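(* Let $(G,K)$ be a compact Gelfand pair and let $\mu$ be a finite positive regular Borel measure on $G$. (1) If $\mu$ is $K$-left-invariant, then $\mu$ has an $L^2$-density (with respect to normalised Haar measure on $G$) if and only if $$\sum_{\pi\in\widehat G_s} d_\pi\,\|\widehat\mu(\pi)\|_{HS}^2=\sum_{\pi\in\widehat G_s} d_\pi\sum_{j=1}^{d_\pi}|\widehat\mu(\pi)_{1j}|^2<\infty .$$ (2) If $\mu$ is $K$-right-invariant, then $\mu$ has an $L^2$-density if and only if $$\sum_{\pi\in\widehat G_s} d_\pi\,\|\widehat\mu(\pi)\|_{HS}^2=\sum_{\pi\in\widehat G_s} d_\pi\sum_{i=1}^{d_\pi}|\widehat\mu(\pi)_{i1}|^2<\infty .$$ (3) If $\mu$ is $K$-bi-invariant, then $\mu$ has an $L^2$-density if and only if $$\sum_{\pi\in\widehat G_s} d_\pi\,|\widehat\mu(\phi_\pi)|^2<\infty .$$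
   Context: A compact Gelfand pair $(G,K)$ consists of a compact Hausdorff group $G$ and a closed subgroup $K$ such that the convolution algebra $L^1(K\backslash G/K)$ of $K$-bi-invariant integrable functions is commutative. Haar measures $m_G$ and $m_K$ are normalised to total mass one. A measure $\mu$ on $G$ is $K$-left-invariant if $\mu(kA)=\mu(A)$, and $K$-right-invariant if $\mu(Ak)=\mu(A)$, for all $k\in K$ and Borel $A\subseteq G$; it is $K$-bi-invariant if both hold. $\mu$ has an $L^2$-density if $\mu$ is absolutely continuous with respect to $m_G$ with $d\mu/dm_G\in L^2(G,m_G)$. $\widehat G$ is the unitary dual of $G$ (equivalence classes of irreducible unitary representations, one representative $\pi$ being fixed in each class), $V_\pi$ is the representation space of $\pi$, and $d_\pi=\dim V_\pi<\infty$. $\pi$ is spherical if there is a non-zero $u_\pi\in V_\pi$ with $\pi(k)u_\pi=u_\pi$ for all $k\in K$; such $u_\pi$ is then unique up to scalars and is taken of norm one. $\widehat G_s\subseteq\widehat G$ is the set of spherical classes. For $\pi\in\widehat G_s$ an orthonormal basis $e_1^\pi,\dots,e_{d_\pi}^\pi$ of $V_\pi$ is fixed with $e_1^\pi=u_\pi$; for other $\pi$ any orthonormal basis is fixed. The inner product is linear in its first slot. Matrix entries of a linear operator $A$ on $V_\pi$ are indexed by $A_{ij}=\langle Ae_i^\pi,e_j^\pi\rangle$. The Fourier transform of $\mu$ is $\widehat\mu(\pi)=\int_G\pi(g^{-1})\,\mu(dg)$. $\|A\|_{HS}^2=\mathrm{tr}(A^*A)$. For $\pi\in\widehat G_s$,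 the spherical function is $\phi_\pi(g)=\langle e_1^\pi,\pi(g)e_1^\pi\rangle$, and the spherical transform of a $K$-bi-invariant $\mu$ is $\widehat\mu(\phi_\pi)=\int_G\phi_\pi(g)\,\mu(dg)$. *)

theory Defs
  imports "HOL-Analysis.Analysis" "Jordan_Normal_Form.Schur_Decomposition"
    "Jordan_Normal_Form.VS_Connect"
begin

text \<open>
  A compact Hausdorff group is a type of sort \<open>{topological_group_add, t2_space}\<close> whose universe is
  compact. The class \<open>group_add\<close> does not assume commutativity; only the notation is additive:
  the product \<open>x y\<close>, the inverse of \<open>x\<close> and the unit are written \<open>x + y\<close>, \<open>- x\<close> and \<open>0\<close>.
\<close>

subsection \<open>Measures on the group\<close>

definition regular_borel_measure :: "'g::topological_space measure \<Rightarrow> bool" where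
  "regular_borel_measure \<mu> \<longleftrightarrow>
     sets \<mu> = sets borel \<and>
     (\<forall>A\<in>sets borel. emeasure \<mu> A = (INF U\<in>{U. open U \<and> A \<subseteq> U}. emeasure \<mu> U)) \<and>
     (\<forall>A\<in>sets borel. emeasure \<mu> A = (SUP C\<in>{C. compact C \<and> C \<subseteq> A}. emeasure \<mu> C))"

definition left_invariant :: "'g::topological_group_add set \<Rightarrow> 'g measure \<Rightarrow> bool" where
  "left_invariant K \<mu> \<longleftrightarrow>
     (\<forall>k\<in>K. \<forall>A\<in>sets borel. emeasure \<mu> ((\<lambda>x. k + x) ` A) = emeasure \<mu> A)"

definition right_invariant :: "'g::topological_group_add set \<Rightarrow> 'g measure \<Rightarrow> bool" where
  "right_invariant K \<mu> \<longleftrightarrow>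
     (\<forall>k\<in>K. \<forall>A\<in>sets borel. emeasure \<mu> ((\<lambda>x. x + k) ` A) = emeasure \<mu> A)"

definition bi_invariant :: "'g::topological_group_add set \<Rightarrow> 'g measure \<Rightarrow> bool" where
  "bi_invariant K \<mu> \<longleftrightarrow> left_invariant K \<mu> \<and> right_invariant K \<mu>"

definition normalised_haar_measure :: "'g::topological_group_add measure \<Rightarrow> bool" where
  "normalised_haar_measure m \<longleftrightarrow>
     regular_borel_measure m \<and> emeasure m UNIV = 1 \<and> left_invariant UNIV m"

definition has_L2_density :: "'g measure \<Rightarrow> 'g measure \<Rightarrow> bool" where
  "has_L2_density m \<mu> \<longleftrightarrow>
     absolutely_continuous m \<mu> \<and> (\<integral>\<^sup>+ x. (RN_deriv m \<mu> x)\<^sup>2 \<partial>m) < \<infinity>"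

subsection \<open>Compact Gelfand pairs\<close>

definition closed_subgroup :: "'g::topological_group_add set \<Rightarrow> bool" where
  "closed_subgroup K \<longleftrightarrow>
     closed K \<and> 0 \<in> K \<and> (\<forall>x\<in>K. \<forall>y\<in>K. x + y \<in> K) \<and> (\<forall>x\<in>K. - x \<in> K)"

definition convolution ::
  "'g::topological_group_add measure \<Rightarrow> ('g \<Rightarrow> complex) \<Rightarrow> ('g \<Rightarrow> complex) \<Rightarrow> 'g \<Rightarrow> complex" where
  "convolution m f g x = (LINT y|m. f y * g (- y + x))"

definition bi_invariant_L1 :: "'g::topological_group_add measure \<Rightarrow> 'g set \<Rightarrow> ('g \<Rightarrow> complex) set" where
  "bi_invariant_L1 m K = {f. integrable m f \<and> (\<forall>k\<in>K. \<forall>k'\<in>K. \<forall>x. f (k + x + k') = f x)}"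

text \<open>The group is the whole type, and \<open>m\<close> is its normalised Haar measure. Elements of the
  convolution algebra are equal when they agree almost everywhere.\<close>

definition compact_gelfand_pair ::
  "'g::{topological_group_add, t2_space} measure \<Rightarrow> 'g set \<Rightarrow> bool" where
  "compact_gelfand_pair m K \<longleftrightarrow>
     compact (UNIV :: 'g set) \<and> normalised_haar_measure m \<and> closed_subgroup K \<and>
     (\<forall>f\<in>bi_invariant_L1 m K. \<forall>g\<in>bi_invariant_L1 m K.
        AE x in m. convolution m f g x = convolution m g f x)"

subsection \<open>Unitary representations and the unitary dual\<close>

text \<open>
  Irreducible unitary representations of a compact group are finite-dimensional, so the
  representation space is taken to be \<open>carrier_vec d\<close> over the complex numbers, with inner product
  \<open>v \<bullet>c w\<close> (linear in \<open>v\<close>, conjugate-linear in \<open>w\<close>).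
\<close>

definition unitary_mat :: "nat \<Rightarrow> complex mat \<Rightarrow> bool" where
  "unitary_mat d U \<longleftrightarrow>
     U \<in> carrier_mat d d \<and> mat_adjoint U * U = 1\<^sub>m d \<and> U * mat_adjoint U = 1\<^sub>m d"

definition rep_dim :: "('g::zero \<Rightarrow> complex mat) \<Rightarrow> nat" where
  "rep_dim \<pi> = dim_row (\<pi> 0)"

definition unitary_rep :: "('g::topological_group_add \<Rightarrow> complex mat) \<Rightarrow> bool" where
  "unitary_rep \<pi> \<longleftrightarrow>
     (\<forall>x. unitary_mat (rep_dim \<pi>) (\<pi> x)) \<and>
     (\<forall>x y. \<pi> (x + y) = \<pi> x * \<pi> y) \<and>
     (\<forall>i<rep_dim \<pi>. \<forall>j<rep_dim \<pi>. continuous_on UNIV (\<lambda>x. \<pi> x $$ (i, j)))"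

definition irreducible_unitary_rep :: "('g::topological_group_add \<Rightarrow> complex mat) \<Rightarrow> bool" where
  "irreducible_unitary_rep \<pi> \<longleftrightarrow>
     unitary_rep \<pi> \<and> rep_dim \<pi> > 0 \<and>
     (\<forall>W. VectorSpace.subspace class_ring W (module_vec TYPE(complex) (rep_dim \<pi>)) \<and>
          (\<forall>x. \<forall>w\<in>W. \<pi> x *\<^sub>v w \<in> W) \<longrightarrow>
        W = {0\<^sub>v (rep_dim \<pi>)} \<or> W = carrier_vec (rep_dim \<pi>))"

definition unitarily_equivalent :: "('g::zero \<Rightarrow> complex mat) \<Rightarrow> ('g \<Rightarrow> complex mat) \<Rightarrow> bool" where
  "unitarily_equivalent \<pi> \<rho> \<longleftrightarrow>
     rep_dim \<pi> = rep_dim \<rho> \<and> (\<exists>U. unitary_mat (rep_dim \<pi>) U \<and> (\<forall>x. U * \<pi> x = \<rho> x * U))"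

text \<open>A system containing exactly one representative of each class of the unitary dual.\<close>

definition dual_representatives :: "('g::topological_group_add \<Rightarrow> complex mat) set \<Rightarrow> bool" where
  "dual_representatives D \<longleftrightarrow>
     (\<forall>\<pi>\<in>D. irreducible_unitary_rep \<pi>) \<and>
     (\<forall>\<pi>. irreducible_unitary_rep \<pi> \<longrightarrow> (\<exists>!\<rho>. \<rho> \<in> D \<and> unitarily_equivalent \<pi> \<rho>))"

definition is_spherical :: "'g::zero set \<Rightarrow> ('g \<Rightarrow> complex mat) \<Rightarrow> bool" where
  "is_spherical K \<pi> \<longleftrightarrow>
     (\<exists>u\<in>carrier_vec (rep_dim \<pi>). u \<noteq> 0\<^sub>v (rep_dim \<pi>) \<and> (\<forall>k\<in>K. \<pi> k *\<^sub>v u = u))"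

definition spherical_part :: "'g::zero set \<Rightarrow> ('g \<Rightarrow> complex mat) set \<Rightarrow> ('g \<Rightarrow> complex mat) set" where
  "spherical_part K D = {\<pi>\<in>D. is_spherical K \<pi>}"

text \<open>Being \<open>d\<close> orthonormal vectors in a \<open>d\<close>-dimensional space, \<open>b 1, \<dots>, b d\<close> form a basis.\<close>

definition orthonormal_basis :: "nat \<Rightarrow> (nat \<Rightarrow> complex vec) \<Rightarrow> bool" where
  "orthonormal_basis d b \<longleftrightarrow>
     (\<forall>i\<in>{1..d}. b i \<in> carrier_vec d) \<and>
     (\<forall>i\<in>{1..d}. \<forall>j\<in>{1..d}. b i \<bullet>c b j = (if i = j then 1 else 0))"

definition adapted_bases ::
  "'g::zero set \<Rightarrow> ('g \<Rightarrow> complex mat) set \<Rightarrow> (('g \<Rightarrow> complex mat) \<Rightarrow> nat \<Rightarrow> complex vec) \<Rightarrow> bool" where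
  "adapted_bases K D e \<longleftrightarrow>
     (\<forall>\<pi>\<in>D. orthonormal_basis (rep_dim \<pi>) (e \<pi>)) \<and>
     (\<forall>\<pi>\<in>spherical_part K D. \<forall>k\<in>K. \<pi> k *\<^sub>v e \<pi> 1 = e \<pi> 1)"

subsection \<open>Fourier and spherical transforms\<close>

definition fourier_transform ::
  "'g::topological_group_add measure \<Rightarrow> ('g \<Rightarrow> complex mat) \<Rightarrow> complex mat" where
  "fourier_transform \<mu> \<pi> =
     mat (rep_dim \<pi>) (rep_dim \<pi>) (\<lambda>(i, j). LINT g|\<mu>. \<pi> (- g) $$ (i, j))"

text \<open>Note the order of the indices: with respect to the usual matrix of \<open>A\<close> in the basis \<open>b\<close>,
  this is the transpose.\<close>

definition matrix_entry :: "(nat \<Rightarrow> complex vec) \<Rightarrow> complex mat \<Rightarrow> nat \<Rightarrow> nat \<Rightarrow> complex" where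
  "matrix_entry b A i j = (A *\<^sub>v b i) \<bullet>c b j"

definition mat_trace :: "complex mat \<Rightarrow> complex" where
  "mat_trace A = (\<Sum>i<dim_row A. A $$ (i, i))"

definition hs_norm :: "complex mat \<Rightarrow> real" where
  "hs_norm A = sqrt (Re (mat_trace (mat_adjoint A * A)))"

definition spherical_function ::
  "(('g \<Rightarrow> complex mat) \<Rightarrow> nat \<Rightarrow> complex vec) \<Rightarrow> ('g \<Rightarrow> complex mat) \<Rightarrow> 'g \<Rightarrow> complex" where
  "spherical_function e \<pi> g = e \<pi> 1 \<bullet>c (\<pi> g *\<^sub>v e \<pi> 1)"

definition spherical_transform :: "'g measure \<Rightarrow> ('g \<Rightarrow> complex) \<Rightarrow> complex" where
  "spherical_transform \<mu> \<phi> = (LINT g|\<mu>. \<phi> g)"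

end

theory Submission
  imports Defs "Jordan_Normal_Form.Spectral_Radius"
begin

text \<open>
  Plancherel: \<open>\<mu>\<close> has an \<open>L\<^sup>2\<close>-density iff \<open>\<Sum>\<^sub>\<pi> d\<^sub>\<pi> \<parallel>\<mu>^(\<pi>)\<parallel>\<^sup>2\<close> over the whole dual is finite. Necessity is
  Bessel's inequality. For sufficiency, the convolution of \<open>\<mu>\<close> with a continuous \<open>h\<close> has an absolutely
  convergent Fourier series, which represents it because a continuous function with vanishing Fourier
  coefficients is zero; evaluation at the unit gives \<open>\<bar>\<integral> h d\<mu>\<bar> \<le> C \<parallel>h\<parallel>\<^sub>2\<close>, and regularity of \<open>\<mu>\<close> turns
  this into an \<open>L\<^sup>2\<close>-density.

  The injectivity of the Fourier transform needs no spectral theorem: if \<open>F \<noteq> 0\<close> has zero coefficients,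
  so has \<open>\<phi> = F * F\<^sup>*\<close>, and suitably normalised convolution powers of \<open>\<phi>\<close> converge uniformly to a non-zero
  self-adjoint idempotent \<open>p\<close> (the projection onto the top eigenspace). The functions \<open>f = f * p\<close> form a
  finite-dimensional translation-invariant space, a minimal invariant subspace of which yields an
  irreducible representation whose coefficients \<open>p\<close> cannot annihilate.

  If \<open>\<mu>\<close> is left (right) \<open>K\<close>-invariant, the range of \<open>\<mu>^(\<pi>)\<^sup>*\<close> (of \<open>\<mu>^(\<pi>)\<close>) consists of \<open>K\<close>-fixed
  vectors. This space vanishes for non-spherical \<open>\<pi>\<close>, and by commutativity of the convolution algebra
  it is spanned by the first basis vector for spherical \<open>\<pi>\<close>, so only one row (column) survives.
\<close>

section \<open>Continuous functions on compact spaces\<close>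

text \<open>The obstacle throughout is that the group need not be metrizable: Borel sets of the
  product may lie outside the product \<sigma>-algebra, continuity cannot be tested along sequences,
  and the dual may be uncountable. Hence most arguments stay with continuous functions. They are
  bounded, measurable for the product \<sigma>-algebra, and zero as soon as their L2 norm is, so no
  quotient or completion is formed. General Borel sets are reached through regularity of both
  measures, and sums over the dual are limits along finite subsets.

  Convolution makes this workable: it is an inner product with a translate, so Cauchy-Schwarz turns
  L2 estimates into uniform ones.

  The roles of rows and columns come from two reversals. The transform integrates
  \<open>\<pi> (- g)\<close>, so left translation of \<mu> acts on the right of the transform and
  only the first column of its usual matrix survives. Entries are indexed by the transpose of that
  matrix, which makes this column the first row.\<close>

lemma compact_space_bounded:
  fixes f :: "'a::topological_space \<Rightarrow> 'b::real_normed_vector"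
  assumes "compact (UNIV :: 'a set)" "continuous_on UNIV f"
  obtains B where "B > 0" "\<And>x. norm (f x) \<le> B"
proof -
  have "bounded (range f)"
    using assms compact_continuous_image compact_imp_bounded by blast
  then show ?thesis using that unfolding bounded_pos by auto
qed

lemma continuous_measurable:
  fixes f :: "'a::topological_space \<Rightarrow> 'b::topological_space"
  assumes "sets M = sets borel" "continuous_on UNIV f"
  shows "f \<in> borel_measurable M"
  using assms borel_measurable_continuous_onI measurable_cong_sets by blast

lemma integrable_continuous:
  fixes f :: "'a::topological_space \<Rightarrow> 'b::{banach, second_countable_topology}"
  assumes "compact (UNIV :: 'a set)" "finite_measure M" "sets M = sets borel"
    "continuous_on UNIV f"
  shows "integrable M f"
proof -
  from compact_space_bounded[OF assms(1,4)]
  obtain B where "\<And>x. norm (f x) \<le> B" by metis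
  then show ?thesis
    using continuous_measurable[OF assms(3,4)]
    by (intro finite_measure.integrable_const_bound[OF assms(2) AE_I2, of f B]) auto
qed

text \<open>Compactness of the second factor gives a neighbourhood of \<open>x\<close> on which
  \<open>F\<close> moves by at most \<open>e'\<close> for all \<open>y\<close> at once. Dominated
  convergence would yield sequential continuity only.\<close>

lemma continuous_parametric_integral:
  fixes F :: "'a::topological_space \<times> 'b::topological_space \<Rightarrow> 'c::{banach, second_countable_topology}"
  assumes "compact (UNIV :: 'b set)" "finite_measure M" "sets M = sets borel"
    and cont: "continuous_on UNIV F"
  shows "continuous_on UNIV (\<lambda>x. LINT y|M. F (x, y))"
proof -
  interpret finite_measure M by fact
  let ?c = "measure M (space M)"
  have slice: "integrable M (\<lambda>y. F (x, y))" for x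
    by (rule integrable_continuous[OF assms(1-3)], rule continuous_on_compose2[OF cont])
       (auto intro!: continuous_intros)
  show ?thesis unfolding continuous_on_topological
  proof (intro ballI allI impI)
    fix x B assume B: "open B" "(LINT y|M. F (x, y)) \<in> B"
    then obtain e where e: "e > 0" "\<And>z. dist z (LINT y|M. F (x, y)) < e \<Longrightarrow> z \<in> B"
      unfolding open_dist by metis
    \<comment> \<open>Adding 1 to the mass keeps the denominator positive for the zero
      measure.\<close>
    define e' where "e' = e / (2 * (?c + 1))"
    have c0: "?c \<ge> 0" by simp
    then have "e' > 0" using e(1) by (simp add: e'_def add_nonneg_pos)
    moreover have "continuous_on (UNIV \<times> UNIV) F" using cont by simp
    ultimately obtain X where X: "x \<in> X" "open X"
      "\<forall>x'\<in>X \<inter> UNIV. \<forall>t\<in>UNIV. dist (F (x', t)) (F (x, t)) \<le> e'"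
      using assms(1) by (elim continuous_on_prod_compactE[of UNIV UNIV F x e']) auto
    have "(LINT y|M. F (x', y)) \<in> B" if "x' \<in> X" for x'
    proof (rule e(2))
      have "norm (LINT y|M. F (x', y) - F (x, y)) \<le> (LINT y|M. e')"
        using X(3) that by (intro integral_norm_bound[THEN order_trans] integral_mono
          integrable_norm Bochner_Integration.integrable_diff slice) (auto simp: dist_norm)
      also have "\<dots> = ?c * e'" by simp
      also have "\<dots> < e"
      proof -
        have "e * (2 * (?c + 1)) = ?c * e + (e * ?c + 2 * e)"
          unfolding distrib_left mult_2 by (simp add: mult.commute)
        moreover have "0 \<le> e * ?c" using c0 e(1) by simp
        ultimately have "?c * e < e * (2 * (?c + 1))" using e(1) by linarith
        then show ?thesis unfolding e'_def using c0 by (simp add: pos_divide_less_eq add_nonneg_pos)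
      qed
      finally show "dist (LINT y|M. F (x', y)) (LINT y|M. F (x, y)) < e"
        using slice by (simp add: dist_norm)
    qed
    then show "\<exists>A. open A \<and> x \<in> A \<and> (\<forall>y\<in>UNIV. y \<in> A \<longrightarrow> (LINT ya|M. F (y, ya)) \<in> B)"
      using X(1,2) by blast
  qed
qed

text \<open>The Borel sets of a product of non-metrizable compact spaces need not be generated by
  rectangles, but continuous functions are still measurable with respect to the product
  \<open>\<sigma>\<close>-algebra: they are uniform limits of functions depending on the first coordinate only through
  a finite partition.\<close>

lemma continuous_measurable_pair:
  fixes F :: "'a::topological_space \<times> 'b::topological_space \<Rightarrow> 'c::real_normed_vector"
  assumes "compact (UNIV :: 'a set)" "compact (UNIV :: 'b set)"
    and M: "sets M = sets borel" and N: "sets N = sets borel"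
    and cont: "continuous_on UNIV F"
  shows "F \<in> borel_measurable (M \<Otimes>\<^sub>M N)"
proof -
  have "\<exists>G. G \<in> borel_measurable (M \<Otimes>\<^sub>M N) \<and> (\<forall>p. dist (G p) (F p) \<le> e)" if e: "e > 0" for e
  proof -
    have "\<exists>X. x \<in> X \<and> open X \<and> (\<forall>x'\<in>X. \<forall>t. dist (F (x', t)) (F (x, t)) \<le> e)" for x
    proof -
      obtain X where "x \<in> X" "open X"
        "\<forall>x'\<in>X \<inter> UNIV. \<forall>t\<in>UNIV. dist (F (x', t)) (F (x, t)) \<le> e"
        by (rule continuous_on_prod_compactE[of UNIV UNIV F x e]) (use assms(2) cont e in auto)
      then show ?thesis by auto
    qed
    then obtain X where X: "\<And>x. x \<in> X x" "\<And>x. open (X x)"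
      "\<And>x x' t. x' \<in> X x \<Longrightarrow> dist (F (x', t)) (F (x, t)) \<le> e" by metis
    have cover: "(UNIV :: 'a set) \<subseteq> (\<Union>c\<in>UNIV. X c)" using X(1) by auto
    obtain C where C: "finite C" "(UNIV :: 'a set) \<subseteq> (\<Union>c\<in>C. X c)"
      by (rule compactE_image[OF assms(1) _ cover]) (use X(2) in auto)
    obtain c :: "nat \<Rightarrow> 'a" and n where cn: "C = c ` {i. i < n}"
      using finite_imp_nat_seg_image_inj_on[OF C(1)] by blast
    \<comment> \<open>Taking the least index of a covering open set makes the choice of centre a
      measurable function with values in a countable set.\<close>
    define i where "i x = (LEAST i. x \<in> X (c i))" for x
    have i: "x \<in> X (c (i x))" for x
    proof -
      from C(2) obtain j where "x \<in> X (c j)" using cn by auto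
      then show ?thesis unfolding i_def by (rule LeastI)
    qed
    have Xm: "X (c j) \<in> sets M" for j using X(2) M by simp
    have "{x \<in> space M. x \<in> X (c j)} \<in> sets M" for j
      using Xm[of j] sets.sets_into_space[OF Xm[of j]] by (simp add: Collect_conj_eq Int_absorb1)
    then have "i \<in> measurable M (count_space UNIV)"
      unfolding i_def by (intro measurable_Least) (simp add: pred_def)
    then have im: "(\<lambda>p. i (fst p)) \<in> measurable (M \<Otimes>\<^sub>M N) (count_space UNIV)"
      by (rule measurable_compose[OF measurable_fst])
    have "(\<lambda>p. F (c j, snd p)) \<in> borel_measurable (M \<Otimes>\<^sub>M N)" for j
    proof (rule measurable_compose[OF measurable_snd])
      show "(\<lambda>y. F (c j, y)) \<in> borel_measurable N"
        by (rule continuous_measurable[OF N], rule continuous_on_compose2[OF cont])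
           (auto intro!: continuous_intros)
    qed
    from measurable_compose_countable'[OF this im] 
    have "(\<lambda>p. F (c (i (fst p)), snd p)) \<in> borel_measurable (M \<Otimes>\<^sub>M N)" by simp
    moreover have "dist (F (c (i (fst p)), snd p)) (F p) \<le> e" for p
      using X(3)[OF i[of "fst p"], of "snd p"] by (simp add: dist_commute)
    ultimately show ?thesis by blast
  qed
  then have "\<forall>n. \<exists>G. G \<in> borel_measurable (M \<Otimes>\<^sub>M N) \<and> (\<forall>p. dist (G p) (F p) \<le> inverse (real (Suc n)))"
    by simp
  then obtain G where G: "\<And>n. G n \<in> borel_measurable (M \<Otimes>\<^sub>M N)"
    "\<And>n p. dist (G n p) (F p) \<le> inverse (real (Suc n))" by metis
  show ?thesis
  proof (rule borel_measurable_LIMSEQ_metric[OF G(1)])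
    fix p
    show "(\<lambda>n. G n p) \<longlonglongrightarrow> F p"
      by (rule metric_tendsto_imp_tendsto[OF LIMSEQ_inverse_real_of_nat])
         (use G(2) in \<open>auto intro!: always_eventually simp: dist_norm\<close>)
  qed
qed

text \<open>A bounded integrand on a finite product measure is integrable once it is measurable for
  the product \<sigma>-algebra, which \<open>continuous_measurable_pair\<close> supplies.\<close>

lemma Fubini_continuous:
  fixes F :: "'a::topological_space \<Rightarrow> 'b::topological_space \<Rightarrow> 'c::{banach, second_countable_topology}"
  assumes "compact (UNIV :: 'a set)" "compact (UNIV :: 'b set)"
    and M: "finite_measure M" "sets M = sets borel" and N: "finite_measure N" "sets N = sets borel"
    and cont: "continuous_on UNIV (\<lambda>p. F (fst p) (snd p))"
  shows "(LINT x|M. LINT y|N. F x y) = (LINT y|N. LINT x|M. F x y)"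
proof -
  interpret M: finite_measure M by fact
  interpret N: finite_measure N by fact
  interpret pair_sigma_finite M N ..
  have fin: "finite_measure (M \<Otimes>\<^sub>M N)"
    by (rule finite_measureI)
       (simp add: space_pair_measure N.emeasure_pair_measure_Times ennreal_mult_eq_top_iff
         M.emeasure_finite N.emeasure_finite)
  have "compact (UNIV :: ('a \<times> 'b) set)"
    using compact_Times[OF assms(1,2)] by simp
  from compact_space_bounded[OF this cont]
  obtain B where B: "\<And>p. norm (F (fst p) (snd p)) \<le> B" by metis
  have "integrable (M \<Otimes>\<^sub>M N) (\<lambda>p. F (fst p) (snd p))"
    by (rule finite_measure.integrable_const_bound[OF fin AE_I2, of _ B])
       (use continuous_measurable_pair[OF assms(1,2) M(2) N(2) cont] B in auto)
  then have "integrable (M \<Otimes>\<^sub>M N) (case_prod F)" by (simp add: case_prod_beta')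
  then show ?thesis by (rule Fubini_integral[symmetric])
qed

section \<open>Haar measure and square-integrable functions\<close>

text \<open>The images under \<open>S\<close> match the invariance definitions, which move sets. As
  \<open>S\<close> inverts \<open>T\<close>, the image of \<open>A\<close> under \<open>S\<close> is
  its preimage under \<open>T\<close>, so \<open>M\<close> is its own push-forward.\<close>

lemma integral_measure_preserving:
  fixes f :: "'a::topological_space \<Rightarrow> 'b::{banach, second_countable_topology}"
  assumes M: "sets M = sets borel" and T: "continuous_on UNIV T" and f: "continuous_on UNIV f"
    and inverse: "\<And>x. S (T x) = x" "\<And>x. T (S x) = x"
    and preserving: "\<And>A. A \<in> sets borel \<Longrightarrow> emeasure M (S ` A) = emeasure M A"
  shows "(LINT x|M. f (T x)) = (LINT x|M. f x)"
proof -
  have T': "T \<in> measurable M borel" by (rule continuous_measurable[OF M T])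
  have "distr M borel T = M"
  proof (rule measure_eqI)
    fix A assume "A \<in> sets (distr M borel T)"
    then have A: "A \<in> sets borel" by simp
    have "T -` A = S ` A"
    proof safe
      fix x assume "T x \<in> A"
      then show "x \<in> S ` A" by (rule image_eqI[rotated]) (simp add: inverse)
    qed (simp add: inverse)
    moreover have "space M = UNIV" using sets_eq_imp_space_eq[OF M] by simp
    ultimately show "emeasure (distr M borel T) A = emeasure M A"
      using A by (simp add: emeasure_distr[OF T'] preserving)
  qed (simp add: M)
  then show ?thesis
    using integral_distr[OF T', of f] borel_measurable_continuous_onI[OF f] by simp
qed

text \<open>Translating the argument by \<open>a\<close> corresponds to moving sets by
  \<open>- a\<close>, which is why \<open>- a\<close> is required to lie in
  \<open>K\<close>.\<close>

lemma integral_left_translate: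
  fixes f :: "'g::topological_group_add \<Rightarrow> 'b::{banach, second_countable_topology}"
  assumes "sets M = sets borel" "left_invariant K M" "- a \<in> K" "continuous_on UNIV f"
  shows "(LINT x|M. f (a + x)) = (LINT x|M. f x)"
  by (rule integral_measure_preserving[where S = "\<lambda>x. - a + x"])
     (use assms in \<open>auto simp: left_invariant_def intro!: continuous_intros\<close>)

lemma integral_right_translate:
  fixes f :: "'g::topological_group_add \<Rightarrow> 'b::{banach, second_countable_topology}"
  assumes "sets M = sets borel" "right_invariant K M" "- a \<in> K" "continuous_on UNIV f"
  shows "(LINT x|M. f (x + a)) = (LINT x|M. f x)"
  by (rule integral_measure_preserving[where S = "\<lambda>x. x + - a"])
     (use assms in \<open>auto simp: right_invariant_def intro!: continuous_intros simp del: add_uminus_conv_diff,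
       simp_all add: add.assoc\<close>)

lemma cont_compose:
  "continuous_on UNIV f \<Longrightarrow> continuous_on A g \<Longrightarrow> continuous_on A (\<lambda>x. f (g x))"
  by (rule continuous_on_compose2) auto

definition star :: "('g::group_add \<Rightarrow> complex) \<Rightarrow> 'g \<Rightarrow> complex" where
  "star f x = cnj (f (- x))"

lemma continuous_star [continuous_intros]:
  fixes f :: "'g::topological_group_add \<Rightarrow> complex"
  shows "continuous_on UNIV f \<Longrightarrow> continuous_on UNIV (star f)"
  unfolding star_def
  by (rule continuous_on_cnj, erule cont_compose) (intro continuous_intros)

locale compact_group =
  fixes m :: "'g::{topological_group_add, t2_space} measure"
  assumes compact_UNIV: "compact (UNIV :: 'g set)"
    and haar: "normalised_haar_measure m"
begin

lemma sets_m: "sets m = sets borel"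
  and left_inv: "left_invariant UNIV m"
  and emeasure_m_UNIV: "emeasure m UNIV = 1"
  using haar by (auto simp: normalised_haar_measure_def regular_borel_measure_def)

lemma space_m [simp]: "space m = UNIV"
  using sets_eq_imp_space_eq[OF sets_m] by simp

lemma finite_m: "finite_measure m"
  by (rule finite_measureI) (simp add: space_m emeasure_m_UNIV)

lemma measure_m_UNIV [simp]: "measure m UNIV = 1"
  by (simp add: measure_def emeasure_m_UNIV)

sublocale finite_measure m by (rule finite_m)

lemma integral_const_m [simp]: "(LINT x|m. c) = (c :: 'b::{banach, second_countable_topology})"
  by (simp add: space_m measure_m_UNIV)

lemma integrable_cont:
  "continuous_on UNIV f \<Longrightarrow> integrable m (f :: 'g \<Rightarrow> 'b::{banach, second_countable_topology})"
  by (rule integrable_continuous[OF compact_UNIV finite_m sets_m])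

lemma integral_left:
  "continuous_on UNIV f \<Longrightarrow> (LINT x|m. f (a + x)) = (LINT x|m. (f :: 'g \<Rightarrow> 'b::{banach, second_countable_topology}) x)"
  by (rule integral_left_translate[OF sets_m left_inv]) auto

lemma Fubini_m:
  "continuous_on UNIV (\<lambda>p. F (fst p) (snd p)) \<Longrightarrow>
   (LINT x|m. LINT y|m. (F :: 'g \<Rightarrow> 'g \<Rightarrow> 'b::{banach, second_countable_topology}) x y) = (LINT y|m. LINT x|m. F x y)"
  by (rule Fubini_continuous[OF compact_UNIV compact_UNIV finite_m sets_m finite_m sets_m])

text \<open>Unimodularity from left invariance alone: in the double integral of
  \<open>f (- y + x)\<close>, integrating over \<open>x\<close> first gives the integral of
  \<open>f\<close>, and over \<open>y\<close> first that of its reflection.\<close>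

lemma integral_inverse:
  fixes f :: "'g \<Rightarrow> 'b::{banach, second_countable_topology}"
  assumes f: "continuous_on UNIV f"
  shows "(LINT x|m. f (- x)) = (LINT x|m. f x)"
proof -
  have f': "continuous_on UNIV (\<lambda>x. f (- x))"
    by (intro cont_compose[OF f] continuous_intros)
  have "(LINT x|m. f x) = (LINT y|m. LINT x|m. f (- y + x))"
    by (simp add: integral_left[OF f])
  also have "\<dots> = (LINT x|m. LINT y|m. f (- y + x))"
    by (rule Fubini_m) (intro cont_compose[OF f] continuous_intros)
  also have "\<dots> = (LINT x|m. LINT y|m. f (- (- x + y)))"
    by (simp add: minus_add)
  also have "\<dots> = (LINT x|m. f (- x))"
    using integral_left[OF f'] by simp
  finally show ?thesis by simp
qed

text \<open>Finitely many translates of \<open>U\<close> cover the compact group; if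
  \<open>U\<close> were null, so would they all be, against total mass one.\<close>

lemma emeasure_open_pos:
  assumes "open U" "U \<noteq> {}"
  shows "emeasure m U > 0"
proof (rule ccontr)
  assume "\<not> emeasure m U > 0"
  then have 0: "emeasure m U = 0" by simp
  obtain u where u: "u \<in> U" using assms by auto
  have tr: "(\<lambda>x. a + x) ` U = (\<lambda>x. - a + x) -` U" for a
  proof safe
    fix x assume "- a + x \<in> U"
    then show "x \<in> (\<lambda>x. a + x) ` U" by (rule image_eqI[rotated]) (simp only: add.assoc[symmetric] right_minus add_0_left)
  qed (simp only: add.assoc[symmetric] left_minus add_0_left vimage_eq)
  have op: "open ((\<lambda>x. a + x) ` U)" for a
    unfolding tr by (rule open_vimage[OF assms(1)]) (intro continuous_intros)
  have "x \<in> (\<lambda>y. (x + - u) + y) ` U" for x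
    using u by (intro image_eqI[of _ _ u]) (auto simp: add.assoc)
  then have cover: "(UNIV :: 'g set) \<subseteq> (\<Union>a\<in>UNIV. (\<lambda>x. a + x) ` U)" by blast
  obtain C where C: "finite C" "(UNIV :: 'g set) \<subseteq> (\<Union>a\<in>C. (\<lambda>x. a + x) ` U)"
    by (rule compactE_image[OF compact_UNIV _ cover]) (use op in auto)
  have null: "(\<lambda>x. a + x) ` U \<in> null_sets m" for a
  proof
    show "emeasure m ((\<lambda>x. a + x) ` U) = 0"
      using left_inv 0 assms(1) by (simp add: left_invariant_def)
    show "(\<lambda>x. a + x) ` U \<in> sets m" using op[of a] by (simp add: sets_m)
  qed
  have "(\<Union>a\<in>C. (\<lambda>x. a + x) ` U) \<in> null_sets m"
    using C(1) null by (intro null_sets_UN' countable_finite) auto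
  moreover have "(\<Union>a\<in>C. (\<lambda>x. a + x) ` U) = UNIV" using C(2) by auto
  ultimately show False using emeasure_m_UNIV by auto
qed

lemma AE_continuous_zero:
  fixes f :: "'g \<Rightarrow> 'b::real_normed_vector"
  assumes f: "continuous_on UNIV f" and ae: "AE x in m. f x = 0"
  shows "f x = 0"
proof (rule ccontr)
  assume "f x \<noteq> 0"
  then have ne: "{x. f x \<noteq> 0} \<noteq> {}" by auto
  have op: "open {x. f x \<noteq> 0}"
    by (rule open_Collect_neq[OF f]) (intro continuous_intros)
  have "{x \<in> space m. \<not> f x = 0} \<in> null_sets m"
    using ae op by (subst AE_iff_null[symmetric]) (simp_all add: sets_m)
  then show False using emeasure_open_pos[OF op ne] by (auto simp: space_m)
qed

section \<open>The L2 inner product, Bessel and Cauchy-Schwarz\<close>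

definition ip :: "('g \<Rightarrow> complex) \<Rightarrow> ('g \<Rightarrow> complex) \<Rightarrow> complex" where
  "ip f g = (LINT x|m. f x * cnj (g x))"

definition nsq :: "('g \<Rightarrow> complex) \<Rightarrow> real" where
  "nsq f = (LINT x|m. (cmod (f x))\<^sup>2)"

definition sqint :: "('g \<Rightarrow> complex) \<Rightarrow> bool" where
  "sqint f \<longleftrightarrow> f \<in> borel_measurable m \<and> integrable m (\<lambda>x. (cmod (f x))\<^sup>2)"

lemma cont_sqint: "continuous_on UNIV f \<Longrightarrow> sqint f"
  unfolding sqint_def
  by (auto intro!: continuous_measurable[OF sets_m] integrable_cont continuous_intros)

lemma sqint_integrable_mult:
  assumes "sqint f" "sqint g"
  shows "integrable m (\<lambda>x. f x * cnj (g x))"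
proof (rule Bochner_Integration.integrable_bound)
  show "integrable m (\<lambda>x. (cmod (f x))\<^sup>2 + (cmod (g x))\<^sup>2)"
    using assms by (auto simp: sqint_def)
  have [measurable]: "f \<in> borel_measurable m" "g \<in> borel_measurable m"
    using assms by (auto simp: sqint_def)
  show "(\<lambda>x. f x * cnj (g x)) \<in> borel_measurable m"
    by (intro borel_measurable_times borel_measurable_continuous_on[OF continuous_on_cnj[OF continuous_on_id]]) auto
  show "AE x in m. norm (f x * cnj (g x)) \<le> norm ((cmod (f x))\<^sup>2 + (cmod (g x))\<^sup>2)"
  proof (rule AE_I2)
    fix x
    have "0 \<le> (cmod (f x) - cmod (g x))\<^sup>2" "0 \<le> (cmod (f x))\<^sup>2" "0 \<le> (cmod (g x))\<^sup>2" by simp_all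
    then have "cmod (f x) * cmod (g x) \<le> (cmod (f x))\<^sup>2 + (cmod (g x))\<^sup>2"
      unfolding power2_diff by linarith
    then show "norm (f x * cnj (g x)) \<le> norm ((cmod (f x))\<^sup>2 + (cmod (g x))\<^sup>2)"
      by (simp add: norm_mult)
  qed
qed

lemma sqint_scale: "sqint f \<Longrightarrow> sqint (\<lambda>x. c * f x)"
  by (auto simp: sqint_def norm_mult power_mult_distrib)

lemma sqint_add:
  assumes "sqint f" "sqint g"
  shows "sqint (\<lambda>x. f x + g x)"
  unfolding sqint_def
proof
  have [measurable]: "f \<in> borel_measurable m" "g \<in> borel_measurable m"
    using assms by (auto simp: sqint_def)
  show "(\<lambda>x. f x + g x) \<in> borel_measurable m" by simp
  show "integrable m (\<lambda>x. (cmod (f x + g x))\<^sup>2)"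
  proof (rule Bochner_Integration.integrable_bound)
    show "integrable m (\<lambda>x. 2 * (cmod (f x))\<^sup>2 + 2 * (cmod (g x))\<^sup>2)"
      using assms by (auto simp: sqint_def)
    show "AE x in m. norm ((cmod (f x + g x))\<^sup>2) \<le> norm (2 * (cmod (f x))\<^sup>2 + 2 * (cmod (g x))\<^sup>2)"
    proof (rule AE_I2)
      fix x
      have "(cmod (f x + g x))\<^sup>2 \<le> (cmod (f x) + cmod (g x))\<^sup>2"
        by (intro power_mono norm_triangle_ineq) simp
      also have "\<dots> \<le> 2 * (cmod (f x))\<^sup>2 + 2 * (cmod (g x))\<^sup>2"
        using zero_le_power2[of "cmod (f x) - cmod (g x)"]
        unfolding power2_diff power2_sum by linarith
      finally show "norm ((cmod (f x + g x))\<^sup>2) \<le> norm (2 * (cmod (f x))\<^sup>2 + 2 * (cmod (g x))\<^sup>2)"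
        by simp
    qed
  qed simp
qed

lemma sqint_zero: "sqint (\<lambda>x. 0)"
  by (simp add: sqint_def)

lemma sqint_sum: "(\<And>i. i \<in> I \<Longrightarrow> sqint (f i)) \<Longrightarrow> sqint (\<lambda>x. \<Sum>i\<in>I. f i x)"
  by (induction I rule: infinite_finite_induct) (auto intro!: sqint_zero sqint_add)

lemma ip_cnj: "ip g f = cnj (ip f g)"
  unfolding ip_def by (subst Bochner_Integration.integral_cnj[symmetric]) (simp add: mult.commute)

lemma ip_self: "ip f f = of_real (nsq f)"
  unfolding ip_def nsq_def complex_norm_square[symmetric] by (rule integral_complex_of_real)

lemma nsq_nonneg: "nsq f \<ge> 0"
  unfolding nsq_def by (intro Bochner_Integration.integral_nonneg) simp

lemma ip_add_left: "sqint f \<Longrightarrow> sqint g \<Longrightarrow> sqint h \<Longrightarrow> ip (\<lambda>x. f x + g x) h = ip f h + ip g h"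
  unfolding ip_def distrib_right
  by (intro Bochner_Integration.integral_add sqint_integrable_mult)

lemma ip_scale_left: "ip (\<lambda>x. c * f x) h = c * ip f h"
  unfolding ip_def mult.assoc by (rule integral_mult_right_zero)

lemma ip_sum_left:
  "(\<And>i. i \<in> I \<Longrightarrow> sqint (f i)) \<Longrightarrow> sqint h \<Longrightarrow> ip (\<lambda>x. \<Sum>i\<in>I. f i x) h = (\<Sum>i\<in>I. ip (f i) h)"
  unfolding ip_def sum_distrib_right
  by (intro Bochner_Integration.integral_sum sqint_integrable_mult)

lemma ip_add_right: "sqint f \<Longrightarrow> sqint g \<Longrightarrow> sqint h \<Longrightarrow> ip h (\<lambda>x. f x + g x) = ip h f + ip h g"
  by (subst (1 2 3) ip_cnj) (simp add: ip_add_left)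

lemma ip_scale_right: "ip h (\<lambda>x. c * f x) = cnj c * ip h f"
  by (subst (1 2) ip_cnj) (simp add: ip_scale_left)

lemma ip_sum_right:
  "(\<And>i. i \<in> I \<Longrightarrow> sqint (f i)) \<Longrightarrow> sqint h \<Longrightarrow> ip h (\<lambda>x. \<Sum>i\<in>I. f i x) = (\<Sum>i\<in>I. ip h (f i))"
  by (subst (1 2) ip_cnj) (simp add: ip_sum_left)

lemma nsq_add:
  assumes "sqint f" "sqint g"
  shows "nsq (\<lambda>x. f x + g x) = nsq f + nsq g + 2 * Re (ip f g)"
proof -
  have "of_real (nsq (\<lambda>x. f x + g x)) = ip (\<lambda>x. f x + g x) (\<lambda>x. f x + g x)"
    by (simp add: ip_self)
  also have "\<dots> = ip f f + ip f g + (ip g f + ip g g)"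
    using assms by (simp add: ip_add_left ip_add_right sqint_add)
  finally have "Re (of_real (nsq (\<lambda>x. f x + g x))) = Re (ip f f + ip f g + (ip g f + ip g g))" by simp
  then show ?thesis by (simp add: ip_self ip_cnj[of g f])
qed

lemma nsq_scale: "nsq (\<lambda>x. c * f x) = (cmod c)\<^sup>2 * nsq f"
  unfolding nsq_def norm_mult power_mult_distrib by simp

lemma nsq_zero_cont:
  assumes f: "continuous_on UNIV f" and 0: "nsq f = 0"
  shows "f x = 0"
proof (rule AE_continuous_zero[OF f])
  have i: "integrable m (\<lambda>x. (cmod (f x))\<^sup>2)"
    using f by (intro integrable_cont continuous_intros)
  have "AE x in m. (cmod (f x))\<^sup>2 = 0"
    using 0 unfolding nsq_def by (subst (asm) integral_nonneg_eq_0_iff_AE[OF i]) auto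
  then show "AE x in m. f x = 0" by simp
qed

lemma Bessel:
  assumes I: "finite I" and b: "\<And>i. i \<in> I \<Longrightarrow> sqint (b i)" and f: "sqint f"
    and orth: "\<And>i j. i \<in> I \<Longrightarrow> j \<in> I \<Longrightarrow> ip (b i) (b j) = (if i = j then 1 else 0)"
  shows "(\<Sum>i\<in>I. (cmod (ip f (b i)))\<^sup>2) \<le> nsq f"
proof -
  let ?c = "\<lambda>i. ip f (b i)"
  let ?p = "\<lambda>x. \<Sum>i\<in>I. ?c i * b i x"
  let ?S = "\<Sum>i\<in>I. (cmod (?c i))\<^sup>2"
  have sb: "sqint (\<lambda>x. ?c i * b i x)" if "i \<in> I" for i using b that by (intro sqint_scale)
  have p: "sqint ?p" by (rule sqint_sum) (rule sb)
  have "ip f ?p = (\<Sum>i\<in>I. cnj (?c i) * ?c i)"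
    by (simp add: ip_sum_right[OF sb f] ip_scale_right)
  then have fp: "ip f ?p = of_real ?S"
    by (simp add: complex_norm_square mult.commute del: of_real_power)
  have "ip ?p ?p = (\<Sum>i\<in>I. ?c i * ip (b i) ?p)"
    by (simp add: ip_sum_left[OF sb p] ip_scale_left)
  also have "\<dots> = (\<Sum>i\<in>I. ?c i * (\<Sum>j\<in>I. cnj (?c j) * ip (b i) (b j)))"
    using b by (simp add: ip_sum_right[OF sb] ip_scale_right cong: sum.cong)
  also have "\<dots> = (\<Sum>i\<in>I. ?c i * cnj (?c i))"
    using I by (intro sum.cong refl) (simp add: orth if_distrib[of "\<lambda>z. _ * z"] cong: if_cong)
  also have "\<dots> = of_real ?S"
    by (simp add: complex_norm_square del: of_real_power)
  finally have pp: "nsq ?p = ?S"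
    unfolding ip_self of_real_eq_iff .
  have "0 \<le> nsq (\<lambda>x. f x + (-1) * ?p x)" by (rule nsq_nonneg)
  also have "\<dots> = nsq f + nsq ?p - 2 * ?S"
    by (subst nsq_add[OF f sqint_scale[OF p]])
       (simp only: nsq_scale ip_scale_right fp, simp)
  finally show ?thesis using pp by simp
qed

text \<open>Bessel's inequality for the single vector \<open>g\<close> after normalisation; if
  \<open>nsq g = 0\<close>, then \<open>g\<close> vanishes almost everywhere and so does the
  product.\<close>

lemma Cauchy_Schwarz:
  assumes "sqint f" "sqint g"
  shows "(cmod (ip f g))\<^sup>2 \<le> nsq f * nsq g"
proof (cases "nsq g = 0")
  case False
  then have pos: "nsq g > 0" using nsq_nonneg[of g] by simp
  define c where "c = complex_of_real (1 / sqrt (nsq g))"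
  have cc: "cmod c = 1 / sqrt (nsq g)" using pos by (simp add: c_def norm_divide)
  have "ip (\<lambda>x. c * g x) (\<lambda>x. c * g x) = 1"
    unfolding ip_self nsq_scale cc using pos by (simp add: power_divide)
  then have "(\<Sum>i\<in>{()}. (cmod (ip f (\<lambda>x. c * g x)))\<^sup>2) \<le> nsq f"
    using assms by (intro Bessel) (auto intro: sqint_scale)
  then have "(cmod (ip f g))\<^sup>2 / nsq g \<le> nsq f"
    using pos by (simp add: ip_scale_right norm_mult cc power_mult_distrib power_divide)
  then show ?thesis using pos by (simp add: pos_divide_le_eq)
next
  case True
  have i: "integrable m (\<lambda>x. (cmod (g x))\<^sup>2)" using assms by (simp add: sqint_def)
  have "AE x in m. (cmod (g x))\<^sup>2 = 0"
    using True unfolding nsq_def by (subst (asm) integral_nonneg_eq_0_iff_AE[OF i]) auto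
  then have "ip f g = 0" unfolding ip_def by (intro integral_eq_zero_AE) auto
  then show ?thesis by (simp add: True)
qed

lemma Cauchy_Schwarz_sqrt:
  "sqint f \<Longrightarrow> sqint g \<Longrightarrow> cmod (ip f g) \<le> sqrt (nsq f) * sqrt (nsq g)"
  using Cauchy_Schwarz[of f g] by (metis real_le_rsqrt real_sqrt_mult)

end

section \<open>Schur orthogonality\<close>

lemma mat_adjoint_carrier: "A \<in> carrier_mat n k \<Longrightarrow> mat_adjoint A \<in> carrier_mat k n"
  unfolding mat_adjoint_def by auto

lemma index_mat_adjoint:
  fixes A :: "complex mat"
  shows "A \<in> carrier_mat n k \<Longrightarrow> i < k \<Longrightarrow> j < n \<Longrightarrow> mat_adjoint A $$ (i, j) = cnj (A $$ (j, i))"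
  unfolding mat_adjoint_def by (auto simp: mat_of_rows_index)

lemma index_mult_mat_sum:
  assumes "A \<in> carrier_mat n k" "B \<in> carrier_mat k l" "i < n" "j < l"
  shows "(A * B) $$ (i, j) = (\<Sum>a<k. A $$ (i, a) * B $$ (a, j))"
  using assms by (auto simp: scalar_prod_def lessThan_atLeast0)

lemma mat_adjoint_one: "mat_adjoint (1\<^sub>m n :: complex mat) = 1\<^sub>m n"
proof -
  have "mat_adjoint (1\<^sub>m n :: complex mat) \<in> carrier_mat n n" by (rule mat_adjoint_carrier) simp
  then show ?thesis by (intro eq_matI) (auto simp: index_mat_adjoint[of _ n n])
qed

lemma mat_adjoint_mult:
  fixes A B :: "complex mat"
  assumes A: "A \<in> carrier_mat n k" and B: "B \<in> carrier_mat k l"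
  shows "mat_adjoint (A * B) = mat_adjoint B * mat_adjoint A"
proof (rule eq_matI)
  have AB: "A * B \<in> carrier_mat n l" using A B by simp
  note ca = mat_adjoint_carrier[OF A] and cb = mat_adjoint_carrier[OF B] and cab = mat_adjoint_carrier[OF AB]
  show "dim_row (mat_adjoint (A * B)) = dim_row (mat_adjoint B * mat_adjoint A)"
    "dim_col (mat_adjoint (A * B)) = dim_col (mat_adjoint B * mat_adjoint A)"
    using ca cb cab by auto
  fix i j assume "i < dim_row (mat_adjoint B * mat_adjoint A)" "j < dim_col (mat_adjoint B * mat_adjoint A)"
  then have i: "i < l" and j: "j < n" using ca cb by auto
  have "mat_adjoint (A * B) $$ (i, j) = cnj ((A * B) $$ (j, i))"
    by (rule index_mat_adjoint[OF AB i j])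
  also have "\<dots> = (\<Sum>a<k. cnj (A $$ (j, a)) * cnj (B $$ (a, i)))"
    by (simp add: index_mult_mat_sum[OF A B j i])
  also have "\<dots> = (mat_adjoint B * mat_adjoint A) $$ (i, j)"
    unfolding index_mult_mat_sum[OF cb ca i j]
    using i j by (intro sum.cong) (auto simp: index_mat_adjoint[OF A] index_mat_adjoint[OF B] mult.commute)
  finally show "mat_adjoint (A * B) $$ (i, j) = (mat_adjoint B * mat_adjoint A) $$ (i, j)" .
qed

context
  fixes \<pi> :: "'g::topological_group_add \<Rightarrow> complex mat"
  assumes rep: "unitary_rep \<pi>"
begin

lemma rep_carrier: "\<pi> x \<in> carrier_mat (rep_dim \<pi>) (rep_dim \<pi>)"
  using rep by (simp add: unitary_rep_def unitary_mat_def)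

lemma rep_adjoint: "mat_adjoint (\<pi> x) * \<pi> x = 1\<^sub>m (rep_dim \<pi>)" "\<pi> x * mat_adjoint (\<pi> x) = 1\<^sub>m (rep_dim \<pi>)"
  using rep by (simp_all add: unitary_rep_def unitary_mat_def)

lemma rep_add: "\<pi> (x + y) = \<pi> x * \<pi> y"
  using rep by (simp add: unitary_rep_def)

lemma rep_add_entry:
  "i < rep_dim \<pi> \<Longrightarrow> j < rep_dim \<pi> \<Longrightarrow>
    \<pi> (x + y) $$ (i, j) = (\<Sum>k<rep_dim \<pi>. \<pi> x $$ (i, k) * \<pi> y $$ (k, j))"
  unfolding rep_add by (rule index_mult_mat_sum[OF rep_carrier rep_carrier])

lemma rep_cont: "i < rep_dim \<pi> \<Longrightarrow> j < rep_dim \<pi> \<Longrightarrow> continuous_on UNIV (\<lambda>x. \<pi> x $$ (i, j))"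
  using rep by (simp add: unitary_rep_def)

lemma rep_zero: "\<pi> 0 = 1\<^sub>m (rep_dim \<pi>)"
proof -
  note c = rep_carrier[of 0] and a = mat_adjoint_carrier[OF rep_carrier[of 0]]
  have "\<pi> 0 = (mat_adjoint (\<pi> 0) * \<pi> 0) * \<pi> 0"
    unfolding rep_adjoint using c by simp
  also have "\<dots> = mat_adjoint (\<pi> 0) * \<pi> (0 + 0)"
    unfolding rep_add by (rule assoc_mult_mat[OF a c c])
  also have "\<dots> = 1\<^sub>m (rep_dim \<pi>)" by (simp add: rep_adjoint)
  finally show ?thesis .
qed

lemma rep_minus: "\<pi> (- x) = mat_adjoint (\<pi> x)"
proof -
  note c = rep_carrier and a = mat_adjoint_carrier[OF rep_carrier[of x]]
  have "\<pi> (- x) = \<pi> (- x) * (\<pi> x * mat_adjoint (\<pi> x))"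
    unfolding rep_adjoint using c[of "- x"] by simp
  also have "\<dots> = \<pi> (- x + x) * mat_adjoint (\<pi> x)"
    unfolding rep_add by (rule assoc_mult_mat[OF c c a, symmetric])
  also have "\<dots> = mat_adjoint (\<pi> x)" using a by (simp add: rep_zero)
  finally show ?thesis .
qed

lemma rep_minus_entry:
  "i < rep_dim \<pi> \<Longrightarrow> j < rep_dim \<pi> \<Longrightarrow> \<pi> (- x) $$ (i, j) = cnj (\<pi> x $$ (j, i))"
  unfolding rep_minus by (rule index_mat_adjoint[OF rep_carrier])

lemma rep_cols_orthonormal:
  assumes "i < rep_dim \<pi>" "j < rep_dim \<pi>"
  shows "(\<Sum>k<rep_dim \<pi>. cnj (\<pi> x $$ (k, i)) * \<pi> x $$ (k, j)) = (if i = j then 1 else 0)"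
proof -
  have "(\<Sum>k<rep_dim \<pi>. cnj (\<pi> x $$ (k, i)) * \<pi> x $$ (k, j)) = \<pi> (- x + x) $$ (i, j)"
    unfolding rep_add_entry[OF assms] using assms by (intro sum.cong) (auto simp: rep_minus_entry)
  then show ?thesis using assms by (simp add: rep_zero)
qed

end

section \<open>Irreducible representations and Schur's lemma\<close>

lemma irr_rep: "irreducible_unitary_rep \<pi> \<Longrightarrow> unitary_rep \<pi>"
  and irr_dim: "irreducible_unitary_rep \<pi> \<Longrightarrow> rep_dim \<pi> > 0"
  by (auto simp: irreducible_unitary_rep_def)

lemma subspace_vecI:
  assumes "W \<subseteq> carrier_vec n" "0\<^sub>v n \<in> W" "\<And>v w. v \<in> W \<Longrightarrow> w \<in> W \<Longrightarrow> v + w \<in> W"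
    "\<And>c v. v \<in> W \<Longrightarrow> c \<cdot>\<^sub>v v \<in> W"
  shows "VectorSpace.subspace class_ring W (module_vec TYPE(complex) n)"
  unfolding VectorSpace.subspace_def LinearCombinations.submodule_def
  using assms vec_vs[of n] vec_module[of n]
  by (auto simp: module_vec_simps class_ring_simps)

lemma subspace_vecD:
  assumes "VectorSpace.subspace class_ring W (module_vec TYPE(complex) n)"
  shows "W \<subseteq> carrier_vec n" "0\<^sub>v n \<in> W" "\<And>v w. v \<in> W \<Longrightarrow> w \<in> W \<Longrightarrow> v + w \<in> W"
    "\<And>c v. v \<in> W \<Longrightarrow> c \<cdot>\<^sub>v v \<in> W"
  using assms unfolding VectorSpace.subspace_def LinearCombinations.submodule_def
  by (auto simp: module_vec_simps class_ring_simps)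

text \<open>Over the complex numbers \<open>T\<close> has an eigenvalue; its eigenspace is invariant
  under every \<open>\<pi> x\<close>, hence is the whole space.\<close>

lemma Schur_scalar:
  assumes irr: "irreducible_unitary_rep \<pi>" and T: "T \<in> carrier_mat (rep_dim \<pi>) (rep_dim \<pi>)"
    and comm: "\<And>x. \<pi> x * T = T * \<pi> x"
  obtains c where "T = c \<cdot>\<^sub>m 1\<^sub>m (rep_dim \<pi>)"
proof -
  let ?d = "rep_dim \<pi>"
  note rep = irr_rep[OF irr]
  note car = rep_carrier[OF rep]
  obtain c where "eigenvalue T c"
    using spectrum_non_empty[OF T irr_dim[OF irr]] by (auto simp: spectrum_def)
  then obtain v where v: "v \<in> carrier_vec ?d" "v \<noteq> 0\<^sub>v ?d" "T *\<^sub>v v = c \<cdot>\<^sub>v v"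
    using T by (auto simp: eigenvalue_def eigenvector_def)
  define W where "W = {w \<in> carrier_vec ?d. T *\<^sub>v w = c \<cdot>\<^sub>v w}"
  have sub: "VectorSpace.subspace class_ring W (module_vec TYPE(complex) ?d)"
  proof (rule subspace_vecI)
    show "0\<^sub>v ?d \<in> W" using T by (auto simp: W_def)
    fix a b assume "a \<in> W" "b \<in> W"
    then show "a + b \<in> W" using T
      by (auto simp: W_def mult_add_distrib_mat_vec smult_add_distrib_vec)
  next
    fix k a assume "a \<in> W"
    then show "k \<cdot>\<^sub>v a \<in> W" using T
      by (auto simp: W_def mult_mat_vec smult_smult_assoc mult.commute)
  qed (auto simp: W_def)
  have inv: "\<pi> x *\<^sub>v w \<in> W" if "w \<in> W" for x w
  proof -
    have w: "w \<in> carrier_vec ?d" "T *\<^sub>v w = c \<cdot>\<^sub>v w" using that by (auto simp: W_def)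
    have "T *\<^sub>v (\<pi> x *\<^sub>v w) = (T * \<pi> x) *\<^sub>v w"
      using assoc_mult_mat_vec[OF T car w(1)] by simp
    also have "\<dots> = \<pi> x *\<^sub>v (T *\<^sub>v w)"
      unfolding comm[symmetric] by (rule assoc_mult_mat_vec[OF car T w(1)])
    also have "\<dots> = c \<cdot>\<^sub>v (\<pi> x *\<^sub>v w)"
      unfolding w(2) by (rule mult_mat_vec[OF car w(1)])
    finally show ?thesis using mult_mat_vec_carrier[OF car w(1)] by (simp add: W_def)
  qed
  have "W \<noteq> {0\<^sub>v ?d}" using v by (auto simp: W_def)
  then have W: "W = carrier_vec ?d"
    using irr sub inv unfolding irreducible_unitary_rep_def by blast
  have "T = c \<cdot>\<^sub>m 1\<^sub>m ?d"
  proof (rule eq_matI)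
    fix i j assume "i < dim_row (c \<cdot>\<^sub>m 1\<^sub>m ?d)" "j < dim_col (c \<cdot>\<^sub>m 1\<^sub>m ?d)"
    then have ij: "i < ?d" "j < ?d" by auto
    have "unit_vec ?d j \<in> W" by (simp add: W)
    then have "T *\<^sub>v unit_vec ?d j = c \<cdot>\<^sub>v unit_vec ?d j" by (simp add: W_def)
    then have "vec_index (T *\<^sub>v unit_vec ?d j) i = vec_index (c \<cdot>\<^sub>v unit_vec ?d j) i" by simp
    then show "T $$ (i, j) = (c \<cdot>\<^sub>m 1\<^sub>m ?d) $$ (i, j)"
      using T ij by (simp add: scalar_prod_right_unit)
  qed (use T in auto)
  then show ?thesis by (rule that)
qed

text \<open>By \<open>Schur_scalar\<close> both products of \<open>T\<close> with its adjoint are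
  scalar. Were \<open>T\<close> nonzero, the two scalars would agree and be positive, the dimensions
  would coincide, and \<open>T\<close> divided by the square root of the scalar would be a unitary
  equivalence.\<close>

lemma Schur_inequivalent:
  assumes irr: "irreducible_unitary_rep \<pi>" "irreducible_unitary_rep \<rho>"
    and T: "T \<in> carrier_mat (rep_dim \<pi>) (rep_dim \<rho>)"
    and comm: "\<And>x. \<pi> x * T = T * \<rho> x"
    and ineq: "\<not> unitarily_equivalent \<rho> \<pi>"
  shows "T = 0\<^sub>m (rep_dim \<pi>) (rep_dim \<rho>)"
proof (rule ccontr)
  assume neq: "T \<noteq> 0\<^sub>m (rep_dim \<pi>) (rep_dim \<rho>)"
  let ?d = "rep_dim \<pi>" and ?e = "rep_dim \<rho>"
  note cp = rep_carrier[OF irr_rep[OF irr(1)]] and cr = rep_carrier[OF irr_rep[OF irr(2)]]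
  let ?S = "mat_adjoint T"
  have S: "?S \<in> carrier_mat ?e ?d" by (rule mat_adjoint_carrier[OF T])
  have commS: "\<rho> x * ?S = ?S * \<pi> x" for x
  proof -
    have "mat_adjoint (\<pi> (- x) * T) = mat_adjoint (T * \<rho> (- x))" by (simp add: comm)
    then have "?S * mat_adjoint (\<pi> (- x)) = mat_adjoint (\<rho> (- x)) * ?S"
      by (simp add: mat_adjoint_mult[OF cp T] mat_adjoint_mult[OF T cr])
    then show ?thesis
      using rep_minus[OF irr_rep[OF irr(1)], of "- x"] rep_minus[OF irr_rep[OF irr(2)], of "- x"] by simp
  qed
  have ST: "?S * T \<in> carrier_mat ?e ?e" and TS: "T * ?S \<in> carrier_mat ?d ?d" using S T by auto
  have "\<rho> x * (?S * T) = ?S * T * \<rho> x" for x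
  proof -
    have "\<rho> x * (?S * T) = ?S * \<pi> x * T"
      unfolding commS[symmetric] by (rule assoc_mult_mat[OF cr S T, symmetric])
    also have "\<dots> = ?S * (T * \<rho> x)"
      unfolding comm[symmetric] by (rule assoc_mult_mat[OF S cp T])
    also have "\<dots> = ?S * T * \<rho> x" by (rule assoc_mult_mat[OF S T cr, symmetric])
    finally show ?thesis .
  qed
  from Schur_scalar[OF irr(2) ST this]
  obtain a where a: "?S * T = a \<cdot>\<^sub>m 1\<^sub>m ?e" by metis
  have "\<pi> x * (T * ?S) = T * ?S * \<pi> x" for x
  proof -
    have "\<pi> x * (T * ?S) = T * \<rho> x * ?S"
      unfolding comm[symmetric] by (rule assoc_mult_mat[OF cp T S, symmetric])
    also have "\<dots> = T * (?S * \<pi> x)"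
      unfolding commS[symmetric] by (rule assoc_mult_mat[OF T cr S])
    also have "\<dots> = T * ?S * \<pi> x" by (rule assoc_mult_mat[OF T S cp, symmetric])
    finally show ?thesis .
  qed
  from Schur_scalar[OF irr(1) TS this]
  obtain b where b: "T * ?S = b \<cdot>\<^sub>m 1\<^sub>m ?d" by metis
  have aa: "a = of_real (\<Sum>i<?d. (cmod (T $$ (i, j)))\<^sup>2)" if j: "j < ?e" for j
  proof -
    have "a = (?S * T) $$ (j, j)" using j by (simp add: a)
    also have "\<dots> = (\<Sum>i<?d. of_real ((cmod (T $$ (i, j)))\<^sup>2))"
      unfolding index_mult_mat_sum[OF S T j j] complex_norm_square
      using j by (intro sum.cong) (auto simp: index_mat_adjoint[OF T] mult.commute)
    finally show ?thesis by simp
  qed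
  have bb: "b = of_real (\<Sum>j<?e. (cmod (T $$ (i, j)))\<^sup>2)" if i: "i < ?d" for i
  proof -
    have "b = (T * ?S) $$ (i, i)" using i by (simp add: b)
    also have "\<dots> = (\<Sum>j<?e. of_real ((cmod (T $$ (i, j)))\<^sup>2))"
      unfolding index_mult_mat_sum[OF T S i i] complex_norm_square
      using i by (intro sum.cong) (auto simp: index_mat_adjoint[OF T])
    finally show ?thesis by simp
  qed
  obtain i j where ij: "i < ?d" "j < ?e" "T $$ (i, j) \<noteq> 0"
    using neq T by (metis eq_matI carrier_matD index_zero_mat)
  define r where "r = (\<Sum>i<?d. (cmod (T $$ (i, j)))\<^sup>2)"
  have ar: "a = of_real r" using aa[OF ij(2)] by (simp add: r_def)
  have "(cmod (T $$ (i, j)))\<^sup>2 \<le> r"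
    unfolding r_def by (rule member_le_sum) (use ij in auto)
  then have r: "r > 0" using ij(3) by (smt (verit) zero_less_norm_iff zero_less_power)
  have "(T * ?S) * T = T * (?S * T)" by (rule assoc_mult_mat[OF T S T])
  then have "b \<cdot>\<^sub>m T = a \<cdot>\<^sub>m T" 
    using T by (simp add: a b mult_smult_assoc_mat[OF one_carrier_mat T] mult_smult_distrib[OF T one_carrier_mat])
  then have "(b \<cdot>\<^sub>m T) $$ (i, j) = (a \<cdot>\<^sub>m T) $$ (i, j)" by simp
  then have ba: "b = a" using ij T by simp
  \<comment> \<open>The sum of the squared moduli of all entries of \<open>T\<close>, taken by
    columns and by rows, is the trace of \<open>?S * T\<close> and of \<open>T * ?S\<close>; both
    scalars being \<open>a\<close>, the dimensions are equal.\<close>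
  have "of_nat ?e * a = (\<Sum>j<?e. of_real (\<Sum>i<?d. (cmod (T $$ (i, j)))\<^sup>2))"
    by (simp add: aa[symmetric] del: of_real_sum of_real_power)
  also have "\<dots> = (\<Sum>i<?d. of_real (\<Sum>j<?e. (cmod (T $$ (i, j)))\<^sup>2))"
    unfolding of_real_sum by (rule sum.swap)
  also have "\<dots> = of_nat ?d * a" by (simp add: bb[symmetric] ba flip: of_real_sum of_real_power)
  finally have "(of_nat ?e :: complex) = of_nat ?d" using r ar by simp
  then have de: "?e = ?d" by simp
  define k where "k = complex_of_real (1 / sqrt r)"
  have kk: "k * k * a = 1" using r by (simp add: k_def ar flip: of_real_mult)
  let ?U = "k \<cdot>\<^sub>m T"
  have U: "?U \<in> carrier_mat ?e ?e" using T de by simp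
  have adjU: "mat_adjoint ?U = k \<cdot>\<^sub>m ?S"
  proof (rule eq_matI)
    fix u v assume "u < dim_row (k \<cdot>\<^sub>m ?S)" "v < dim_col (k \<cdot>\<^sub>m ?S)"
    then have uv: "u < ?e" "v < ?d" using S by auto
    have "k \<cdot>\<^sub>m T \<in> carrier_mat ?d ?e" using T by simp
    from index_mat_adjoint[OF this uv] uv S T
    show "mat_adjoint ?U $$ (u, v) = (k \<cdot>\<^sub>m ?S) $$ (u, v)"
      by (simp add: index_mat_adjoint[OF T] k_def)
  qed (use mat_adjoint_carrier[OF U] S de in auto)
  have one: "k \<cdot>\<^sub>m (k \<cdot>\<^sub>m (a \<cdot>\<^sub>m 1\<^sub>m n)) = 1\<^sub>m n" for n
    by (rule eq_matI) (use kk in \<open>auto simp: mult.assoc\<close>)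
  have "mat_adjoint ?U * ?U = 1\<^sub>m ?e"
    using S T by (simp add: adjU mult_smult_assoc_mat[OF S smult_carrier_mat[OF T]] mult_smult_distrib[OF S T] a one)
  moreover have "?U * mat_adjoint ?U = 1\<^sub>m ?e"
    using S T by (simp add: adjU mult_smult_assoc_mat[OF T smult_carrier_mat[OF S]] mult_smult_distrib[OF T S] b ba one de)
  ultimately have "unitary_mat ?e ?U" using U by (simp add: unitary_mat_def)
  moreover have "?U * \<rho> x = \<pi> x * ?U" for x
    using T comm[of x] by (simp add: mult_smult_distrib[OF cp T] mult_smult_assoc_mat[OF T cr])
  ultimately have "unitarily_equivalent \<rho> \<pi>"
    unfolding unitarily_equivalent_def using de by blast
  then show False using ineq by simp
qed

text \<open>Reflexivity, witnessed by the identity matrix, makes \<rho> a representative of its own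
  class, so \<pi> would be a second one.\<close>

lemma dual_representatives_inequivalent:
  assumes "dual_representatives D" "\<pi> \<in> D" "\<rho> \<in> D" "\<pi> \<noteq> \<rho>"
  shows "\<not> unitarily_equivalent \<rho> \<pi>"
proof
  assume eq: "unitarily_equivalent \<rho> \<pi>"
  have irr: "irreducible_unitary_rep \<rho>" using assms by (auto simp: dual_representatives_def)
  have "unitary_mat (rep_dim \<rho>) (1\<^sub>m (rep_dim \<rho>))" by (simp add: unitary_mat_def mat_adjoint_one)
  moreover have "1\<^sub>m (rep_dim \<rho>) * \<rho> x = \<rho> x * 1\<^sub>m (rep_dim \<rho>)" for x
    using rep_carrier[OF irr_rep[OF irr], of x] by simp
  ultimately have "unitarily_equivalent \<rho> \<rho>" by (auto simp: unitarily_equivalent_def)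
  then show False using assms eq irr unfolding dual_representatives_def by blast
qed

context compact_group
begin

text \<open>\<open>T\<close> is the group average of
  \<open>\<pi> y * E * mat_adjoint (\<rho> y)\<close>, where \<open>E\<close> is the matrix unit at
  position \<open>(j, l)\<close>. Left translation of the averaging variable carries
  \<open>\<pi> x\<close> across to \<open>\<rho> x\<close>.\<close>

lemma average_intertwines:
  assumes irr: "unitary_rep \<pi>" "unitary_rep \<rho>" and j: "j < rep_dim \<pi>" and l: "l < rep_dim \<rho>"
  defines "T \<equiv> mat (rep_dim \<pi>) (rep_dim \<rho>) (\<lambda>(i, k). ip (\<lambda>y. \<pi> y $$ (i, j)) (\<lambda>y. \<rho> y $$ (k, l)))"
  shows "\<pi> x * T = T * \<rho> x"
proof (rule eq_matI)
  note cp = rep_carrier[OF irr(1)] and cr = rep_carrier[OF irr(2)]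
  have T: "T \<in> carrier_mat (rep_dim \<pi>) (rep_dim \<rho>)" by (simp add: T_def)
  show "dim_row (\<pi> x * T) = dim_row (T * \<rho> x)" "dim_col (\<pi> x * T) = dim_col (T * \<rho> x)"
    using cp[of x] cr[of x] T by auto
  fix i k assume "i < dim_row (T * \<rho> x)" "k < dim_col (T * \<rho> x)"
  then have i: "i < rep_dim \<pi>" and k: "k < rep_dim \<rho>" using T cr[of x] by auto
  note contp = rep_cont[OF irr(1)] and contr = rep_cont[OF irr(2)]
  have "(\<pi> x * T) $$ (i, k) = (\<Sum>a<rep_dim \<pi>. \<pi> x $$ (i, a) * ip (\<lambda>y. \<pi> y $$ (a, j)) (\<lambda>y. \<rho> y $$ (k, l)))"
    unfolding index_mult_mat_sum[OF cp T i k] using k by (intro sum.cong) (auto simp: T_def)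
  also have "\<dots> = ip (\<lambda>y. \<Sum>a<rep_dim \<pi>. \<pi> x $$ (i, a) * \<pi> y $$ (a, j)) (\<lambda>y. \<rho> y $$ (k, l))"
    using j k l by (subst ip_sum_left) (auto intro!: cont_sqint contp contr continuous_intros simp: ip_scale_left)
  also have "\<dots> = ip (\<lambda>y. \<pi> (x + y) $$ (i, j)) (\<lambda>y. \<rho> (- x + (x + y)) $$ (k, l))"
    by (simp add: rep_add_entry[OF irr(1) i j])
  also have "\<dots> = ip (\<lambda>y. \<pi> y $$ (i, j)) (\<lambda>y. \<rho> (- x + y) $$ (k, l))"
    unfolding ip_def
    by (rule integral_left[where f = "\<lambda>y. \<pi> y $$ (i, j) * cnj (\<rho> (- x + y) $$ (k, l))"])
       (intro continuous_intros contp contr[THEN cont_compose] i j k l)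
  also have "\<dots> = ip (\<lambda>y. \<pi> y $$ (i, j)) (\<lambda>y. \<Sum>b<rep_dim \<rho>. cnj (\<rho> x $$ (b, k)) * \<rho> y $$ (b, l))"
    using k l by (simp add: rep_add_entry[OF irr(2)] rep_minus_entry[OF irr(2)])
  also have "\<dots> = (\<Sum>b<rep_dim \<rho>. ip (\<lambda>y. \<pi> y $$ (i, j)) (\<lambda>y. \<rho> y $$ (b, l)) * \<rho> x $$ (b, k))"
    using i j l by (subst ip_sum_right)
      (auto intro!: cont_sqint contp contr continuous_intros simp: ip_scale_right mult.commute[of "ip _ _"])
  also have "\<dots> = (T * \<rho> x) $$ (i, k)"
    unfolding index_mult_mat_sum[OF T cr i k] using i by (intro sum.cong) (auto simp: T_def)
  finally show "(\<pi> x * T) $$ (i, k) = (T * \<rho> x) $$ (i, k)" .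
qed

text \<open>For fixed \<open>j\<close> and \<open>l\<close>, Schur's lemma leaves one unknown
  scalar. The trace determines it, being the integral of the inner product of columns
  \<open>j\<close> and \<open>l\<close> of the unitary matrix \<open>\<pi> y\<close>.\<close>

lemma Schur_orthogonality:
  assumes irr: "irreducible_unitary_rep \<pi>"
    and ijkl: "i < rep_dim \<pi>" "j < rep_dim \<pi>" "k < rep_dim \<pi>" "l < rep_dim \<pi>"
  shows "ip (\<lambda>y. \<pi> y $$ (i, j)) (\<lambda>y. \<pi> y $$ (k, l)) =
    (if i = k \<and> j = l then 1 / of_nat (rep_dim \<pi>) else 0)"
proof -
  note rep = irr_rep[OF irr]
  let ?d = "rep_dim \<pi>"
  define T where "T = mat ?d ?d (\<lambda>(i, k). ip (\<lambda>y. \<pi> y $$ (i, j)) (\<lambda>y. \<pi> y $$ (k, l)))"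
  have T: "T \<in> carrier_mat ?d ?d" by (simp add: T_def)
  from Schur_scalar[OF irr T] average_intertwines[OF rep rep ijkl(2,4)]
  obtain c where c: "T = c \<cdot>\<^sub>m 1\<^sub>m ?d" unfolding T_def by metis
  have entry: "ip (\<lambda>y. \<pi> y $$ (a, j)) (\<lambda>y. \<pi> y $$ (b, l)) = (if a = b then c else 0)"
    if "a < ?d" "b < ?d" for a b
  proof -
    have "T $$ (a, b) = (c \<cdot>\<^sub>m 1\<^sub>m ?d) $$ (a, b)" by (simp add: c)
    then show ?thesis using that by (simp add: T_def)
  qed
  have "of_nat ?d * c = (\<Sum>a<?d. ip (\<lambda>y. \<pi> y $$ (a, j)) (\<lambda>y. \<pi> y $$ (a, l)))"
    by (simp add: entry)
  also have "\<dots> = (LINT y|m. (\<Sum>a<?d. \<pi> y $$ (a, j) * cnj (\<pi> y $$ (a, l))))"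
    unfolding ip_def using ijkl
    by (intro Bochner_Integration.integral_sum[symmetric] integrable_cont continuous_intros rep_cont[OF rep]) auto
  also have "\<dots> = (LINT y|m. (if l = j then 1 else 0))"
    using rep_cols_orthonormal[OF rep ijkl(4,2)] by (simp add: mult.commute)
  also have "\<dots> = (if j = l then 1 else 0)" by (simp add: measure_m_UNIV)
  finally have "c = (if j = l then 1 / of_nat ?d else 0)"
    using irr_dim[OF irr] by (auto simp: field_simps split: if_splits)
  then show ?thesis using entry[OF ijkl(1,3)] by auto
qed

lemma Schur_orthogonality_inequivalent:
  assumes irr: "irreducible_unitary_rep \<pi>" "irreducible_unitary_rep \<rho>" "\<not> unitarily_equivalent \<rho> \<pi>"
    and ij: "i < rep_dim \<pi>" "j < rep_dim \<pi>" and kl: "k < rep_dim \<rho>" "l < rep_dim \<rho>"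
  shows "ip (\<lambda>y. \<pi> y $$ (i, j)) (\<lambda>y. \<rho> y $$ (k, l)) = 0"
proof -
  define T where "T = mat (rep_dim \<pi>) (rep_dim \<rho>) (\<lambda>(i, k). ip (\<lambda>y. \<pi> y $$ (i, j)) (\<lambda>y. \<rho> y $$ (k, l)))"
  have T: "T \<in> carrier_mat (rep_dim \<pi>) (rep_dim \<rho>)" by (simp add: T_def)
  have "T = 0\<^sub>m (rep_dim \<pi>) (rep_dim \<rho>)"
    using Schur_inequivalent[OF irr(1,2) T _ irr(3)]
      average_intertwines[OF irr_rep[OF irr(1)] irr_rep[OF irr(2)] ij(2) kl(2)]
    unfolding T_def by metis
  then have "T $$ (i, k) = 0" using ij kl by simp
  then show ?thesis using ij kl by (simp add: T_def)
qed

end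

section \<open>Convolution\<close>

text \<open>Log-convexity makes the ratios \<open>c (Suc n) / c n\<close> increase and
  submultiplicativity bounds them by \<open>c 0\<close>; \<open>L\<close> is their limit. Every
  ratio is at most \<open>L\<close>, so the normalised sequence decreases. It stays above 1 because
  k + 1 consecutive ratios starting at \<open>N\<close> multiply to at most \<open>c k\<close>;
  letting \<open>N\<close> grow gives \<open>L ^ Suc k \<le> c k\<close>. This lower bound later
  keeps the idempotent from vanishing.\<close>

lemma log_convex_submultiplicative_limit:
  fixes c :: "nat \<Rightarrow> real"
  assumes pos: "\<And>n. c n > 0"
    and convex: "\<And>n. (c (Suc n))\<^sup>2 \<le> c n * c (Suc (Suc n))"
    and submult: "\<And>j k. c (Suc (j + k)) \<le> c j * c k"
  obtains L l where "L > 0" "l \<ge> 1" "(\<lambda>n. c n / L ^ Suc n) \<longlonglongrightarrow> l" "\<And>n. c n / L ^ Suc n \<ge> 1"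
proof -
  define r where "r n = c (Suc n) / c n" for n
  have r_pos: "r n > 0" for n using pos by (simp add: r_def)
  have "r n \<le> r (Suc n)" for n
    using convex[of n] pos[of n] pos[of "Suc n"] by (simp add: r_def field_simps power2_eq_square)
  then have "incseq r" by (rule incseq_SucI)
  moreover have "r n \<le> c 0" for n
    using submult[of n 0] pos[of n] by (simp add: r_def field_simps)
  ultimately obtain L where L: "r \<longlonglongrightarrow> L" "\<And>n. r n \<le> L"
    using incseq_convergent by metis
  have L_pos: "L > 0" using r_pos[of 0] L(2)[of 0] by linarith
  let ?g = "\<lambda>n. c n / L ^ Suc n"
  have ge1: "?g k \<ge> 1" for k
  proof -
    have eq: "(\<Prod>i<k'. r (N + i)) = c (N + k') / c N" for N k'
      by (induction k') (use pos less_imp_neq[OF pos] in \<open>auto simp: r_def\<close>)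
    have "(\<lambda>N. \<Prod>i<Suc k. r (N + i)) \<longlonglongrightarrow> (\<Prod>i<Suc k. L)"
      using L(1) by (intro tendsto_prod LIMSEQ_ignore_initial_segment)
    moreover have "(\<Prod>i<Suc k. r (N + i)) \<le> c k" for N
      unfolding eq using submult[of N k] pos[of N] by (simp add: field_simps)
    ultimately have "L ^ Suc k \<le> c k"
      by (intro LIMSEQ_le_const2[of "\<lambda>N. \<Prod>i<Suc k. r (N + i)"]) auto
    then show ?thesis using L_pos by (simp add: pos_le_divide_eq)
  qed
  have "?g (Suc n) \<le> ?g n" for n
  proof -
    have "c (Suc n) \<le> L * c n" using L(2)[of n] pos[of n] by (simp add: r_def pos_divide_le_eq)
    then show ?thesis using L_pos by (simp add: field_simps)
  qed
  then have "decseq ?g" by (rule decseq_SucI)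
  then obtain l where l: "?g \<longlonglongrightarrow> l" by (rule decseq_convergent) (use ge1 in auto)
  moreover have "l \<ge> 1" using l ge1 by (intro LIMSEQ_le_const[of ?g]) auto
  ultimately show ?thesis using that L_pos ge1 by blast
qed

section \<open>The convolution algebra of continuous functions\<close>

context compact_group
begin

abbreviation conv :: "('g \<Rightarrow> complex) \<Rightarrow> ('g \<Rightarrow> complex) \<Rightarrow> 'g \<Rightarrow> complex" where
  "conv \<equiv> convolution m"

lemma cont_left: "continuous_on UNIV f \<Longrightarrow> continuous_on UNIV (\<lambda>y. f (a + y :: 'g))"
  by (erule cont_compose) (intro continuous_intros)

lemma star_star [simp]: "star (star f) = f"
  by (simp add: star_def fun_eq_iff)

lemma nsq_left: "continuous_on UNIV f \<Longrightarrow> nsq (\<lambda>y. f (a + y)) = nsq f"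
  unfolding nsq_def
  by (rule integral_left[where f = "\<lambda>y. (cmod (f y))\<^sup>2"]) (intro continuous_intros)

lemma ip_left:
  "continuous_on UNIV f \<Longrightarrow> continuous_on UNIV g \<Longrightarrow> ip (\<lambda>y. f (a + y)) (\<lambda>y. g (a + y)) = ip f g"
  unfolding ip_def
  by (rule integral_left[where f = "\<lambda>y. f y * cnj (g y)"]) (intro continuous_intros)

lemma nsq_star: "continuous_on UNIV f \<Longrightarrow> nsq (star f) = nsq f"
  unfolding nsq_def star_def complex_mod_cnj
  by (rule integral_inverse[where f = "\<lambda>y. (cmod (f y))\<^sup>2"]) (intro continuous_intros)

lemma cont_conv [continuous_intros]:
  assumes "continuous_on UNIV f" "continuous_on UNIV g"
  shows "continuous_on UNIV (conv f g)"
proof -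
  have "continuous_on UNIV (\<lambda>p. f (snd p) * g (- snd p + fst p))"
    by (intro continuous_intros cont_compose[OF assms(1)] cont_compose[OF assms(2)])
  from continuous_parametric_integral[OF compact_UNIV finite_m sets_m this]
  have "continuous_on UNIV (\<lambda>x. LINT y|m. f y * g (- y + x))" by simp
  then show ?thesis unfolding convolution_def .
qed

lemma conv_ip: "conv f g x = ip f (\<lambda>y. star g (- x + y))"
  by (simp add: convolution_def ip_def star_def minus_add)

lemma conv_zero_ip: "conv f g 0 = ip f (star g)"
  by (simp add: conv_ip)

text \<open>A translate of \<open>star g\<close> has the norm of \<open>g\<close>, so L2 norms bound
  the convolution uniformly. This converts L2 convergence into uniform convergence below.\<close>

lemma cmod_conv_le:
  assumes "continuous_on UNIV f" "continuous_on UNIV g"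
  shows "cmod (conv f g x) \<le> sqrt (nsq f) * sqrt (nsq g)"
proof -
  have "cmod (conv f g x) \<le> sqrt (nsq f) * sqrt (nsq (\<lambda>y. star g (- x + y)))"
    unfolding conv_ip using assms
    by (intro Cauchy_Schwarz_sqrt cont_sqint cont_left continuous_star)
  then show ?thesis
    using assms by (simp add: nsq_left continuous_star nsq_star)
qed

lemma nsq_le_bound:
  assumes "continuous_on UNIV f" "\<And>x. cmod (f x) \<le> e"
  shows "nsq f \<le> e\<^sup>2"
proof -
  have "nsq f \<le> (LINT x|m. e\<^sup>2)"
    unfolding nsq_def using assms
    by (intro integral_mono integrable_cont continuous_intros power_mono) auto
  then show ?thesis by simp
qed

lemma nsq_conv_le:
  assumes "continuous_on UNIV f" "continuous_on UNIV g"
  shows "nsq (conv f g) \<le> nsq f * nsq g"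
  using nsq_le_bound[OF cont_conv[OF assms] cmod_conv_le[OF assms]]
  by (simp add: power_mult_distrib nsq_nonneg)

lemma conv_assoc:
  assumes f: "continuous_on UNIV f" and g: "continuous_on UNIV g" and h: "continuous_on UNIV h"
  shows "conv (conv f g) h = conv f (conv g h)"
proof
  fix x
  have "conv (conv f g) h x = (LINT y|m. LINT z|m. f z * g (- z + y) * h (- y + x))"
    by (simp add: convolution_def)
  also have "\<dots> = (LINT z|m. LINT y|m. f z * g (- z + y) * h (- y + x))"
    by (rule Fubini_m)
       (intro continuous_intros cont_compose[OF f] cont_compose[OF g]
         cont_compose[OF h])
  also have "\<dots> = (LINT z|m. LINT y|m. f z * g (- z + (z + y)) * h (- (z + y) + x))"
    by (intro Bochner_Integration.integral_cong refl
         integral_left[symmetric, where f = "\<lambda>y. f _ * g (- _ + y) * h (- y + x)"]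
         continuous_intros cont_compose[OF g] cont_compose[OF h])
  also have "\<dots> = (LINT z|m. LINT y|m. f z * (g y * h (- y + (- z + x))))"
    by (simp add: minus_add add.assoc mult.assoc del: add_uminus_conv_diff)
  also have "\<dots> = conv f (conv g h) x"
    by (simp add: convolution_def)
  finally show "conv (conv f g) h x = conv f (conv g h) x" .
qed

lemma star_conv:
  assumes f: "continuous_on UNIV f" and g: "continuous_on UNIV g"
  shows "star (conv f g) = conv (star g) (star f)"
proof
  fix x
  have "conv (star g) (star f) x = (LINT y|m. cnj (g (- y)) * cnj (f (- x + y)))"
    by (simp add: convolution_def star_def minus_add)
  also have "\<dots> = (LINT y|m. cnj (g (- (x + y))) * cnj (f (- x + (x + y))))"
    by (rule integral_left[symmetric, where f = "\<lambda>y. cnj (g (- y)) * cnj (f (- x + y))"])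
       (intro continuous_intros cont_compose[OF f] cont_compose[OF g])
  also have "\<dots> = (LINT y|m. cnj (f y * g (- y + - x)))"
    by (simp add: minus_add mult.commute)
  also have "\<dots> = star (conv f g) x"
    unfolding star_def convolution_def by (rule Bochner_Integration.integral_cnj)
  finally show "star (conv f g) x = conv (star g) (star f) x" by simp
qed

lemma conv_scale_left: "conv (\<lambda>x. a * f x) g = (\<lambda>x. a * conv f g x)"
  unfolding convolution_def mult.assoc by (simp add: fun_eq_iff)

lemma conv_scale_right: "conv f (\<lambda>x. a * g x) = (\<lambda>x. a * conv f g x)"
  unfolding convolution_def mult.left_commute[of _ a] by (simp add: fun_eq_iff)

lemma conv_diff_right:
  assumes "continuous_on UNIV f" "continuous_on UNIV g" "continuous_on UNIV h"
  shows "conv f (\<lambda>x. g x - h x) x = conv f g x - conv f h x"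
  unfolding convolution_def right_diff_distrib
  using assms by (intro Bochner_Integration.integral_diff integrable_cont continuous_intros)
    (auto intro!: cont_compose[OF assms(2)] cont_compose[OF assms(3)] continuous_intros)

lemma conv_diff_left:
  assumes "continuous_on UNIV f" "continuous_on UNIV g" "continuous_on UNIV h"
  shows "conv (\<lambda>x. f x - g x) h x = conv f h x - conv g h x"
  unfolding convolution_def left_diff_distrib
  using assms by (intro Bochner_Integration.integral_diff integrable_cont continuous_intros)
    (auto intro!: cont_compose[OF assms(3)] continuous_intros)

text \<open>The filter is arbitrary because the consequences serve both sequences of convolution
  powers and nets of finite subsets of the dual.\<close>

lemma uniform_limit_nsq:
  assumes "uniform_limit UNIV u f F" "\<And>n. continuous_on UNIV (u n)" "continuous_on UNIV f"
  shows "((\<lambda>n. nsq (\<lambda>x. u n x - f x)) \<longlongrightarrow> 0) F"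
proof (rule tendstoI)
  fix e :: real assume e: "e > 0"
  have "\<forall>\<^sub>F n in F. \<forall>x\<in>UNIV. dist (u n x) (f x) < sqrt (e / 2)"
    using assms(1) e by (intro uniform_limitD) auto
  then show "\<forall>\<^sub>F n in F. dist (nsq (\<lambda>x. u n x - f x)) 0 < e"
  proof eventually_elim
    case (elim n)
    then have "nsq (\<lambda>x. u n x - f x) \<le> (sqrt (e / 2))\<^sup>2"
      using assms(2,3) by (intro nsq_le_bound continuous_intros) (auto simp: dist_norm less_imp_le)
    then show ?case using e nsq_nonneg[of "\<lambda>x. u n x - f x"] by (simp add: dist_norm)
  qed
qed

lemma uniform_limit_conv_right:
  assumes u: "uniform_limit UNIV u f F" "\<And>n. continuous_on UNIV (u n)" "continuous_on UNIV f"
    and g: "continuous_on UNIV g"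
  shows "((\<lambda>n. conv g (u n) x) \<longlongrightarrow> conv g f x) F"
proof -
  have "((\<lambda>n. sqrt (nsq g) * sqrt (nsq (\<lambda>x. u n x - f x))) \<longlongrightarrow> 0) F"
    using tendsto_mult[OF tendsto_const tendsto_real_sqrt[OF uniform_limit_nsq[OF u]], of "sqrt (nsq g)"] by simp
  then have "((\<lambda>n. conv g (u n) x - conv g f x) \<longlongrightarrow> 0) F"
    by (rule Lim_null_comparison[OF always_eventually, rotated])
       (use cmod_conv_le[OF g continuous_on_diff[OF u(2,3)]] in \<open>simp add: conv_diff_right[OF g u(2,3), symmetric]\<close>)
  then show ?thesis by (rule LIM_zero_cancel)
qed

lemma uniform_limit_conv_left:
  assumes u: "uniform_limit UNIV u f F" "\<And>n. continuous_on UNIV (u n)" "continuous_on UNIV f"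
    and g: "continuous_on UNIV g"
  shows "((\<lambda>n. conv (u n) g x) \<longlongrightarrow> conv f g x) F"
proof -
  have "((\<lambda>n. sqrt (nsq (\<lambda>x. u n x - f x)) * sqrt (nsq g)) \<longlongrightarrow> 0) F"
    using tendsto_mult[OF tendsto_real_sqrt[OF uniform_limit_nsq[OF u]] tendsto_const, of "sqrt (nsq g)"] by simp
  then have "((\<lambda>n. conv (u n) g x - conv f g x) \<longlongrightarrow> 0) F"
    by (rule Lim_null_comparison[OF always_eventually, rotated])
       (use cmod_conv_le[OF continuous_on_diff[OF u(2,3)] g] in \<open>simp add: conv_diff_left[OF u(2,3) g, symmetric]\<close>)
  then show ?thesis by (rule LIM_zero_cancel)
qed

lemma uniform_limit_ip:
  assumes u: "uniform_limit UNIV u f F" "\<And>n. continuous_on UNIV (u n)" "continuous_on UNIV f"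
    and g: "continuous_on UNIV g"
  shows "((\<lambda>n. ip (u n) g) \<longlongrightarrow> ip f g) F"
  using uniform_limit_conv_left[OF u continuous_star[OF g], of 0] by (simp add: conv_zero_ip)

end

section \<open>The Peter--Weyl theorem\<close>

context compact_group
begin

text \<open>The pairing carries no complex conjugation. The matrix-valued integral of
  \<open>f x\<close> times \<open>\<pi> x\<close> is then multiplicative under convolution, so
  vanishing passes from \<open>f\<close> to \<open>conv f g\<close>.\<close>

definition annihilates :: "('g \<Rightarrow> complex) \<Rightarrow> bool" where
  "annihilates f \<longleftrightarrow> continuous_on UNIV f \<and>
     (\<forall>\<pi>. irreducible_unitary_rep \<pi> \<longrightarrow>
       (\<forall>i<rep_dim \<pi>. \<forall>j<rep_dim \<pi>. (LINT x|m. f x * \<pi> x $$ (i, j)) = 0))"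

lemma annihilates_cont: "annihilates f \<Longrightarrow> continuous_on UNIV f"
  by (simp add: annihilates_def)

lemma annihilates_conv:
  assumes f: "annihilates f" and g: "continuous_on UNIV g"
  shows "annihilates (conv f g)"
  unfolding annihilates_def
proof (intro conjI allI impI)
  note cf = annihilates_cont[OF f]
  show "continuous_on UNIV (conv f g)" by (rule cont_conv[OF cf g])
  fix \<pi> :: "'g \<Rightarrow> complex mat" and i j
  assume irr: "irreducible_unitary_rep \<pi>" and ij: "i < rep_dim \<pi>" "j < rep_dim \<pi>"
  note rep = irr_rep[OF irr]
  note cp = rep_cont[OF rep]
  have "(LINT x|m. conv f g x * \<pi> x $$ (i, j)) = (LINT x|m. LINT y|m. f y * g (- y + x) * \<pi> x $$ (i, j))"
    by (simp add: convolution_def)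
  also have "\<dots> = (LINT y|m. LINT x|m. f y * g (- y + x) * \<pi> x $$ (i, j))"
    by (rule Fubini_m)
       (intro continuous_intros cont_compose[OF cf] cont_compose[OF g]
         cont_compose[OF cp] ij)
  also have "\<dots> = (LINT y|m. LINT x|m. f y * g (- y + (y + x)) * \<pi> (y + x) $$ (i, j))"
    by (intro Bochner_Integration.integral_cong refl
         integral_left[symmetric, where f = "\<lambda>x. f _ * g (- _ + x) * \<pi> x $$ (i, j)"]
         continuous_intros cont_compose[OF g] cp ij)
  also have "\<dots> = (LINT y|m. LINT x|m. (\<Sum>k<rep_dim \<pi>. (f y * \<pi> y $$ (i, k)) * (g x * \<pi> x $$ (k, j))))"
    by (simp add: rep_add_entry[OF rep ij] sum_distrib_left mult_ac)
  also have "\<dots> = (LINT y|m. (\<Sum>k<rep_dim \<pi>. (f y * \<pi> y $$ (i, k)) * (LINT x|m. g x * \<pi> x $$ (k, j))))"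
    by (subst Bochner_Integration.integral_sum)
       (use ij in \<open>auto intro!: integrable_cont continuous_intros g cp\<close>)
  also have "\<dots> = (\<Sum>k<rep_dim \<pi>. (LINT y|m. f y * \<pi> y $$ (i, k)) * (LINT x|m. g x * \<pi> x $$ (k, j)))"
    by (subst Bochner_Integration.integral_sum)
       (use ij in \<open>auto intro!: integrable_cont continuous_intros cf cp\<close>)
  also have "\<dots> = 0"
    using f irr ij by (simp add: annihilates_def)
  finally show "(LINT x|m. conv f g x * \<pi> x $$ (i, j)) = 0" .
qed

lemma annihilates_scale: "annihilates f \<Longrightarrow> annihilates (\<lambda>x. c * f x)"
  by (auto simp: annihilates_def mult.assoc intro!: continuous_intros)

lemma annihilates_uniform_limit:
  assumes u: "uniform_limit UNIV u f sequentially" and a: "\<And>n. annihilates (u n)" and f: "continuous_on UNIV f"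
  shows "annihilates f"
  unfolding annihilates_def
proof (intro conjI allI impI f)
  fix \<pi> :: "'g \<Rightarrow> complex mat" and i j
  assume irr: "irreducible_unitary_rep \<pi>" and ij: "i < rep_dim \<pi>" "j < rep_dim \<pi>"
  have c: "continuous_on UNIV (\<lambda>x. cnj (\<pi> x $$ (i, j)))"
    by (intro continuous_intros rep_cont[OF irr_rep[OF irr]] ij)
  have "(\<lambda>n. ip (u n) (\<lambda>x. cnj (\<pi> x $$ (i, j)))) \<longlonglongrightarrow> ip f (\<lambda>x. cnj (\<pi> x $$ (i, j)))"
    using annihilates_cont[OF a] by (intro uniform_limit_ip[OF u _ f c])
  moreover have "ip (u n) (\<lambda>x. cnj (\<pi> x $$ (i, j))) = 0" for n
    using a[of n] irr ij by (simp add: annihilates_def ip_def)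
  ultimately have "ip f (\<lambda>x. cnj (\<pi> x $$ (i, j))) = 0"
    by (simp add: LIMSEQ_const_iff)
  then show "(LINT x|m. f x * \<pi> x $$ (i, j)) = 0" by (simp add: ip_def)
qed

text \<open>Self-adjointness makes the value at the unit of an even convolution power the squared
  norm of a lower one. Every inner product between powers is thus a term of the single sequence
  \<open>c\<close>, and Cauchy-Schwarz becomes log-convexity of \<open>c\<close>.\<close>

lemma annihilating_idempotent:
  assumes \<phi>: "annihilates \<phi>" "star \<phi> = \<phi>" and pos: "nsq \<phi> > 0"
  obtains p where "annihilates p" "star p = p" "conv p p = p" "Re (p 0) \<ge> 1"
proof -
  define P where "P n = (conv \<phi> ^^ n) \<phi>" for n
  have P0: "P 0 = \<phi>" and PS: "P (Suc n) = conv \<phi> (P n)" for n by (simp_all add: P_def)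
  note c\<phi> = annihilates_cont[OF \<phi>(1)]
  have cP: "continuous_on UNIV (P n)" for n
    by (induction n) (auto simp: P0 PS intro!: c\<phi> cont_conv)
  have aP: "annihilates (P n)" for n
    by (cases n) (auto simp: P0 PS intro!: \<phi> annihilates_conv cP)
  have conv_P: "conv (P j) (P k) = P (Suc (j + k))" for j k
    by (induction j) (simp_all add: P0 PS conv_assoc[OF c\<phi> cP cP])
  have star_P: "star (P n) = P n" for n
  proof (induction n)
    case (Suc n)
    have "star (P (Suc n)) = conv (P n) (P 0)"
      by (simp add: PS star_conv[OF c\<phi> cP] Suc \<phi>(2) P0)
    then show ?case by (simp add: conv_P)
  qed (simp add: P0 \<phi>(2))
  have ip_P: "ip (P j) (P k) = P (Suc (j + k)) 0" for j k
    using conv_zero_ip[of "P j" "P k"] by (simp add: star_P conv_P)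
  define c where "c n = nsq (P n)" for n
  have c: "P (Suc (n + n)) 0 = of_real (c n)" for n
    using ip_P[of n n] by (simp add: c_def ip_self)
  have convex: "(c (Suc n))\<^sup>2 \<le> c n * c (Suc (Suc n))" for n
    using Cauchy_Schwarz[OF cont_sqint[OF cP[of n]] cont_sqint[OF cP[of "Suc (Suc n)"]]]
      ip_P[of n "Suc (Suc n)"] c[of "Suc n"] by (simp add: c_def)
  have c_pos: "c n > 0" for n
  proof (induction n rule: less_induct)
    case (less n)
    have "c n \<noteq> 0"
    proof
      assume z: "c n = 0"
      \<comment> \<open>Log-convexity at \<open>k\<close> rules out a first zero at index
        \<open>Suc (Suc k)\<close>, but cannot reach indices 0 and 1. At index 1, \<open>P 1\<close>
        would vanish at the unit, where its value is \<open>c 0\<close>.\<close>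
      consider "n = 0" | "n = 1" | k where "n = Suc (Suc k)" by (metis One_nat_def not0_implies_Suc)
      then show False
      proof cases
        case 1 then show ?thesis using z pos by (simp add: c_def P0)
      next
        case 2
        then have "P (Suc (0 + 0)) 0 = 0" using z nsq_zero_cont[OF cP, of n] by (simp add: c_def)
        then show ?thesis unfolding c using less[of 0] 2 by simp
      next
        case 3 then show ?thesis using z convex[of k] less[of "Suc k"] by simp
      qed
    qed
    then show ?case using nsq_nonneg[of "P n"] by (simp add: c_def)
  qed
  have submult: "c (Suc (j + k)) \<le> c j * c k" for j k
    unfolding c_def conv_P[symmetric] by (rule nsq_conv_le[OF cP cP])
  from log_convex_submultiplicative_limit[OF c_pos convex submult]
  obtain L l where L: "L > 0" "(\<lambda>n. c n / L ^ Suc n) \<longlonglongrightarrow> l" "\<And>n. c n / L ^ Suc n \<ge> 1" by metis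
  let ?g = "\<lambda>n. c n / L ^ Suc n"
  \<comment> \<open>The number of factors \<phi> is 2j + 2, an even number, which removes the sign
    of negative eigenvalues; \<open>L\<close> plays the role of the square of the largest eigenvalue
    modulus.\<close>
  define \<psi> where "\<psi> j = (\<lambda>x. complex_of_real (1 / L ^ Suc j) * P (Suc (j + j)) x)" for j
  have c\<psi>: "continuous_on UNIV (\<psi> j)" for j
    unfolding \<psi>_def by (intro continuous_intros cP)
  have ip_\<psi>: "ip (\<psi> j) (\<psi> k) = of_real (?g (Suc (j + k)))" for j k
  proof -
    have "ip (\<psi> j) (\<psi> k) = of_real (1 / L ^ Suc j * (1 / L ^ Suc k)) * P (Suc (Suc (j + k) + Suc (j + k))) 0"
      unfolding \<psi>_def ip_scale_left ip_scale_right ip_P by (simp add: algebra_simps)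
    then show ?thesis unfolding c by (simp add: power_add algebra_simps)
  qed
  have conv_\<psi>: "conv (\<psi> j) (\<psi> k) = \<psi> (Suc (j + k))" for j k
    unfolding \<psi>_def conv_scale_left conv_scale_right conv_P
    by (simp add: fun_eq_iff power_add algebra_simps)
  \<comment> \<open>As \<open>j\<close> and \<open>k\<close> grow, the right-hand side tends to l +
    l - 2l = 0.\<close>
  have nsq_\<psi>: "nsq (\<lambda>x. \<psi> j x - \<psi> k x) = ?g (Suc (j + j)) + ?g (Suc (k + k)) - 2 * ?g (Suc (j + k))" for j k
  proof -
    have s: "nsq (\<psi> i) = ?g (Suc (i + i))" for i
      using ip_\<psi>[of i i] unfolding ip_self of_real_eq_iff .
    have "nsq (\<lambda>x. \<psi> j x + (-1) * \<psi> k x) =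
        nsq (\<psi> j) + nsq (\<lambda>x. (-1) * \<psi> k x) + 2 * Re (ip (\<psi> j) (\<lambda>x. (-1) * \<psi> k x))"
      by (rule nsq_add) (intro cont_sqint continuous_intros c\<psi>)+
    also have "\<dots> = ?g (Suc (j + j)) + ?g (Suc (k + k)) - 2 * ?g (Suc (j + k))"
      unfolding nsq_scale ip_scale_right ip_\<psi> s by simp
    finally have "nsq (\<lambda>x. \<psi> j x + (-1) * \<psi> k x) = ?g (Suc (j + j)) + ?g (Suc (k + k)) - 2 * ?g (Suc (j + k))" .
    then show ?thesis by simp
  qed
  have "uniformly_Cauchy_on UNIV (\<lambda>n. \<psi> (Suc n))"
    unfolding uniformly_Cauchy_on_def
  proof (intro allI impI)
    fix e :: real assume e: "e > 0"
    define s where "s = sqrt (nsq (\<psi> 0)) + 1"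
    have s: "s > 0" using nsq_nonneg[of "\<psi> 0"] by (simp add: s_def add_nonneg_pos)
    \<comment> \<open>Counted with multiplicity, four values of \<open>?g\<close> enter
      \<open>nsq_\<psi>\<close>, hence the quarter. The division by \<open>s\<close> prepares for
      the factor \<open>sqrt (nsq (\<psi> 0))\<close>; the 1 added in \<open>s\<close> keeps it
      positive.\<close>
    have "(e / s)\<^sup>2 / 4 > 0" using e s by simp
    from LIMSEQ_D[OF L(2) this] obtain N where N: "\<And>n. n \<ge> N \<Longrightarrow> \<bar>?g n - l\<bar> < (e / s)\<^sup>2 / 4" by auto
    have "dist (\<psi> (Suc j) x) (\<psi> (Suc k) x) < e" if "j \<ge> N" "k \<ge> N" for j k x
    proof -
      have "\<bar>?g (Suc (j + j)) - l\<bar> < (e / s)\<^sup>2 / 4" "\<bar>?g (Suc (k + k)) - l\<bar> < (e / s)\<^sup>2 / 4"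
        "\<bar>?g (Suc (j + k)) - l\<bar> < (e / s)\<^sup>2 / 4"
        using that by (intro N; simp)+
      then have "nsq (\<lambda>x. \<psi> j x - \<psi> k x) < (e / s)\<^sup>2"
        unfolding nsq_\<psi> by linarith
      then have lt: "sqrt (nsq (\<lambda>x. \<psi> j x - \<psi> k x)) < e / s"
        using e s by (intro real_less_lsqrt) auto
      \<comment> \<open>One further convolution with \<open>\<psi> 0\<close> raises the index by one
        and upgrades the L2 Cauchy property to a uniform one.\<close>
      have "\<psi> (Suc j) x - \<psi> (Suc k) x = conv (\<psi> 0) (\<lambda>x. \<psi> j x - \<psi> k x) x"
        by (simp add: conv_diff_right c\<psi> conv_\<psi>)
      also have "cmod \<dots> \<le> sqrt (nsq (\<psi> 0)) * sqrt (nsq (\<lambda>x. \<psi> j x - \<psi> k x))"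
        by (intro cmod_conv_le c\<psi> continuous_on_diff)
      also have "\<dots> \<le> s * sqrt (nsq (\<lambda>x. \<psi> j x - \<psi> k x))"
        by (intro mult_right_mono) (auto simp: s_def nsq_nonneg)
      also have "\<dots> < s * (e / s)" by (rule mult_strict_left_mono[OF lt s])
      finally show ?thesis using s by (simp add: dist_norm)
    qed
    then show "\<exists>M. \<forall>x\<in>UNIV. \<forall>m\<ge>M. \<forall>n\<ge>M. dist (\<psi> (Suc m) x) (\<psi> (Suc n) x) < e" by blast
  qed
  then obtain p where p: "uniform_limit UNIV (\<lambda>n. \<psi> (Suc n)) p sequentially"
    using Cauchy_uniformly_convergent uniformly_convergent_on_def by blast
  have cp: "continuous_on UNIV p"
    by (rule uniform_limit_theorem[OF _ p]) (simp_all add: c\<psi>)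
  have lim: "(\<lambda>n. \<psi> (Suc n) x) \<longlonglongrightarrow> p x" for x
    by (rule tendsto_uniform_limitI[OF p]) simp
  have "annihilates p"
    by (rule annihilates_uniform_limit[OF p _ cp]) (unfold \<psi>_def, intro annihilates_scale aP)
  moreover have "star p = p"
  proof
    fix x
    have "star (\<psi> j) = \<psi> j" for j
      using star_P[of "Suc (j + j)"] by (simp add: star_def \<psi>_def fun_eq_iff)
    then have "cnj (\<psi> j (- x)) = \<psi> j x" for j by (metis star_def)
    then have "(\<lambda>n. \<psi> (Suc n) x) \<longlonglongrightarrow> cnj (p (- x))"
      using tendsto_cnj[OF lim[of "- x"]] by simp
    then show "star p x = p x" using LIMSEQ_unique[OF _ lim] by (simp add: star_def)
  qed
  moreover have "conv p p = p"
  proof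
    fix x
    \<comment> \<open>Convolving with \<open>\<psi> j\<close> merely shifts the sequence by
      \<open>Suc j\<close>, which leaves the limit unchanged.\<close>
    have *: "conv (\<psi> j) p x = p x" for j
    proof -
      have "(\<lambda>k. conv (\<psi> j) (\<psi> (Suc k)) x) \<longlonglongrightarrow> conv (\<psi> j) p x"
        by (rule uniform_limit_conv_right[OF p c\<psi> cp c\<psi>])
      moreover have "(\<lambda>k. conv (\<psi> j) (\<psi> (Suc k)) x) \<longlonglongrightarrow> p x"
        using LIMSEQ_ignore_initial_segment[OF lim[of x], of "Suc j"]
        by (simp add: conv_\<psi> algebra_simps)
      ultimately show ?thesis by (rule LIMSEQ_unique)
    qed
    have "(\<lambda>k. conv (\<psi> (Suc k)) p x) \<longlonglongrightarrow> conv p p x"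
      by (rule uniform_limit_conv_left[OF p c\<psi> cp cp])
    then show "conv p p x = p x" unfolding * by (simp add: LIMSEQ_const_iff)
  qed
  moreover have "Re (p 0) \<ge> 1"
  proof (rule LIMSEQ_le_const[OF tendsto_Re[OF lim[of 0]]])
    \<comment> \<open>By \<open>c\<close>, the value at the unit is a normalised squared norm, so
      the lower bound 1 applies.\<close>
    have "\<psi> j 0 = of_real (?g j)" for j
      unfolding \<psi>_def c by simp
    then show "\<exists>N. \<forall>n\<ge>N. 1 \<le> Re (\<psi> (Suc n) 0)" using L(3) by (metis Re_complex_of_real)
  qed
  ultimately show ?thesis by (rule that)
qed

section \<open>Finite-dimensional translation-invariant function spaces\<close>

definition invariant_space :: "('g \<Rightarrow> complex) set \<Rightarrow> bool" where
  "invariant_space W \<longleftrightarrow> (\<forall>f\<in>W. continuous_on UNIV f) \<and> (\<lambda>x. 0) \<in> W \<and>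
     (\<forall>f\<in>W. \<forall>g\<in>W. (\<lambda>x. f x + g x) \<in> W) \<and> (\<forall>c. \<forall>f\<in>W. (\<lambda>x. c * f x) \<in> W) \<and>
     (\<forall>a. \<forall>f\<in>W. (\<lambda>x. f (a + x)) \<in> W)"

definition orthonormal_in :: "('g \<Rightarrow> complex) set \<Rightarrow> nat \<Rightarrow> (nat \<Rightarrow> 'g \<Rightarrow> complex) \<Rightarrow> bool" where
  "orthonormal_in W n f \<longleftrightarrow> (\<forall>i<n. f i \<in> W) \<and>
     (\<forall>i<n. \<forall>j<n. ip (f i) (f j) = (if i = j then 1 else 0))"

text \<open>An orthonormal \<open>f\<close> of length \<open>n\<close> that expands every element of
  a space is a basis, and \<open>n\<close> stands for the dimension. Equality is pointwise rather
  than almost everywhere, as suits continuous functions.\<close>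

definition expands :: "nat \<Rightarrow> (nat \<Rightarrow> 'g \<Rightarrow> complex) \<Rightarrow> ('g \<Rightarrow> complex) \<Rightarrow> bool" where
  "expands n f g \<longleftrightarrow> (\<forall>x. g x = (\<Sum>i<n. ip g (f i) * f i x))"

lemma conv_add_left:
  assumes "continuous_on UNIV f" "continuous_on UNIV g" "continuous_on UNIV h"
  shows "conv (\<lambda>x. f x + g x) h x = conv f h x + conv g h x"
  unfolding convolution_def distrib_right
  using assms by (intro Bochner_Integration.integral_add integrable_cont continuous_intros)
    (auto intro!: cont_compose[OF assms(3)] continuous_intros)

lemma invariant_spaceD:
  assumes "invariant_space W"
  shows "f \<in> W \<Longrightarrow> continuous_on UNIV f" "(\<lambda>x. 0) \<in> W"
    "f \<in> W \<Longrightarrow> g \<in> W \<Longrightarrow> (\<lambda>x. f x + g x) \<in> W" "f \<in> W \<Longrightarrow> (\<lambda>x. c * f x) \<in> W"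
    "f \<in> W \<Longrightarrow> (\<lambda>x. f (a + x)) \<in> W"
  using assms by (auto simp: invariant_space_def)

lemma invariant_space_lincomb:
  fixes n :: nat
  assumes W: "invariant_space W" and f: "\<And>i. i < n \<Longrightarrow> f i \<in> W"
  shows "(\<lambda>x. \<Sum>i<n. c i * f i x) \<in> W"
  using f
proof (induction n)
  case 0
  then show ?case by (simp add: invariant_spaceD(2)[OF W])
next
  case (Suc n)
  have "(\<lambda>x. \<Sum>i<n. c i * f i x) \<in> W" "(\<lambda>x. c n * f n x) \<in> W"
    using Suc by (simp_all add: invariant_spaceD(4)[OF W])
  from invariant_spaceD(3)[OF W this] show ?case by simp
qed

lemma invariant_space_diff:
  "invariant_space W \<Longrightarrow> f \<in> W \<Longrightarrow> g \<in> W \<Longrightarrow> (\<lambda>x. f x - g x) \<in> W"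
  using invariant_spaceD(3)[of W f "\<lambda>x. (-1) * g x"] invariant_spaceD(4)[of W g "-1"] by simp

lemma ip_diff_left: "sqint f \<Longrightarrow> sqint g \<Longrightarrow> sqint h \<Longrightarrow> ip (\<lambda>x. f x - g x) h = ip f h - ip g h"
  unfolding ip_def left_diff_distrib
  by (intro Bochner_Integration.integral_diff sqint_integrable_mult)

text \<open>One Gram-Schmidt step: the residue of \<open>g\<close> is orthogonal to the family, and
  being continuous and not identically zero it has positive norm.\<close>

lemma orthonormal_in_extend:
  assumes W: "invariant_space W" and f: "orthonormal_in W n f" and g: "g \<in> W" "\<not> expands n f g"
  obtains f' where "orthonormal_in W (Suc n) f'"
proof -
  define r where "r x = g x - (\<Sum>i<n. ip g (f i) * f i x)" for x
  have fW: "f i \<in> W" if "i < n" for i using f that by (simp add: orthonormal_in_def)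
  have sf: "sqint (\<lambda>x. c * f i x)" if "i < n" for i c
    using fW[OF that] invariant_spaceD(1)[OF W] by (intro sqint_scale cont_sqint) blast
  have rW: "r \<in> W"
    unfolding r_def by (intro invariant_space_diff[OF W g(1)] invariant_space_lincomb[OF W] fW)
  have sr: "sqint r" and sg: "sqint g" and cr: "continuous_on UNIV r"
    using rW g(1) invariant_spaceD(1)[OF W] by (auto intro: cont_sqint)
  have orth: "ip r (f j) = 0" if j: "j < n" for j
  proof -
    have sfj: "sqint (f j)" using sf[OF j, of 1] by simp
    have "ip r (f j) = ip g (f j) - ip (\<lambda>x. \<Sum>i<n. ip g (f i) * f i x) (f j)"
      unfolding r_def using sf by (intro ip_diff_left sg sfj sqint_sum) auto
    also have "ip (\<lambda>x. \<Sum>i<n. ip g (f i) * f i x) (f j) = (\<Sum>i<n. ip g (f i) * ip (f i) (f j))"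
      using sf sfj by (subst ip_sum_left) (auto simp: ip_scale_left)
    also have "\<dots> = (\<Sum>i<n. if i = j then ip g (f i) else 0)"
      using f j by (intro sum.cong) (auto simp: orthonormal_in_def)
    also have "\<dots> = ip g (f j)" using j by simp
    finally show ?thesis by simp
  qed
  obtain x where "r x \<noteq> 0" using g(2) by (auto simp: expands_def r_def)
  then have pos: "nsq r > 0" using nsq_zero_cont[OF cr] nsq_nonneg[of r] by (metis less_eq_real_def)
  define h where "h = (\<lambda>x. complex_of_real (1 / sqrt (nsq r)) * r x)"
  have hW: "h \<in> W" unfolding h_def by (rule invariant_spaceD(4)[OF W rW])
  have "ip h h = 1"
    unfolding ip_self h_def nsq_scale using pos by (simp add: norm_divide power_divide)
  moreover have "ip h (f j) = 0" "ip (f j) h = 0" if "j < n" for j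
    unfolding h_def ip_scale_left ip_scale_right using orth[OF that] ip_cnj[of "f j" r] by simp_all
  ultimately have "orthonormal_in W (Suc n) (f(n := h))"
    using f hW by (auto simp: orthonormal_in_def less_Suc_eq)
  then show ?thesis by (rule that)
qed

text \<open>The bound provides an orthonormal family of greatest length; by
  \<open>orthonormal_in_extend\<close> such a family misses no element.\<close>

lemma orthonormal_basis_exists:
  assumes W: "invariant_space W" and bound: "\<forall>n f. orthonormal_in W n f \<longrightarrow> n \<le> B"
  obtains n f where "orthonormal_in W n f" "\<forall>g\<in>W. expands n f g"
proof -
  have "orthonormal_in W 0 undefined" by (simp add: orthonormal_in_def)
  then have "\<exists>f. orthonormal_in W 0 f" by blast
  moreover have "\<forall>n. (\<exists>f. orthonormal_in W n f) \<longrightarrow> n \<le> B" using bound by blast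
  ultimately obtain n where n: "\<exists>f. orthonormal_in W n f" "\<And>k. \<exists>f. orthonormal_in W k f \<Longrightarrow> k \<le> n"
    using Nat.ex_has_greatest_nat[of "\<lambda>n. \<exists>f. orthonormal_in W n f" 0 B] by blast
  then obtain f where f: "orthonormal_in W n f" by blast
  have "expands n f g" if g: "g \<in> W" for g
  proof (rule ccontr)
    assume "\<not> expands n f g"
    from orthonormal_in_extend[OF W f g this] obtain f' where "orthonormal_in W (Suc n) f'" by blast
    then show False using n(2)[of "Suc n"] by auto
  qed
  then show ?thesis using that f by blast
qed

lemma expands_ip:
  assumes W: "invariant_space W" and f: "orthonormal_in W n f" and g: "expands n f g" and h: "sqint h"
  shows "ip g h = (\<Sum>i<n. ip g (f i) * ip (f i) h)"
proof -
  have s: "sqint (f i)" if "i < n" for i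
    using f that invariant_spaceD(1)[OF W] by (auto simp: orthonormal_in_def intro: cont_sqint)
  have "g = (\<lambda>x. \<Sum>i<n. ip g (f i) * f i x)" using g by (auto simp: expands_def)
  then have "ip g h = ip (\<lambda>x. \<Sum>i<n. ip g (f i) * f i x) h" by simp
  also have "\<dots> = (\<Sum>i<n. ip g (f i) * ip (f i) h)"
    by (subst ip_sum_left[OF _ h]) (auto simp: ip_scale_left intro!: sqint_scale s)
  finally show ?thesis .
qed

text \<open>Double counting of the squared inner products of \<open>f\<close> with \<open>g\<close>:
  Parseval in the basis \<open>f\<close> makes the total \<open>k\<close>, while Bessel for
  \<open>g\<close> bounds it by \<open>n\<close>.\<close>

lemma orthonormal_card_le:
  assumes W: "invariant_space W" and f: "orthonormal_in W n f" and ex: "\<forall>g\<in>W. expands n f g"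
    and g: "orthonormal_in W k g"
  shows "k \<le> n"
proof -
  have s: "sqint (f i)" if "i < n" for i
    using f that invariant_spaceD(1)[OF W] by (auto simp: orthonormal_in_def intro: cont_sqint)
  have t: "sqint (g i)" if "i < k" for i
    using g that invariant_spaceD(1)[OF W] by (auto simp: orthonormal_in_def intro: cont_sqint)
  have "complex_of_real (real k) = (\<Sum>l<k. ip (g l) (g l))"
    using g by (simp add: orthonormal_in_def)
  also have "\<dots> = (\<Sum>l<k. \<Sum>i<n. ip (g l) (f i) * ip (f i) (g l))"
    using g ex t by (intro sum.cong refl expands_ip[OF W f]) (auto simp: orthonormal_in_def)
  also have "\<dots> = (\<Sum>l<k. \<Sum>i<n. of_real ((cmod (ip (f i) (g l)))\<^sup>2))"
    by (intro sum.cong refl) (simp only: complex_norm_square ip_cnj[of "g _" "f _"] mult.commute)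
  finally have "real k = (\<Sum>l<k. \<Sum>i<n. (cmod (ip (f i) (g l)))\<^sup>2)"
    unfolding of_real_sum[symmetric] of_real_eq_iff .
  also have "\<dots> = (\<Sum>i<n. \<Sum>l<k. (cmod (ip (f i) (g l)))\<^sup>2)" by (rule sum.swap)
  also have "\<dots> \<le> (\<Sum>i<n. nsq (f i))"
    using g s t by (intro sum_mono Bessel) (auto simp: orthonormal_in_def)
  also have "\<dots> = (\<Sum>i<n. 1)"
  proof (rule sum.cong)
    fix i assume "i \<in> {..<n}"
    then have "complex_of_real (nsq (f i)) = 1" using f by (simp add: orthonormal_in_def flip: ip_self)
    then show "nsq (f i) = 1" by simp
  qed simp
  finally show ?thesis by simp
qed

lemma orthonormal_expansion_unique:
  assumes W: "invariant_space W" and f: "orthonormal_in W n f" and j: "j < n"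
  shows "ip (\<lambda>x. \<Sum>i<n. c i * f i x) (f j) = c j"
proof -
  have s: "sqint (f i)" if "i < n" for i
    using f that invariant_spaceD(1)[OF W] by (auto simp: orthonormal_in_def intro: cont_sqint)
  have "ip (\<lambda>x. \<Sum>i<n. c i * f i x) (f j) = (\<Sum>i<n. c i * ip (f i) (f j))"
    using j by (subst ip_sum_left) (auto simp: ip_scale_left intro!: sqint_scale s)
  also have "\<dots> = (\<Sum>i<n. if i = j then c i else 0)"
    using f j by (intro sum.cong) (auto simp: orthonormal_in_def)
  finally show ?thesis using j by simp
qed

text \<open>The matrix of the left regular representation in the family \<open>f\<close>: column
  \<open>j\<close> holds the coordinates of the translate of \<open>f j\<close>.\<close>

definition regular_mat :: "nat \<Rightarrow> (nat \<Rightarrow> 'g \<Rightarrow> complex) \<Rightarrow> 'g \<Rightarrow> complex mat" where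
  "regular_mat n f x = mat n n (\<lambda>(i, j). ip (\<lambda>y. f j (- x + y)) (f i))"

section \<open>The regular representation on an invariant space\<close>

context
  fixes W n f
  assumes W: "invariant_space W" and f: "orthonormal_in W n f"
    and ex: "\<forall>g\<in>W. expands n f g"
begin

lemma basis_in: "i < n \<Longrightarrow> f i \<in> W" and basis_cont: "i < n \<Longrightarrow> continuous_on UNIV (f i)"
  and basis_sqint: "i < n \<Longrightarrow> sqint (f i)"
  and basis_ip: "i < n \<Longrightarrow> j < n \<Longrightarrow> ip (f i) (f j) = (if i = j then 1 else 0)"
  using f invariant_spaceD(1)[OF W] by (auto simp: orthonormal_in_def intro: cont_sqint)

lemma rep_dim_regular [simp]: "rep_dim (regular_mat n f) = n"
  by (simp add: rep_dim_def regular_mat_def)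

lemma regular_mat_translate:
  assumes j: "j < n"
  shows "f j (- x + y) = (\<Sum>i<n. regular_mat n f x $$ (i, j) * f i y)"
proof -
  have "f j (- x + y) = (\<Sum>i<n. ip (\<lambda>y. f j (- x + y)) (f i) * f i y)"
    using bspec[OF ex invariant_spaceD(5)[OF W basis_in[OF j], of "- x"]]
    unfolding expands_def by (rule spec)
  also have "\<dots> = (\<Sum>i<n. regular_mat n f x $$ (i, j) * f i y)"
    using j by (intro sum.cong) (auto simp: regular_mat_def)
  finally show ?thesis .
qed

text \<open>Unitarity is Parseval in the basis \<open>f\<close> combined with translation invariance
  of the inner product; a one-sided inverse of a square matrix is two-sided. Continuity is that of a
  parametric integral.\<close>

lemma unitary_rep_regular: "unitary_rep (regular_mat n f)"
proof -
  let ?\<pi> = "regular_mat n f"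
  have car: "?\<pi> x \<in> carrier_mat n n" for x by (simp add: regular_mat_def)
  have entry: "i < n \<Longrightarrow> j < n \<Longrightarrow> ?\<pi> x $$ (i, j) = ip (\<lambda>y. f j (- x + y)) (f i)" for i j x
    by (simp add: regular_mat_def)
  have add: "?\<pi> (x + z) = ?\<pi> x * ?\<pi> z" for x z
  proof (rule eq_matI)
    fix i j assume "i < dim_row (?\<pi> x * ?\<pi> z)" "j < dim_col (?\<pi> x * ?\<pi> z)"
    then have i: "i < n" and j: "j < n" using car[of x] car[of z] by auto
    have "?\<pi> (x + z) $$ (i, j) = ip (\<lambda>y. f j (- z + (- x + y))) (f i)"
      by (simp add: entry[OF i j] minus_add add.assoc del: add_uminus_conv_diff)
    also have "\<dots> = ip (\<lambda>y. \<Sum>k<n. ?\<pi> z $$ (k, j) * f k (- x + y)) (f i)"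
      by (simp add: regular_mat_translate[OF j])
    also have "\<dots> = (\<Sum>k<n. ?\<pi> z $$ (k, j) * ip (\<lambda>y. f k (- x + y)) (f i))"
      using cont_sqint[OF cont_left[OF basis_cont], of _ "- x"]
      by (subst ip_sum_left) (auto simp: ip_scale_left sqint_scale basis_sqint i)
    also have "\<dots> = (\<Sum>k<n. ?\<pi> x $$ (i, k) * ?\<pi> z $$ (k, j))"
      by (intro sum.cong) (auto simp: entry i)
    also have "\<dots> = (?\<pi> x * ?\<pi> z) $$ (i, j)"
      by (rule index_mult_mat_sum[OF car car i j, symmetric])
    finally show "?\<pi> (x + z) $$ (i, j) = (?\<pi> x * ?\<pi> z) $$ (i, j)" .
  qed (simp_all add: regular_mat_def)
  have unit: "mat_adjoint (?\<pi> x) * ?\<pi> x = 1\<^sub>m n" for x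
  proof (rule eq_matI)
    note ca = mat_adjoint_carrier[OF car[of x]]
    show "dim_row (mat_adjoint (?\<pi> x) * ?\<pi> x) = dim_row (1\<^sub>m n)"
      "dim_col (mat_adjoint (?\<pi> x) * ?\<pi> x) = dim_col (1\<^sub>m n)" using ca car[of x] by auto
    fix i j assume "i < dim_row (1\<^sub>m n)" "j < dim_col (1\<^sub>m n)"
    then have i: "i < n" and j: "j < n" by auto
    have "(mat_adjoint (?\<pi> x) * ?\<pi> x) $$ (i, j) = (\<Sum>k<n. ?\<pi> x $$ (k, j) * cnj (?\<pi> x $$ (k, i)))"
      unfolding index_mult_mat_sum[OF ca car i j]
      by (intro sum.cong) (auto simp: index_mat_adjoint[OF car] i)
    also have "\<dots> = (\<Sum>k<n. ip (\<lambda>y. f j (- x + y)) (f k) * ip (f k) (\<lambda>y. f i (- x + y)))"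
    proof (rule sum.cong)
      fix k assume "k \<in> {..<n}"
      then show "?\<pi> x $$ (k, j) * cnj (?\<pi> x $$ (k, i)) =
          ip (\<lambda>y. f j (- x + y)) (f k) * ip (f k) (\<lambda>y. f i (- x + y))"
        using i j ip_cnj[of "f k" "\<lambda>y. f i (- x + y)"] by (simp add: entry)
    qed simp
    also have "\<dots> = ip (\<lambda>y. f j (- x + y)) (\<lambda>y. f i (- x + y))"
      by (rule expands_ip[OF W f, symmetric])
         (intro ex[rule_format] invariant_spaceD(5)[OF W] basis_in cont_sqint cont_left basis_cont i j)+
    also have "\<dots> = ip (f j) (f i)" by (rule ip_left) (intro basis_cont i j)+
    finally show "(mat_adjoint (?\<pi> x) * ?\<pi> x) $$ (i, j) = 1\<^sub>m n $$ (i, j)"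
      using i j by (simp add: basis_ip)
  qed
  have unit': "?\<pi> x * mat_adjoint (?\<pi> x) = 1\<^sub>m n" for x
    by (rule mat_mult_left_right_inverse[OF mat_adjoint_carrier[OF car] car unit])
  have cont: "continuous_on UNIV (\<lambda>x. ?\<pi> x $$ (i, j))" if i: "i < n" and j: "j < n" for i j
  proof -
    have "continuous_on UNIV (\<lambda>p. f j (- fst p + snd p) * cnj (f i (snd p)))"
      by (intro continuous_intros cont_compose[OF basis_cont[OF i]]
          cont_compose[OF basis_cont[OF j]])
    from continuous_parametric_integral[OF compact_UNIV finite_m sets_m this]
    show ?thesis by (simp add: entry[OF i j] ip_def)
  qed
  show ?thesis
    unfolding unitary_rep_def unitary_mat_def rep_dim_regular
    using car unit unit' add cont by blast
qed

lemma lincomb_translate: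
  assumes v: "v \<in> carrier_vec n"
  shows "(\<Sum>i<n. vec_index v i * f i (- a + x)) = (\<Sum>k<n. vec_index (regular_mat n f a *\<^sub>v v) k * f k x)"
proof -
  have "(\<Sum>i<n. vec_index v i * f i (- a + x)) = (\<Sum>i<n. \<Sum>k<n. vec_index v i * (regular_mat n f a $$ (k, i) * f k x))"
    by (simp add: regular_mat_translate sum_distrib_left)
  also have "\<dots> = (\<Sum>k<n. \<Sum>i<n. vec_index v i * (regular_mat n f a $$ (k, i) * f k x))"
    by (rule sum.swap)
  also have "\<dots> = (\<Sum>k<n. vec_index (regular_mat n f a *\<^sub>v v) k * f k x)"
    using v by (intro sum.cong)
      (auto simp: regular_mat_def scalar_prod_def lessThan_atLeast0 sum_distrib_left sum_distrib_right mult_ac)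
  finally show ?thesis .
qed

text \<open>Coordinates identify an invariant subspace of the representation with a
  translation-invariant space \<open>U\<close> inside \<open>W\<close>. If the subspace is proper,
  then \<open>U\<close> has smaller dimension than \<open>W\<close>, and minimality leaves only
  dimension 0.\<close>

lemma irreducible_regular:
  assumes n: "n > 0"
    and minimal: "\<And>U k g. \<lbrakk>U \<subseteq> W; invariant_space U; orthonormal_in U k g; \<forall>h\<in>U. expands k g h; k > 0\<rbrakk> \<Longrightarrow> n \<le> k"
  shows "irreducible_unitary_rep (regular_mat n f)"
  unfolding irreducible_unitary_rep_def rep_dim_regular
proof (intro conjI allI impI, rule unitary_rep_regular, rule n)
  let ?\<pi> = "regular_mat n f"
  fix W' assume "VectorSpace.subspace class_ring W' (module_vec TYPE(complex) n) \<and> (\<forall>x. \<forall>w\<in>W'. ?\<pi> x *\<^sub>v w \<in> W')"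
  then have sub: "VectorSpace.subspace class_ring W' (module_vec TYPE(complex) n)"
    and inv: "\<And>x w. w \<in> W' \<Longrightarrow> ?\<pi> x *\<^sub>v w \<in> W'" by auto
  note subD = subspace_vecD[OF sub]
  have dim: "w \<in> carrier_vec n" if "w \<in> W'" for w using subD(1) that by auto
  show "W' = {0\<^sub>v n} \<or> W' = carrier_vec n"
  proof (rule disjCI)
    assume "W' \<noteq> carrier_vec n"
    then obtain u where u: "u \<in> carrier_vec n" "u \<notin> W'" using subD(1) by auto
    define F where "F v = (\<lambda>x. \<Sum>i<n. vec_index v i * f i x)" for v
    define U where "U = F ` W'"
    have ip_F: "ip (F v) (f j) = vec_index v j" if "j < n" for v j
      unfolding F_def by (rule orthonormal_expansion_unique[OF W f that])
    have F_inj: "v = w" if "F v = F w" "v \<in> carrier_vec n" "w \<in> carrier_vec n" for v w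
      using that ip_F[of _ v] ip_F[of _ w] by (intro eq_vecI) auto
    have F_W: "F v \<in> W" for v
      unfolding F_def by (intro invariant_space_lincomb[OF W] basis_in)
    have UW: "U \<subseteq> W" using F_W by (auto simp: U_def)
    have invU: "invariant_space U"
      unfolding invariant_space_def
    proof (intro conjI ballI allI)
      fix g assume "g \<in> U" then show "continuous_on UNIV g" using UW invariant_spaceD(1)[OF W] by blast
    next
      have "F (0\<^sub>v n) = (\<lambda>x. 0)" by (auto simp: F_def fun_eq_iff intro!: sum.neutral)
      then show "(\<lambda>x. 0) \<in> U" unfolding U_def using subD(2) by (metis image_eqI)
    next
      fix g h assume "g \<in> U" "h \<in> U"
      then obtain v w where vw: "v \<in> W'" "w \<in> W'" "g = F v" "h = F w" by (auto simp: U_def)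
      have "F (v + w) = (\<lambda>x. g x + h x)"
        using dim[OF vw(1)] dim[OF vw(2)] by (simp add: vw F_def fun_eq_iff distrib_right sum.distrib)
      then show "(\<lambda>x. g x + h x) \<in> U" unfolding U_def using subD(3)[OF vw(1,2)] by (metis image_eqI)
    next
      fix c g assume "g \<in> U"
      then obtain v where v: "v \<in> W'" "g = F v" by (auto simp: U_def)
      have "F (c \<cdot>\<^sub>v v) = (\<lambda>x. c * g x)"
        using dim[OF v(1)] by (simp add: v F_def fun_eq_iff sum_distrib_left mult.assoc)
      then show "(\<lambda>x. c * g x) \<in> U" unfolding U_def using subD(4)[OF v(1)] by (metis image_eqI)
    next
      fix a g assume "g \<in> U"
      then obtain v where v: "v \<in> W'" "g = F v" by (auto simp: U_def)
      have "F (?\<pi> (- a) *\<^sub>v v) = (\<lambda>x. g (a + x))"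
        using lincomb_translate[OF dim[OF v(1)], of "- a"] by (simp add: v F_def fun_eq_iff)
      then show "(\<lambda>x. g (a + x)) \<in> U" unfolding U_def using inv[OF v(1)] by (metis image_eqI)
    qed
    have "\<forall>k g. orthonormal_in U k g \<longrightarrow> k \<le> n"
      using UW by (intro allI impI orthonormal_card_le[OF W f ex]) (auto simp: orthonormal_in_def)
    from orthonormal_basis_exists[OF invU this]
    obtain k g where g: "orthonormal_in U k g" "\<forall>h\<in>U. expands k g h" by metis
    have gW: "orthonormal_in W k g" using g(1) UW by (auto simp: orthonormal_in_def)
    have "\<not> expands k g (F u)"
    proof
      assume "expands k g (F u)"
      then have "F u = (\<lambda>x. \<Sum>i<k. ip (F u) (g i) * g i x)" by (auto simp: expands_def)
      moreover have "(\<lambda>x. \<Sum>i<k. ip (F u) (g i) * g i x) \<in> U"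
        using g(1) by (intro invariant_space_lincomb[OF invU]) (auto simp: orthonormal_in_def)
      ultimately have "F u \<in> U" by simp
      then obtain w where "w \<in> W'" "F u = F w" by (auto simp: U_def)
      then show False using F_inj[of u w] u dim by auto
    qed
    \<comment> \<open>Since \<open>F u\<close> lies in \<open>W\<close> but outside
      \<open>U\<close>, a basis of \<open>U\<close> has room for one more orthonormal function in
      \<open>W\<close>, so \<open>k < n\<close>.\<close>
    from orthonormal_in_extend[OF W gW F_W this] obtain g' where "orthonormal_in W (Suc k) g'" by metis
    then have "Suc k \<le> n" by (rule orthonormal_card_le[OF W f ex])
    then have k0: "k = 0" using minimal[OF UW invU g] by (cases k) auto
    have "w = 0\<^sub>v n" if w: "w \<in> W'" for w
    proof (rule F_inj[OF _ dim[OF w]])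
      have "expands k g (F w)" using g(2) w by (auto simp: U_def)
      then show "F w = F (0\<^sub>v n)" using k0 by (auto simp: expands_def F_def fun_eq_iff)
    qed simp
    then show "W' = {0\<^sub>v n}" using subD(2) by blast
  qed
qed

end

text \<open>Convolution with a self-adjoint idempotent \<open>p\<close> projects onto a finite-dimensional
  left-invariant space; a minimal invariant subspace of it is spanned by matrix coefficients of an
  irreducible representation, and \<open>p\<close> cannot annihilate these.\<close>

lemma idempotent_not_annihilates:
  assumes p: "annihilates p" "star p = p" "conv p p = p" and p0: "p 0 \<noteq> 0"
  shows False
proof -
  note cp = annihilates_cont[OF p(1)]
  define V where "V = {f. continuous_on UNIV f \<and> conv f p = f}"
  have invV: "invariant_space V"
    unfolding invariant_space_def
  proof (intro conjI ballI allI)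
    fix f g assume f: "f \<in> V" and g: "g \<in> V"
    have "conv (\<lambda>x. f x + g x) p x = f x + g x" for x
      using f g by (subst conv_add_left) (auto simp: V_def cp)
    then show "(\<lambda>x. f x + g x) \<in> V" using f g by (auto simp: V_def intro!: continuous_intros)
  next
    fix a f assume f: "f \<in> V"
    have "conv (\<lambda>x. f (a + x)) p x = f (a + x)" for x
    proof -
      have "conv (\<lambda>x. f (a + x)) p x = (LINT y|m. f (a + y) * p (- (a + y) + (a + x)))"
        by (simp add: convolution_def minus_add add.assoc del: add_uminus_conv_diff)
      also have "\<dots> = conv f p (a + x)"
        unfolding convolution_def using f
        by (intro integral_left[where f = "\<lambda>y. f y * p (- y + (a + x))"] continuous_intros
            cont_compose[OF cp]) (simp add: V_def)
      finally show ?thesis using f by (simp add: V_def)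
    qed
    then show "(\<lambda>x. f (a + x)) \<in> V" using f cont_left by (auto simp: V_def)
  qed (auto simp: V_def conv_scale_left convolution_def[where f = "\<lambda>x. 0"] intro!: continuous_intros)
  \<comment> \<open>As \<open>conv f p = f\<close> and \<open>star p = p\<close>, the value of
    \<open>f i\<close> at \<open>x\<close> is its inner product with the translate of
    \<open>p\<close> by \<open>x\<close>. Bessel bounds the sum of squared values at each
    \<open>x\<close> by \<open>nsq p\<close>; integrating over \<open>x\<close> bounds
    \<open>n\<close>.\<close>
  have boundV: "n \<le> nat \<lceil>nsq p\<rceil>" if f: "orthonormal_in V n f" for n f
  proof -
    have fV: "f i \<in> V" and cf: "continuous_on UNIV (f i)" if "i < n" for i
      using f that by (auto simp: orthonormal_in_def V_def)
    have pointwise: "(\<Sum>i<n. (cmod (f i x))\<^sup>2) \<le> nsq p" for x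
    proof -
      let ?q = "\<lambda>y. p (- x + y)"
      have "cmod (ip ?q (f i)) = cmod (f i x)" if "i < n" for i
        using fV[OF that] conv_ip[of "f i" p x] ip_cnj[of ?q "f i"] by (simp add: V_def p(2))
      then have "(\<Sum>i<n. (cmod (f i x))\<^sup>2) = (\<Sum>i<n. (cmod (ip ?q (f i)))\<^sup>2)" by simp
      also have "\<dots> \<le> nsq ?q"
        using f by (intro Bessel) (auto simp: orthonormal_in_def intro!: cont_sqint cont_left cp cf)
      finally show ?thesis by (simp add: nsq_left[OF cp])
    qed
    have "real n = (\<Sum>i<n. nsq (f i))"
    proof -
      have "complex_of_real (nsq (f i)) = 1" if "i < n" for i
        using f that by (simp add: orthonormal_in_def flip: ip_self)
      then show ?thesis by simp
    qed
    also have "\<dots> = (LINT x|m. (\<Sum>i<n. (cmod (f i x))\<^sup>2))"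
      unfolding nsq_def
      by (rule Bochner_Integration.integral_sum[symmetric]) (auto intro!: integrable_cont continuous_intros cf)
    also have "\<dots> \<le> (LINT x|m. nsq p)"
      using pointwise by (intro integral_mono integrable_cont) (auto intro!: continuous_intros cf)
    finally show ?thesis by simp linarith
  qed
  \<comment> \<open>Dimension 0 is excluded, so that the least dimension satisfying \<open>Q\<close>
    belongs to a nonzero space with no smaller nonzero invariant subspace. The idempotent
    \<open>p\<close>, itself in \<open>V\<close>, shows that some positive dimension occurs.\<close>
  define Q where "Q n \<longleftrightarrow> n > 0 \<and> (\<exists>W f. W \<subseteq> V \<and> invariant_space W \<and> orthonormal_in W n f \<and> (\<forall>g\<in>W. expands n f g))" for n
  obtain n f where nf: "orthonormal_in V n f" "\<forall>g\<in>V. expands n f g"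
    using orthonormal_basis_exists[OF invV, of "nat \<lceil>nsq p\<rceil>"] boundV by metis
  have "expands n f p" using nf(2) cp p(3) by (simp add: V_def)
  then have "n \<noteq> 0" using p0 by (cases n) (auto simp: expands_def)
  then have "Q n" using nf invV by (auto simp: Q_def)
  define d where "d = (LEAST n. Q n)"
  have "Q d" unfolding d_def using \<open>Q n\<close> by (rule LeastI)
  then obtain W b where W: "W \<subseteq> V" "invariant_space W" "orthonormal_in W d b" "\<forall>g\<in>W. expands d b g"
    and d: "d > 0" by (auto simp: Q_def)
  let ?\<pi> = "regular_mat d b"
  have irr: "irreducible_unitary_rep ?\<pi>"
  proof (rule irreducible_regular[OF W(2-4) d])
    fix U k g assume "U \<subseteq> W" "invariant_space U" "orthonormal_in U k g" "\<forall>h\<in>U. expands k g h" "k > 0"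
    then have "Q k" using W(1) unfolding Q_def by blast
    then show "d \<le> k" unfolding d_def by (rule Least_le)
  qed
  have dim: "rep_dim ?\<pi> = d" by (rule rep_dim_regular[OF W(2-4)])
  note rep = irr_rep[OF irr]
  note cpi = rep_cont[OF rep, unfolded dim]
  have b0: "b 0 \<in> V" using W(1,3) d by (auto simp: orthonormal_in_def)
  have pint: "(LINT y|m. cnj (p y) * cnj (?\<pi> y $$ (k, i))) = 0" if "k < d" "i < d" for k i
  proof -
    have "(LINT y|m. p y * ?\<pi> y $$ (k, i)) = 0"
      using p(1) irr that unfolding annihilates_def by (simp add: dim)
    then have "cnj (LINT y|m. p y * ?\<pi> y $$ (k, i)) = 0" by simp
    then show ?thesis by (subst (asm) Bochner_Integration.integral_cnj[symmetric]) simp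
  qed
  have "b 0 x = 0" for x
  proof -
    \<comment> \<open>The reproducing identity, shifted by \<open>x\<close>. Expanding the translate
      of \<open>b 0\<close> in entries of \<open>?\<pi>\<close> leaves only the integrals in
      \<open>pint\<close>, which vanish.\<close>
    have "b 0 x = (LINT y|m. b 0 y * p (- y + x))"
      using b0 by (simp add: V_def convolution_def fun_eq_iff)
    also have "\<dots> = (LINT y|m. b 0 (x + y) * p (- (x + y) + x))"
      using b0 by (intro integral_left[symmetric, where f = "\<lambda>y. b 0 y * p (- y + x)"] continuous_intros
          cont_compose[OF cp]) (simp add: V_def)
    also have "\<dots> = (LINT y|m. (\<Sum>i<d. \<Sum>k<d. (?\<pi> (- x) $$ (k, 0) * b i 0) * (cnj (p y) * cnj (?\<pi> y $$ (k, i)))))"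
    proof (intro Bochner_Integration.integral_cong refl)
      fix y
      have "p (- y) = cnj (p y)" using fun_cong[OF p(2), of "- y"] by (simp add: star_def)
      moreover have "b 0 (x + y) = (\<Sum>i<d. ?\<pi> (- y + - x) $$ (i, 0) * b i 0)"
        using regular_mat_translate[OF W(2-4) d, of "- (x + y)" 0] by (simp add: minus_add)
      moreover have "?\<pi> (- y + - x) $$ (i, 0) = (\<Sum>k<d. cnj (?\<pi> y $$ (k, i)) * ?\<pi> (- x) $$ (k, 0))" if "i < d" for i
        using that d rep_add_entry[OF rep, of i 0 "- y" "- x"] by (simp add: dim rep_minus_entry[OF rep])
      ultimately show "b 0 (x + y) * p (- (x + y) + x) =
          (\<Sum>i<d. \<Sum>k<d. (?\<pi> (- x) $$ (k, 0) * b i 0) * (cnj (p y) * cnj (?\<pi> y $$ (k, i))))"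
        by (simp add: minus_add add.assoc sum_distrib_left sum_distrib_right mult_ac)
    qed
    also have "\<dots> = (\<Sum>i<d. LINT y|m. (\<Sum>k<d. (?\<pi> (- x) $$ (k, 0) * b i 0) * (cnj (p y) * cnj (?\<pi> y $$ (k, i)))))"
      by (rule Bochner_Integration.integral_sum) (auto intro!: integrable_cont continuous_intros cp cpi)
    also have "\<dots> = (\<Sum>i<d. \<Sum>k<d. LINT y|m. (?\<pi> (- x) $$ (k, 0) * b i 0) * (cnj (p y) * cnj (?\<pi> y $$ (k, i))))"
      by (intro sum.cong refl Bochner_Integration.integral_sum) (auto intro!: integrable_cont continuous_intros cp cpi)
    also have "\<dots> = 0" by (simp add: pint)
    finally show ?thesis .
  qed
  then have "ip (b 0) (b 0) = 0" by (simp add: ip_def)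
  then show False using W(3) d by (simp add: orthonormal_in_def)
qed

text \<open>\<open>annihilates\<close> pairs without conjugation whereas \<open>ip\<close>
  conjugates the entry, so the argument runs for the conjugate \<open>g\<close>. Convolving with
  \<open>star g\<close> gives a self-adjoint function whose value at the unit is
  \<open>nsq g\<close>, hence a nonzero one.\<close>

theorem Peter_Weyl_injective:
  assumes f: "continuous_on UNIV f"
    and coeff: "\<And>\<pi> i j. irreducible_unitary_rep \<pi> \<Longrightarrow> i < rep_dim \<pi> \<Longrightarrow> j < rep_dim \<pi> \<Longrightarrow>
      ip f (\<lambda>x. \<pi> x $$ (i, j)) = 0"
  shows "f x = 0"
proof (rule ccontr)
  assume ne: "f x \<noteq> 0"
  define g where "g y = cnj (f y)" for y
  have cg: "continuous_on UNIV g" unfolding g_def by (intro continuous_intros f)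
  have ag: "annihilates g"
    unfolding annihilates_def
  proof (intro conjI allI impI cg)
    fix \<pi> :: "'g \<Rightarrow> complex mat" and i j assume "irreducible_unitary_rep \<pi>" "i < rep_dim \<pi>" "j < rep_dim \<pi>"
    from coeff[OF this] have "cnj (LINT x|m. f x * cnj (\<pi> x $$ (i, j))) = 0" by (simp add: ip_def)
    then show "(LINT x|m. g x * \<pi> x $$ (i, j)) = 0"
      by (subst (asm) Bochner_Integration.integral_cnj[symmetric]) (simp add: g_def)
  qed
  note cs = continuous_star[OF cg]
  define \<phi> where "\<phi> = conv g (star g)"
  have a\<phi>: "annihilates \<phi>" unfolding \<phi>_def by (rule annihilates_conv[OF ag cs])
  have s\<phi>: "star \<phi> = \<phi>" unfolding \<phi>_def by (simp add: star_conv[OF cg cs])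
  have "nsq \<phi> > 0"
  proof (rule ccontr)
    assume "\<not> nsq \<phi> > 0"
    then have "nsq \<phi> = 0" using nsq_nonneg[of \<phi>] by simp
    then have "\<phi> 0 = 0" by (rule nsq_zero_cont[OF annihilates_cont[OF a\<phi>]])
    then have "nsq g = 0" by (simp add: \<phi>_def conv_zero_ip ip_self)
    then have "g x = 0" by (rule nsq_zero_cont[OF cg])
    then show False using ne by (simp add: g_def)
  qed
  from annihilating_idempotent[OF a\<phi> s\<phi> this]
  obtain p where "annihilates p" "star p = p" "conv p p = p" "Re (p 0) \<ge> 1" by metis
  moreover from this(4) have "p 0 \<noteq> 0" by auto
  ultimately show False using idempotent_not_annihilates by blast
qed

end

section \<open>Fourier coefficients and square-integrable densities\<close>

lemma rep_rows_orthonormal: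
  assumes rep: "unitary_rep \<pi>" and "i < rep_dim \<pi>" "j < rep_dim \<pi>"
  shows "(\<Sum>k<rep_dim \<pi>. \<pi> x $$ (i, k) * cnj (\<pi> x $$ (j, k))) = (if i = j then 1 else 0)"
proof -
  have "(\<Sum>k<rep_dim \<pi>. \<pi> x $$ (i, k) * cnj (\<pi> x $$ (j, k))) =
      (\<Sum>k<rep_dim \<pi>. cnj (\<pi> (- x) $$ (k, i)) * \<pi> (- x) $$ (k, j))"
    using assms by (intro sum.cong) (auto simp: rep_minus_entry)
  then show ?thesis using rep_cols_orthonormal[OF assms, of "- x"] by simp
qed

lemma sum_cmod_square_isometry:
  fixes U :: "nat \<Rightarrow> nat \<Rightarrow> complex"
  assumes U: "\<And>k k'. k < d \<Longrightarrow> k' < d \<Longrightarrow> (\<Sum>l<d. U k l * cnj (U k' l)) = (if k = k' then 1 else 0)"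
  shows "(\<Sum>l<d. (cmod (\<Sum>k<d. c k * U k l))\<^sup>2) = (\<Sum>k<d. (cmod (c k))\<^sup>2)"
proof -
  have "complex_of_real (\<Sum>l<d. (cmod (\<Sum>k<d. c k * U k l))\<^sup>2) =
      (\<Sum>l<d. \<Sum>k<d. \<Sum>k'<d. (c k * cnj (c k')) * (U k l * cnj (U k' l)))"
    by (simp add: complex_norm_square sum_product mult_ac del: of_real_power)
  also have "\<dots> = (\<Sum>k<d. \<Sum>l<d. \<Sum>k'<d. (c k * cnj (c k')) * (U k l * cnj (U k' l)))"
    by (rule sum.swap)
  also have "\<dots> = (\<Sum>k<d. \<Sum>k'<d. \<Sum>l<d. (c k * cnj (c k')) * (U k l * cnj (U k' l)))"
    by (intro sum.cong refl sum.swap)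
  also have "\<dots> = (\<Sum>k<d. \<Sum>k'<d. if k = k' then c k * cnj (c k') else 0)"
    by (intro sum.cong refl) (simp add: U flip: sum_distrib_left)
  also have "\<dots> = complex_of_real (\<Sum>k<d. (cmod (c k))\<^sup>2)"
    by (simp add: complex_norm_square del: of_real_power)
  finally show ?thesis unfolding of_real_eq_iff .
qed

lemma sum_cmod_square_rep:
  assumes "unitary_rep \<pi>"
  shows "(\<Sum>l<rep_dim \<pi>. (cmod (\<Sum>k<rep_dim \<pi>. c k * \<pi> x $$ (k, l)))\<^sup>2) = (\<Sum>k<rep_dim \<pi>. (cmod (c k))\<^sup>2)"
  by (rule sum_cmod_square_isometry) (rule rep_rows_orthonormal[OF assms])

section \<open>Fourier series over a system of representatives\<close>

locale compact_group_dual = compact_group m for m :: "'g::{topological_group_add, t2_space} measure" +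
  fixes D :: "('g \<Rightarrow> complex mat) set"
  assumes dual: "dual_representatives D"
begin

lemma dual_irr: "\<pi> \<in> D \<Longrightarrow> irreducible_unitary_rep \<pi>"
  using dual by (simp add: dual_representatives_def)

lemma dual_rep: "\<pi> \<in> D \<Longrightarrow> unitary_rep \<pi>"
  by (rule irr_rep[OF dual_irr])

lemma dual_cont:
  "\<pi> \<in> D \<Longrightarrow> i < rep_dim \<pi> \<Longrightarrow> j < rep_dim \<pi> \<Longrightarrow> continuous_on UNIV (\<lambda>x. \<pi> x $$ (i, j))"
  by (rule rep_cont[OF dual_rep])

lemma dual_orthogonality:
  assumes "\<pi> \<in> D" "\<rho> \<in> D" "i < rep_dim \<pi>" "j < rep_dim \<pi>" "k < rep_dim \<rho>" "l < rep_dim \<rho>"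
  shows "ip (\<lambda>x. \<pi> x $$ (i, j)) (\<lambda>x. \<rho> x $$ (k, l)) =
    (if \<pi> = \<rho> \<and> i = k \<and> j = l then 1 / of_nat (rep_dim \<pi>) else 0)"
proof (cases "\<pi> = \<rho>")
  case True
  then show ?thesis using Schur_orthogonality[OF dual_irr] assms by auto
next
  case False
  then show ?thesis
    using Schur_orthogonality_inequivalent[OF dual_irr dual_irr
      dual_representatives_inequivalent[OF dual assms(1,2)]] assms by auto
qed

text \<open>By Schur's relations the entries of \<pi> become orthonormal after multiplication by
  \<open>sqrt (rep_dim \<pi>)\<close>; squaring this factor yields the weight in the sum.\<close>

lemma Bessel_dual:
  assumes F: "finite F" "F \<subseteq> D" and h: "sqint h"
  shows "(\<Sum>\<pi>\<in>F. real (rep_dim \<pi>) *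
    (\<Sum>i<rep_dim \<pi>. \<Sum>j<rep_dim \<pi>. (cmod (ip h (\<lambda>x. \<pi> x $$ (i, j))))\<^sup>2)) \<le> nsq h"
proof -
  define I where "I = (SIGMA \<pi>:F. {..<rep_dim \<pi>} \<times> {..<rep_dim \<pi>})"
  define b where "b = (\<lambda>(\<pi>, i, j) x. complex_of_real (sqrt (real (rep_dim \<pi>))) * (\<pi> :: 'g \<Rightarrow> complex mat) x $$ (i, j))"
  have "(\<Sum>a\<in>I. (cmod (ip h (b a)))\<^sup>2) \<le> nsq h"
  proof (rule Bessel[OF _ _ h])
    show "finite I" using F by (auto simp: I_def)
    fix a assume "a \<in> I"
    then show "sqint (b a)"
      using F by (auto simp: I_def b_def intro!: cont_sqint continuous_intros dual_cont)
  next
    fix a a' assume "a \<in> I" "a' \<in> I"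
    then obtain \<pi> i j \<rho> k l where a: "a = (\<pi>, i, j)" "a' = (\<rho>, k, l)" "\<pi> \<in> D" "\<rho> \<in> D"
      "i < rep_dim \<pi>" "j < rep_dim \<pi>" "k < rep_dim \<rho>" "l < rep_dim \<rho>"
      unfolding I_def by (elim SigmaE) (use F in auto)
    have "complex_of_real (sqrt (real (rep_dim \<pi>))) * complex_of_real (sqrt (real (rep_dim \<pi>))) = of_nat (rep_dim \<pi>)"
      by (simp flip: of_real_mult)
    then show "ip (b a) (b a') = (if a = a' then 1 else 0)"
      using irr_dim[OF dual_irr[OF a(3)]]
      by (auto simp: a(1,2) b_def ip_scale_left ip_scale_right dual_orthogonality[OF a(3-8)] mult.assoc[symmetric])
  qed
  also have "(\<Sum>a\<in>I. (cmod (ip h (b a)))\<^sup>2) =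
      (\<Sum>\<pi>\<in>F. \<Sum>p\<in>{..<rep_dim \<pi>} \<times> {..<rep_dim \<pi>}. (cmod (ip h (b (\<pi>, p))))\<^sup>2)"
    unfolding I_def using F by (subst sum.Sigma) (auto simp: case_prod_beta')
  also have "\<dots> = (\<Sum>\<pi>\<in>F. real (rep_dim \<pi>) *
    (\<Sum>i<rep_dim \<pi>. \<Sum>j<rep_dim \<pi>. (cmod (ip h (\<lambda>x. \<pi> x $$ (i, j))))\<^sup>2))"
    unfolding sum.cartesian_product'
    by (simp add: b_def ip_scale_right norm_mult power_mult_distrib sum_distrib_left)
  finally show ?thesis .
qed

text \<open>The entries of any irreducible representation are linear combinations of those of its
  representative, obtained by conjugating with the intertwining unitary matrix.\<close>

lemma Peter_Weyl_dual:
  assumes f: "continuous_on UNIV f"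
    and coeff: "\<And>\<rho> k l. \<rho> \<in> D \<Longrightarrow> k < rep_dim \<rho> \<Longrightarrow> l < rep_dim \<rho> \<Longrightarrow> ip f (\<lambda>x. \<rho> x $$ (k, l)) = 0"
  shows "f x = 0"
proof (rule Peter_Weyl_injective[OF f])
  fix \<pi> :: "'g \<Rightarrow> complex mat" and i j
  assume irr: "irreducible_unitary_rep \<pi>" and ij: "i < rep_dim \<pi>" "j < rep_dim \<pi>"
  obtain \<rho> where \<rho>: "\<rho> \<in> D" "unitarily_equivalent \<pi> \<rho>"
    using dual irr unfolding dual_representatives_def by blast
  let ?d = "rep_dim \<pi>"
  from \<rho>(2) obtain U where d: "rep_dim \<rho> = ?d" and U: "U \<in> carrier_mat ?d ?d" "mat_adjoint U * U = 1\<^sub>m ?d"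
    and comm: "\<And>x. U * \<pi> x = \<rho> x * U"
    by (auto simp: unitarily_equivalent_def unitary_mat_def)
  note cp = rep_carrier[OF irr_rep[OF irr]] and cr = rep_carrier[OF dual_rep[OF \<rho>(1)], unfolded d]
  note U' = mat_adjoint_carrier[OF U(1)]
  have \<pi>: "\<pi> x $$ (i, j) = (\<Sum>k<?d. \<Sum>l<?d. cnj (U $$ (k, i)) * U $$ (l, j) * \<rho> x $$ (k, l))" for x
  proof -
    have "\<pi> x = (mat_adjoint U * U) * \<pi> x" using cp[of x] by (simp add: U(2))
    also have "\<dots> = mat_adjoint U * (\<rho> x * U)"
      unfolding comm[symmetric] by (rule assoc_mult_mat[OF U' U(1) cp])
    finally have "\<pi> x $$ (i, j) = (mat_adjoint U * (\<rho> x * U)) $$ (i, j)" by simp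
    also have "\<dots> = (\<Sum>k<?d. mat_adjoint U $$ (i, k) * (\<rho> x * U) $$ (k, j))"
      by (rule index_mult_mat_sum[OF U' _ ij]) (use cr[of x] U(1) in auto)
    also have "\<dots> = (\<Sum>k<?d. cnj (U $$ (k, i)) * (\<Sum>l<?d. \<rho> x $$ (k, l) * U $$ (l, j)))"
    proof (rule sum.cong)
      fix k assume "k \<in> {..<?d}"
      then have k: "k < ?d" by simp
      show "mat_adjoint U $$ (i, k) * (\<rho> x * U) $$ (k, j) =
          cnj (U $$ (k, i)) * (\<Sum>l<?d. \<rho> x $$ (k, l) * U $$ (l, j))"
        using index_mat_adjoint[OF U(1) ij(1) k] index_mult_mat_sum[OF cr U(1) k ij(2)] by simp
    qed simp
    finally show ?thesis by (simp add: sum_distrib_left mult_ac)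
  qed
  have sr: "sqint (\<lambda>x. \<rho> x $$ (k, l))" if "k < ?d" "l < ?d" for k l
    using that by (intro cont_sqint dual_cont \<rho>) (auto simp: d)
  let ?c = "\<lambda>k l. cnj (U $$ (k, i)) * U $$ (l, j)"
  have inner: "sqint (\<lambda>x. \<Sum>l<?d. ?c k l * \<rho> x $$ (k, l))" if "k < ?d" for k
    using that by (intro sqint_sum sqint_scale sr) auto
  have "ip f (\<lambda>x. \<Sum>l<?d. ?c k l * \<rho> x $$ (k, l)) = (\<Sum>l<?d. cnj (?c k l) * ip f (\<lambda>x. \<rho> x $$ (k, l)))"
    if "k < ?d" for k
    using that by (subst ip_sum_right) (simp_all add: sqint_scale sr cont_sqint[OF f] ip_scale_right)
  then have "ip f (\<lambda>x. \<pi> x $$ (i, j)) = (\<Sum>k<?d. \<Sum>l<?d. cnj (?c k l) * ip f (\<lambda>x. \<rho> x $$ (k, l)))"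
    unfolding \<pi> by (subst ip_sum_right) (auto simp: inner cont_sqint[OF f])
  then show "ip f (\<lambda>x. \<pi> x $$ (i, j)) = 0" using coeff[OF \<rho>(1)] by (simp add: d)
qed

text \<open>For continuous \<open>h\<close> the function \<open>H x = \<integral> h (y + x) d\<mu>(y)\<close> is continuous and its Fourier series
  converges absolutely and uniformly, being dominated by \<open>(\<Sum>\<^sub>\<pi> d\<^sub>\<pi> (\<parallel>\<mu>^(\<pi>)\<parallel>\<^sup>2 + \<parallel>h^(\<pi>)\<parallel>\<^sup>2)) / 2\<close>; so it represents
  \<open>H\<close>, and evaluation at the unit gives a Parseval-type bound.\<close>

lemma Fourier_Stieltjes_bound:
  fixes \<mu> :: "'g measure"
  assumes \<mu>: "finite_measure \<mu>" "sets \<mu> = sets borel"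
    and S: "\<And>F. finite F \<Longrightarrow> F \<subseteq> D \<Longrightarrow> (\<Sum>\<pi>\<in>F. real (rep_dim \<pi>) *
      (\<Sum>i<rep_dim \<pi>. \<Sum>j<rep_dim \<pi>. (cmod (LINT x|\<mu>. \<pi> x $$ (i, j)))\<^sup>2)) \<le> S"
    and h: "continuous_on UNIV h"
  shows "cmod (LINT x|\<mu>. h x) \<le> sqrt S * sqrt (nsq h)"
proof -
  define M where "M \<pi> i j = (LINT x|\<mu>. \<pi> x $$ (i, j))" for \<pi> :: "'g \<Rightarrow> complex mat" and i j
  define C where "C \<pi> i j = ip h (\<lambda>x. \<pi> x $$ (i, j))" for \<pi> :: "'g \<Rightarrow> complex mat" and i j
  define A where "A \<pi> = real (rep_dim \<pi>) * (\<Sum>i<rep_dim \<pi>. \<Sum>j<rep_dim \<pi>. (cmod (M \<pi> i j))\<^sup>2)" for \<pi>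
  define B where "B \<pi> = real (rep_dim \<pi>) * (\<Sum>i<rep_dim \<pi>. \<Sum>j<rep_dim \<pi>. (cmod (C \<pi> i j))\<^sup>2)" for \<pi>
  define H where "H x = (LINT y|\<mu>. h (y + x))" for x
  \<comment> \<open>The contribution of \<pi> to the Fourier series of \<open>H\<close>; the
    innermost sum is the integral of entry \<open>(j, l)\<close> of \<open>\<pi> (y + x)\<close>
    over \<open>y\<close>. The value 0 off \<open>D\<close> makes \<open>R \<pi>\<close> continuous
    for every \<pi>.\<close>
  define R where "R \<pi> x = (if \<pi> \<in> D then of_nat (rep_dim \<pi>) *
      (\<Sum>j<rep_dim \<pi>. \<Sum>l<rep_dim \<pi>. C \<pi> j l * (\<Sum>k<rep_dim \<pi>. M \<pi> j k * \<pi> x $$ (k, l))) else 0)" for \<pi> x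
  have sumA: "sum A F \<le> S" and sumB: "sum B F \<le> nsq h" if "finite F" "F \<subseteq> D" for F
    using S[OF that] Bessel_dual[OF that cont_sqint[OF h]] by (simp_all add: A_def B_def M_def C_def)
  have AB0: "A \<pi> \<ge> 0" "B \<pi> \<ge> 0" for \<pi>
    by (auto simp: A_def B_def intro!: mult_nonneg_nonneg sum_nonneg)
  have bound: "cmod (R \<pi> x) \<le> (A \<pi> + B \<pi>) / 2" if \<pi>: "\<pi> \<in> D" for \<pi> x
  proof -
    let ?d = "rep_dim \<pi>" and ?N = "\<lambda>j l. \<Sum>k<rep_dim \<pi>. M \<pi> j k * \<pi> x $$ (k, l)"
    have "cmod (\<Sum>j<?d. \<Sum>l<?d. C \<pi> j l * ?N j l) \<le> (\<Sum>j<?d. \<Sum>l<?d. ((cmod (?N j l))\<^sup>2 + (cmod (C \<pi> j l))\<^sup>2) / 2)"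
    proof (intro order_trans[OF norm_sum] sum_mono)
      fix j l
      have "a * b \<le> (b\<^sup>2 + a\<^sup>2) / 2" for a b :: real
        using sum_squares_bound[of a b] by simp
      then show "cmod (C \<pi> j l * ?N j l) \<le> ((cmod (?N j l))\<^sup>2 + (cmod (C \<pi> j l))\<^sup>2) / 2"
        unfolding norm_mult .
    qed
    also have "\<dots> = ((\<Sum>j<?d. \<Sum>l<?d. (cmod (?N j l))\<^sup>2) + (\<Sum>j<?d. \<Sum>l<?d. (cmod (C \<pi> j l))\<^sup>2)) / 2"
      by (simp add: sum.distrib flip: sum_divide_distrib)
    \<comment> \<open>Right multiplication by the unitary matrix \<open>\<pi> x\<close> preserves
      the sum of squares, which frees the bound from \<open>x\<close>.\<close>
    also have "(\<Sum>j<?d. \<Sum>l<?d. (cmod (?N j l))\<^sup>2) = (\<Sum>j<?d. \<Sum>l<?d. (cmod (M \<pi> j l))\<^sup>2)"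
      by (simp add: sum_cmod_square_rep[OF dual_rep[OF \<pi>]])
    finally have "real ?d * cmod (\<Sum>j<?d. \<Sum>l<?d. C \<pi> j l * ?N j l) \<le>
        real ?d * (((\<Sum>j<?d. \<Sum>l<?d. (cmod (M \<pi> j l))\<^sup>2) + (\<Sum>j<?d. \<Sum>l<?d. (cmod (C \<pi> j l))\<^sup>2)) / 2)"
      by (intro mult_left_mono) auto
    then show ?thesis using \<pi> by (simp add: R_def A_def B_def norm_mult distrib_left)
  qed
  have contR: "continuous_on UNIV (R \<pi>)" for \<pi>
    unfolding R_def by (cases "\<pi> \<in> D") (auto intro!: continuous_intros dual_cont)
  have "(\<lambda>\<pi>. (A \<pi> + B \<pi>) / 2) summable_on D"
  proof (rule nonneg_bdd_above_summable_on)
    show "bdd_above (sum (\<lambda>\<pi>. (A \<pi> + B \<pi>) / 2) ` {F. F \<subseteq> D \<and> finite F})"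
    proof (rule bdd_aboveI2)
      fix F assume "F \<in> {F. F \<subseteq> D \<and> finite F}"
      then show "(\<Sum>\<pi>\<in>F. (A \<pi> + B \<pi>) / 2) \<le> (S + nsq h) / 2"
        using sumA[of F] sumB[of F] by (simp add: sum.distrib flip: sum_divide_distrib)
    qed
  qed (use AB0 in auto)
  \<comment> \<open>The M-test in its form for unordered sums, since \<open>D\<close> may be
    uncountable.\<close>
  with bound have ul: "uniform_limit UNIV (\<lambda>F x. \<Sum>\<pi>\<in>F. R \<pi> x) (\<lambda>x. \<Sum>\<^sub>\<infinity>\<pi>\<in>D. R \<pi> x) (finite_subsets_at_top D)"
    by (intro Weierstrass_m_test_general[where M = "\<lambda>\<pi>. (A \<pi> + B \<pi>) / 2"]) auto
  define T where "T x = (\<Sum>\<^sub>\<infinity>\<pi>\<in>D. R \<pi> x)" for x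
  have contF: "continuous_on UNIV (\<lambda>x. \<Sum>\<pi>\<in>F. R \<pi> x)" for F
    by (intro continuous_intros contR)
  have contT: "continuous_on UNIV T"
    unfolding T_def by (rule uniform_limit_theorem[OF _ ul]) (simp_all add: contF)
  have contH: "continuous_on UNIV H"
  proof -
    have "continuous_on UNIV (\<lambda>p. h (snd p + fst p))"
      by (intro cont_compose[OF h] continuous_intros)
    from continuous_parametric_integral[OF compact_UNIV \<mu> this] show ?thesis by (simp add: H_def)
  qed
  have coefT: "ip T (\<lambda>x. \<rho> x $$ (a, b)) = (\<Sum>j<rep_dim \<rho>. C \<rho> j b * M \<rho> j a)"
    if \<rho>: "\<rho> \<in> D" and ab: "a < rep_dim \<rho>" "b < rep_dim \<rho>" for \<rho> a b
  proof -
    let ?r = "\<lambda>x. \<rho> x $$ (a, b)"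
    have cr: "continuous_on UNIV ?r" using \<rho> ab by (rule dual_cont)
    have R\<rho>: "ip (R \<pi>) ?r = (if \<pi> = \<rho> then \<Sum>j<rep_dim \<rho>. C \<rho> j b * M \<rho> j a else 0)" if \<pi>: "\<pi> \<in> D" for \<pi>
    proof -
      let ?d = "rep_dim \<pi>"
      have s: "sqint (\<lambda>x. \<pi> x $$ (k, l))" if "k < ?d" "l < ?d" for k l
        using that \<pi> by (intro cont_sqint dual_cont)
      have "ip (R \<pi>) ?r = of_nat ?d * (\<Sum>j<?d. \<Sum>l<?d. C \<pi> j l * (\<Sum>k<?d. M \<pi> j k * ip (\<lambda>x. \<pi> x $$ (k, l)) ?r))"
      proof -
        have s1: "sqint (\<lambda>x. \<Sum>k<?d. M \<pi> j k * \<pi> x $$ (k, l))" if "l < ?d" for j l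
          using that by (intro sqint_sum sqint_scale s) auto
        have s2: "sqint (\<lambda>x. \<Sum>l<?d. C \<pi> j l * (\<Sum>k<?d. M \<pi> j k * \<pi> x $$ (k, l)))" for j
          by (intro sqint_sum sqint_scale s1) auto
        have "ip (\<lambda>x. \<Sum>k<?d. M \<pi> j k * \<pi> x $$ (k, l)) ?r = (\<Sum>k<?d. M \<pi> j k * ip (\<lambda>x. \<pi> x $$ (k, l)) ?r)"
          if "l < ?d" for j l
          using that by (subst ip_sum_left) (simp_all add: sqint_scale s cont_sqint[OF cr] ip_scale_left)
        then have "ip (\<lambda>x. \<Sum>l<?d. C \<pi> j l * (\<Sum>k<?d. M \<pi> j k * \<pi> x $$ (k, l))) ?r =
            (\<Sum>l<?d. C \<pi> j l * (\<Sum>k<?d. M \<pi> j k * ip (\<lambda>x. \<pi> x $$ (k, l)) ?r))" for j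
          by (subst ip_sum_left) (simp_all add: sqint_scale s1 cont_sqint[OF cr] ip_scale_left)
        then have "ip (\<lambda>x. \<Sum>j<?d. \<Sum>l<?d. C \<pi> j l * (\<Sum>k<?d. M \<pi> j k * \<pi> x $$ (k, l))) ?r =
            (\<Sum>j<?d. \<Sum>l<?d. C \<pi> j l * (\<Sum>k<?d. M \<pi> j k * ip (\<lambda>x. \<pi> x $$ (k, l)) ?r))"
          by (subst ip_sum_left) (simp_all add: s2 cont_sqint[OF cr])
        moreover have "R \<pi> = (\<lambda>x. of_nat ?d * (\<Sum>j<?d. \<Sum>l<?d. C \<pi> j l * (\<Sum>k<?d. M \<pi> j k * \<pi> x $$ (k, l))))"
          using \<pi> by (simp add: R_def fun_eq_iff)
        ultimately show ?thesis by (simp only: ip_scale_left)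
      qed
      also have "\<dots> = of_nat ?d * (\<Sum>j<?d. \<Sum>l<?d. C \<pi> j l * (\<Sum>k<?d. if \<pi> = \<rho> \<and> k = a \<and> l = b then M \<pi> j k / of_nat ?d else 0))"
      proof -
        have "M \<pi> j k * ip (\<lambda>x. \<pi> x $$ (k, l)) ?r = (if \<pi> = \<rho> \<and> k = a \<and> l = b then M \<pi> j k / of_nat ?d else 0)"
          if "k < ?d" "l < ?d" for j k l
          unfolding dual_orthogonality[OF \<pi> \<rho> that ab] by simp
        then show ?thesis by simp
      qed
      also have "\<dots> = (if \<pi> = \<rho> then \<Sum>j<rep_dim \<rho>. C \<rho> j b * M \<rho> j a else 0)"
      proof (cases "\<pi> = \<rho>")
        case True
        have "(\<Sum>l<?d. C \<pi> j l * (\<Sum>k<?d. if \<pi> = \<rho> \<and> k = a \<and> l = b then M \<pi> j k / of_nat ?d else 0)) =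
            C \<pi> j b * (M \<pi> j a / of_nat ?d)" for j
        proof -
          have "(\<Sum>l<?d. C \<pi> j l * (\<Sum>k<?d. if \<pi> = \<rho> \<and> k = a \<and> l = b then M \<pi> j k / of_nat ?d else 0)) =
             (\<Sum>l<?d. if l = b then C \<pi> j b * (M \<pi> j a / of_nat ?d) else 0)"
            using True ab by (intro sum.cong) auto
          then show ?thesis using True ab by simp
        qed
        then show ?thesis
          using True irr_dim[OF dual_irr[OF \<rho>]] by (simp flip: sum_divide_distrib)
      qed simp
      finally show ?thesis .
    qed
    have "((\<lambda>F. ip (\<lambda>x. \<Sum>\<pi>\<in>F. R \<pi> x) ?r) \<longlongrightarrow> ip T ?r) (finite_subsets_at_top D)"
      using ul unfolding T_def[symmetric] by (rule uniform_limit_ip[OF _ contF contT cr])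
    \<comment> \<open>Once \<open>F\<close> contains \<rho>, orthogonality makes the coefficient of
      the partial sum independent of \<open>F\<close>.\<close>
    moreover have "\<forall>\<^sub>F F in finite_subsets_at_top D. ip (\<lambda>x. \<Sum>\<pi>\<in>F. R \<pi> x) ?r = (\<Sum>j<rep_dim \<rho>. C \<rho> j b * M \<rho> j a)"
    proof (rule eventually_finite_subsets_at_top[THEN iffD2], intro exI[of _ "{\<rho>}"] conjI allI impI)
      fix F assume F: "finite F \<and> {\<rho>} \<subseteq> F \<and> F \<subseteq> D"
      have "ip (\<lambda>x. \<Sum>\<pi>\<in>F. R \<pi> x) ?r = (\<Sum>\<pi>\<in>F. ip (R \<pi>) ?r)"
        by (intro ip_sum_left cont_sqint contR cr)
      also have "\<dots> = (\<Sum>\<pi>\<in>F. if \<pi> = \<rho> then \<Sum>j<rep_dim \<rho>. C \<rho> j b * M \<rho> j a else 0)"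
        using F R\<rho> by (intro sum.cong) auto
      finally show "ip (\<lambda>x. \<Sum>\<pi>\<in>F. R \<pi> x) ?r = (\<Sum>j<rep_dim \<rho>. C \<rho> j b * M \<rho> j a)"
        using F by simp
    qed (use \<rho> in auto)
    ultimately have "((\<lambda>F. \<Sum>j<rep_dim \<rho>. C \<rho> j b * M \<rho> j a) \<longlongrightarrow> ip T ?r) (finite_subsets_at_top D)"
      by (rule Lim_transform_eventually)
    then show ?thesis by (intro tendsto_unique[OF _ _ tendsto_const]) auto
  qed
  have coefH: "ip H (\<lambda>x. \<rho> x $$ (a, b)) = (\<Sum>j<rep_dim \<rho>. C \<rho> j b * M \<rho> j a)"
    if \<rho>: "\<rho> \<in> D" and ab: "a < rep_dim \<rho>" "b < rep_dim \<rho>" for \<rho> a b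
  proof -
    let ?d = "rep_dim \<rho>"
    note rep = dual_rep[OF \<rho>]
    note cp = dual_cont[OF \<rho>]
    have "ip H (\<lambda>x. \<rho> x $$ (a, b)) = (LINT x|m. LINT y|\<mu>. h (y + x) * cnj (\<rho> x $$ (a, b)))"
      by (simp add: ip_def H_def)
    also have "\<dots> = (LINT y|\<mu>. LINT x|m. h (y + x) * cnj (\<rho> x $$ (a, b)))"
      by (rule Fubini_continuous[OF compact_UNIV compact_UNIV finite_m sets_m \<mu>])
         (intro continuous_intros cont_compose[OF h] cont_compose[OF cp] ab)
    also have "\<dots> = (LINT y|\<mu>. (\<Sum>j<?d. C \<rho> j b * \<rho> y $$ (j, a)))"
    proof (rule Bochner_Integration.integral_cong[OF refl])
      fix y
      \<comment> \<open>Writing \<open>x\<close> as \<open>- y + (y + x)\<close> lets invariance of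
        \<open>m\<close> absorb the translation of \<open>h\<close>; the shift reappears in \<rho>,
        where multiplicativity separates \<open>x\<close> from \<open>y\<close>.\<close>
      have "(LINT x|m. h (y + x) * cnj (\<rho> x $$ (a, b))) = (LINT x|m. h (y + x) * cnj (\<rho> (- y + (y + x)) $$ (a, b)))"
        by simp
      also have "\<dots> = (LINT x|m. h x * cnj (\<rho> (- y + x) $$ (a, b)))"
        by (rule integral_left[where f = "\<lambda>x. h x * cnj (\<rho> (- y + x) $$ (a, b))"])
           (intro continuous_intros h cont_compose[OF cp] ab)
      also have "\<dots> = ip h (\<lambda>x. \<Sum>j<?d. cnj (\<rho> y $$ (j, a)) * \<rho> x $$ (j, b))"
        unfolding ip_def rep_add_entry[OF rep ab] using ab by (simp add: rep_minus_entry[OF rep])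
      also have "\<dots> = (\<Sum>j<?d. C \<rho> j b * \<rho> y $$ (j, a))"
        using ab by (subst ip_sum_right)
          (auto simp: ip_scale_right C_def mult.commute[of "ip _ _"] intro!: cont_sqint continuous_intros cp h)
      finally show "(LINT x|m. h (y + x) * cnj (\<rho> x $$ (a, b))) = (\<Sum>j<?d. C \<rho> j b * \<rho> y $$ (j, a))" .
    qed
    also have "\<dots> = (\<Sum>j<?d. C \<rho> j b * M \<rho> j a)"
      unfolding M_def using ab
      by (subst Bochner_Integration.integral_sum)
         (auto intro!: integrable_continuous[OF compact_UNIV \<mu>] continuous_intros cp)
    finally show ?thesis .
  qed
  have "H x - T x = 0" for x
  proof (rule Peter_Weyl_dual)
    show "continuous_on UNIV (\<lambda>x. H x - T x)" by (intro continuous_intros contH contT)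
    fix \<rho> k l assume \<rho>: "\<rho> \<in> D" "k < rep_dim \<rho>" "l < rep_dim \<rho>"
    show "ip (\<lambda>x. H x - T x) (\<lambda>x. \<rho> x $$ (k, l)) = 0"
      by (subst ip_diff_left) (auto intro!: cont_sqint contH contT dual_cont \<rho> simp: coefH[OF \<rho>] coefT[OF \<rho>])
  qed
  from this[of 0] have HT: "(LINT x|\<mu>. h x) = T 0" by (simp add: H_def)
  \<comment> \<open>The estimate by \<open>(A \<pi> + B \<pi>) / 2\<close> secured convergence but
    is not homogeneous in \<open>h\<close>. At the unit, Cauchy-Schwarz within each \<pi> and again
    over \<open>F\<close> gives the product of norms instead.\<close>
  have part: "cmod (\<Sum>\<pi>\<in>F. R \<pi> 0) \<le> sqrt S * sqrt (nsq h)" if F: "finite F" "F \<subseteq> D" for F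
  proof -
    have "cmod (R \<pi> 0) \<le> sqrt (A \<pi>) * sqrt (B \<pi>)" if \<pi>: "\<pi> \<in> D" for \<pi>
    proof -
      let ?d = "rep_dim \<pi>" and ?J = "{..<rep_dim \<pi>} \<times> {..<rep_dim \<pi>}"
      have "(\<Sum>k<?d. M \<pi> j k * \<pi> 0 $$ (k, l)) = M \<pi> j l" if "l < ?d" for j l
      proof -
        have "(\<Sum>k<?d. M \<pi> j k * \<pi> 0 $$ (k, l)) = (\<Sum>k<?d. if k = l then M \<pi> j k else 0)"
          using that by (intro sum.cong) (auto simp: rep_zero[OF dual_rep[OF \<pi>]])
        then show ?thesis using that by simp
      qed
      then have R0: "R \<pi> 0 = of_nat ?d * (\<Sum>(j, l)\<in>?J. C \<pi> j l * M \<pi> j l)"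
        using \<pi> by (simp add: R_def flip: sum.cartesian_product)
      have "cmod (\<Sum>(j, l)\<in>?J. C \<pi> j l * M \<pi> j l) \<le> (\<Sum>p\<in>?J. \<bar>cmod (M \<pi> (fst p) (snd p))\<bar> * \<bar>cmod (C \<pi> (fst p) (snd p))\<bar>)"
        by (rule order_trans[OF norm_sum]) (simp add: case_prod_beta norm_mult mult.commute)
      also have "\<dots> \<le> L2_set (\<lambda>p. cmod (M \<pi> (fst p) (snd p))) ?J * L2_set (\<lambda>p. cmod (C \<pi> (fst p) (snd p))) ?J"
        by (rule L2_set_mult_ineq)
      finally have "cmod (R \<pi> 0) \<le> real ?d * (L2_set (\<lambda>p. cmod (M \<pi> (fst p) (snd p))) ?J * L2_set (\<lambda>p. cmod (C \<pi> (fst p) (snd p))) ?J)"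
        unfolding R0 norm_mult by (auto intro: mult_left_mono)
      also have "\<dots> = sqrt (A \<pi>) * sqrt (B \<pi>)"
        by (simp add: A_def B_def L2_set_def real_sqrt_mult sum.cartesian_product case_prod_beta)
      finally show ?thesis .
    qed
    then have "cmod (\<Sum>\<pi>\<in>F. R \<pi> 0) \<le> (\<Sum>\<pi>\<in>F. \<bar>sqrt (A \<pi>)\<bar> * \<bar>sqrt (B \<pi>)\<bar>)"
      using F AB0 by (intro order_trans[OF norm_sum] sum_mono) auto
    also have "\<dots> \<le> L2_set (\<lambda>\<pi>. sqrt (A \<pi>)) F * L2_set (\<lambda>\<pi>. sqrt (B \<pi>)) F"
      by (rule L2_set_mult_ineq)
    also have "\<dots> = sqrt (sum A F) * sqrt (sum B F)" by (simp add: L2_set_def AB0)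
    also have "\<dots> \<le> sqrt S * sqrt (nsq h)"
      using sumA[OF F] sumB[OF F] AB0 by (intro mult_mono) (auto intro!: sum_nonneg order_trans[OF _ sumA[OF F]])
    finally show ?thesis .
  qed
  have "((\<lambda>F. \<Sum>\<pi>\<in>F. R \<pi> 0) \<longlongrightarrow> T 0) (finite_subsets_at_top D)"
    unfolding T_def by (rule tendsto_uniform_limitI[OF ul]) simp
  then have "cmod (T 0) \<le> sqrt S * sqrt (nsq h)"
    by (rule tendsto_upperbound[OF tendsto_norm]) (auto intro!: eventually_finite_subsets_at_top_weakI part)
  then show ?thesis by (simp add: HT)
qed

end

section \<open>From a bound on continuous functions to a square-integrable density\<close>

lemma Urysohn_compact_space:
  fixes C U :: "'a::t2_space set"
  assumes "compact (UNIV :: 'a set)" "closed C" "open U" "C \<subseteq> U"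
  obtains h :: "'a \<Rightarrow> real" where "continuous_on UNIV h" "\<And>x. 0 \<le> h x" "\<And>x. h x \<le> 1"
    "\<And>x. x \<in> C \<Longrightarrow> h x = 1" "\<And>x. x \<notin> U \<Longrightarrow> h x = 0"
proof -
  have "Hausdorff_space (euclidean :: 'a topology)"
    unfolding Hausdorff_space_def by (simp add: disjnt_def) (metis hausdorff)
  moreover have "compact_space (euclidean :: 'a topology)"
    using assms(1) by (simp add: compact_space_def compactin_euclidean_iff)
  ultimately have "normal_space (euclidean :: 'a topology)"
    using compact_Hausdorff_or_regular_imp_normal_space by blast
  moreover have "closedin euclidean (- U)" "closedin euclidean C" "disjnt (- U) C"
    using assms by (auto simp: disjnt_def closed_closedin[symmetric])
  ultimately obtain h where h: "continuous_map euclidean (top_of_set {0..1::real}) h" "h ` (- U) \<subseteq> {0}" "h ` C \<subseteq> {1}"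
    by (rule Urysohn_lemma[where a = 0 and b = 1]) auto
  have "continuous_on UNIV h" and "\<And>x. h x \<in> {0..1}"
    using h(1) by (auto simp: continuous_map_in_subtopology)
  then show ?thesis using h(2,3) by (intro that[of h]) auto
qed

lemma regular_borel_approx:
  assumes M: "regular_borel_measure M" "finite_measure M" and A: "A \<in> sets borel" and e: "e > 0"
  obtains C U where "compact C" "open U" "C \<subseteq> A" "A \<subseteq> U" "measure M U - measure M C < e"
proof -
  interpret finite_measure M by fact
  have s: "sets M = sets borel" using M by (simp add: regular_borel_measure_def)
  have fin: "emeasure M A \<noteq> \<infinity>" by simp
  have e2: "0 < e / 2" using e by simp
  have out: "emeasure M A = (INF U\<in>{U. open U \<and> A \<subseteq> U}. emeasure M U)"
    and inn: "emeasure M A = (SUP C\<in>{C. compact C \<and> C \<subseteq> A}. emeasure M C)"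
    using M A by (auto simp: regular_borel_measure_def)
  obtain U where U: "open U" "A \<subseteq> U" "emeasure M U < emeasure M A + ennreal (e / 2)"
    using INF_approx_ennreal[OF e2 out fin] by auto
  have "{C. compact C \<and> C \<subseteq> A} \<noteq> {}" by (auto intro: exI[of _ "{}"])
  from SUP_approx_ennreal[OF e2 this inn fin]
  obtain C where C: "compact C" "C \<subseteq> A" "emeasure M A < emeasure M C + ennreal (e / 2)" by auto
  have "ennreal (measure M U) < ennreal (measure M A + e / 2)"
    using U(3) e by (simp add: emeasure_eq_measure ennreal_plus)
  moreover have "ennreal (measure M A) < ennreal (measure M C + e / 2)"
    using C(3) e by (simp add: emeasure_eq_measure ennreal_plus)
  ultimately have "measure M U < measure M A + e / 2" "measure M A < measure M C + e / 2"
    by (simp_all add: ennreal_less_iff)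
  then show ?thesis using that U C by simp
qed

text \<open>The bound to be extended compares an integral for one measure with a square integral for
  the other, so one \<open>h\<close> must serve both. It separates the union of the inner compact
  sets from the complement of the intersection of the outer open sets.\<close>

lemma continuous_approx_indicator:
  fixes A :: "'a::t2_space set"
  assumes "compact (UNIV :: 'a set)" and M: "regular_borel_measure M" "finite_measure M"
    and N: "regular_borel_measure N" "finite_measure N" and A: "A \<in> sets borel" and e: "e > 0"
  shows "\<exists>h :: 'a \<Rightarrow> real. continuous_on UNIV h \<and> (\<forall>x. 0 \<le> h x \<and> h x \<le> 1) \<and>
    (LINT x|M. \<bar>indicator A x - h x\<bar>) \<le> e \<and> (LINT x|N. \<bar>indicator A x - h x\<bar>) \<le> e"
proof -
  obtain C1 U1 where 1: "compact C1" "open U1" "C1 \<subseteq> A" "A \<subseteq> U1" "measure M U1 - measure M C1 < e"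
    using regular_borel_approx[OF M A e] .
  obtain C2 U2 where 2: "compact C2" "open U2" "C2 \<subseteq> A" "A \<subseteq> U2" "measure N U2 - measure N C2 < e"
    using regular_borel_approx[OF N A e] .
  have closed: "closed C1" "closed C2" using 1 2 by (auto intro: compact_imp_closed)
  obtain h :: "'a \<Rightarrow> real" where h: "continuous_on UNIV h" "\<And>x. 0 \<le> h x" "\<And>x. h x \<le> 1"
    "\<And>x. x \<in> C1 \<union> C2 \<Longrightarrow> h x = 1" "\<And>x. x \<notin> U1 \<inter> U2 \<Longrightarrow> h x = 0"
    by (rule Urysohn_compact_space[OF assms(1), of "C1 \<union> C2" "U1 \<inter> U2"]) (use 1 2 closed in auto)
  have bound: "(LINT x|L. \<bar>indicator A x - h x\<bar>) \<le> e"
    if L: "regular_borel_measure L" "finite_measure L" and CU: "closed C" "open U" "C \<subseteq> A" "A \<subseteq> U"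
      "measure L U - measure L C < e" and hC: "\<And>x. x \<in> C \<Longrightarrow> h x = 1" and hU: "\<And>x. x \<notin> U \<Longrightarrow> h x = 0" for L C U
  proof -
    interpret L: finite_measure L by fact
    have s: "sets L = sets borel" using L by (simp add: regular_borel_measure_def)
    have m: "C \<in> sets L" "U \<in> sets L" "A \<in> sets L" using CU A s by auto
    have [measurable]: "h \<in> borel_measurable L" by (rule continuous_measurable[OF s h(1)])
    note [measurable] = m
    have le: "\<bar>indicator A x - h x\<bar> \<le> indicator (U - C) x" for x
      using h(2)[of x] h(3)[of x] hC[of x] hU[of x] CU by (auto simp: indicator_def)
    have "(LINT x|L. \<bar>indicator A x - h x\<bar>) \<le> (LINT x|L. indicator (U - C) x)"
    proof (rule integral_mono)
      show i: "integrable L (indicator (U - C) :: 'a \<Rightarrow> real)"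
        by (rule integrable_real_indicator) (use m in \<open>auto simp: less_top[symmetric]\<close>)
      show "integrable L (\<lambda>x. \<bar>indicator A x - h x\<bar>)"
        by (rule Bochner_Integration.integrable_bound[OF i]) (use le in auto)
    qed (rule le)
    also have "\<dots> = measure L (U - C)" using m sets.sets_into_space[OF m(2)] by (simp add: Int_absorb2)
    also have "\<dots> = measure L U - measure L C"
      using CU m by (intro L.finite_measure_Diff) auto
    finally show ?thesis using CU by simp
  qed
  have "(LINT x|M. \<bar>indicator A x - h x\<bar>) \<le> e" by (rule bound[OF M closed(1) 1(2-5)]) (use h(4,5) in auto)
  moreover have "(LINT x|N. \<bar>indicator A x - h x\<bar>) \<le> e" by (rule bound[OF N closed(2) 2(2-5)]) (use h(4,5) in auto)
  ultimately show ?thesis using h(1-3) by blast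
qed

text \<open>Each indicator is replaced by a continuous function close to it for both measures. The
  error is at most \<open>e\<close> times the sum \<open>B\<close> of the coefficients, and
  \<open>e\<close> tends to 0.\<close>

lemma continuous_bound_simple:
  fixes a :: "'i \<Rightarrow> real" and A :: "'i \<Rightarrow> 'a::t2_space set"
  assumes compact: "compact (UNIV :: 'a set)" and m: "regular_borel_measure m" "finite_measure m"
    and \<mu>: "regular_borel_measure \<mu>" "finite_measure \<mu>" and C: "C \<ge> 0"
    and bound: "\<And>h :: 'a \<Rightarrow> real. continuous_on UNIV h \<Longrightarrow> (LINT x|\<mu>. h x) \<le> C * sqrt (LINT x|m. (h x)\<^sup>2)"
    and I: "finite I" "\<And>i. i \<in> I \<Longrightarrow> a i \<ge> 0" "\<And>i. i \<in> I \<Longrightarrow> A i \<in> sets borel"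
  defines "s \<equiv> \<lambda>x. \<Sum>i\<in>I. a i * indicator (A i) x"
  shows "(LINT x|\<mu>. s x) \<le> C * sqrt (LINT x|m. (s x)\<^sup>2)"
proof -
  interpret m: finite_measure m by fact
  interpret \<mu>: finite_measure \<mu> by fact
  have sm: "sets m = sets borel" and s\<mu>: "sets \<mu> = sets borel"
    using m \<mu> by (auto simp: regular_borel_measure_def)
  define B where "B = sum a I"
  have B: "B \<ge> 0" unfolding B_def by (rule sum_nonneg) (rule I)
  have bm: "s \<in> borel_measurable m" "s \<in> borel_measurable \<mu>"
    unfolding s_def
    by (intro borel_measurable_sum borel_measurable_times borel_measurable_const borel_measurable_indicator;
        simp add: sm s\<mu> I(3))+
  have sB: "0 \<le> s x" "s x \<le> B" for x
    unfolding s_def B_def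
    by (rule sum_nonneg, simp add: I(2), rule sum_mono, simp add: I(2) indicator_def)
  have int_s: "integrable \<mu> s" by (rule \<mu>.integrable_const_bound[of _ B]) (use sB bm in auto)
  have int_s2: "integrable m (\<lambda>x. (s x)\<^sup>2)"
    by (rule m.integrable_const_bound[of _ "B\<^sup>2"]) (use sB bm in \<open>auto intro!: power_mono\<close>)
  have ineq: "(LINT x|\<mu>. s x) \<le> C * sqrt ((LINT x|m. (s x)\<^sup>2) + 2 * B * (e * B)) + e * B" if e: "e > 0" for e
  proof -
    have "\<forall>i\<in>I. \<exists>h :: 'a \<Rightarrow> real. continuous_on UNIV h \<and> (\<forall>x. 0 \<le> h x \<and> h x \<le> 1) \<and>
      (LINT x|m. \<bar>indicator (A i) x - h x\<bar>) \<le> e \<and> (LINT x|\<mu>. \<bar>indicator (A i) x - h x\<bar>) \<le> e"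
      by (rule ballI) (rule continuous_approx_indicator[OF compact m \<mu> I(3) e])
    from bchoice[OF this] obtain h :: "'i \<Rightarrow> 'a \<Rightarrow> real" where h': "\<forall>i\<in>I. continuous_on UNIV (h i) \<and>
      (\<forall>x. 0 \<le> h i x \<and> h i x \<le> 1) \<and> (LINT x|m. \<bar>indicator (A i) x - h i x\<bar>) \<le> e \<and>
      (LINT x|\<mu>. \<bar>indicator (A i) x - h i x\<bar>) \<le> e" ..
    have h: "\<And>i. i \<in> I \<Longrightarrow> continuous_on UNIV (h i)" "\<And>i x. i \<in> I \<Longrightarrow> 0 \<le> h i x"
      "\<And>i x. i \<in> I \<Longrightarrow> h i x \<le> 1" "\<And>i. i \<in> I \<Longrightarrow> (LINT x|m. \<bar>indicator (A i) x - h i x\<bar>) \<le> e"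
      "\<And>i. i \<in> I \<Longrightarrow> (LINT x|\<mu>. \<bar>indicator (A i) x - h i x\<bar>) \<le> e"
      by (simp_all add: h'[rule_format])
    define g where "g x = (\<Sum>i\<in>I. a i * h i x)" for x
    have cg: "continuous_on UNIV g" unfolding g_def by (intro continuous_intros h(1))
    have gB: "0 \<le> g x" "g x \<le> B" for x
      unfolding g_def B_def
      by (rule sum_nonneg, simp add: I(2) h(2), rule sum_mono, simp add: I(2) h(3) mult_left_le)
    have diff: "(LINT x|L. \<bar>s x - g x\<bar>) \<le> e * B" "integrable L (\<lambda>x. \<bar>s x - g x\<bar>)"
      if L: "finite_measure L" "sets L = sets borel" "s \<in> borel_measurable L"
        "\<And>i. i \<in> I \<Longrightarrow> (LINT x|L. \<bar>indicator (A i) x - h i x\<bar>) \<le> e" for L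
    proof -
      interpret L: finite_measure L by fact
      have gm: "g \<in> borel_measurable L" by (rule continuous_measurable[OF L(2) cg])
      show i0: "integrable L (\<lambda>x. \<bar>s x - g x\<bar>)"
      proof (rule L.integrable_const_bound[of _ "2 * B"])
        show "AE x in L. norm \<bar>s x - g x\<bar> \<le> 2 * B"
        proof (rule AE_I2)
          fix x show "norm \<bar>s x - g x\<bar> \<le> 2 * B" using sB[of x] gB[of x] by simp
        qed
      qed (use L gm in auto)
      have ii: "integrable L (\<lambda>x. a i * \<bar>indicator (A i) x - h i x\<bar>)" if i: "i \<in> I" for i
      proof (rule integrable_mult_right, rule L.integrable_const_bound[of _ 1])
        show "AE x in L. norm \<bar>indicator (A i) x - h i x\<bar> \<le> 1"
        proof (rule AE_I2)
          fix x show "norm \<bar>indicator (A i) x - h i x\<bar> \<le> 1"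
            using h(2,3)[OF i, of x] by (auto simp: indicator_def)
        qed
        have "h i \<in> borel_measurable L" "A i \<in> sets L" using continuous_measurable[OF L(2) h(1)[OF i]] I(3)[OF i] L(2) by auto
        then show "(\<lambda>x. \<bar>indicator (A i) x - h i x\<bar>) \<in> borel_measurable L" by measurable
      qed
      have "(LINT x|L. \<bar>s x - g x\<bar>) \<le> (LINT x|L. (\<Sum>i\<in>I. a i * \<bar>indicator (A i) x - h i x\<bar>))"
      proof (rule integral_mono[OF i0])
        show "integrable L (\<lambda>x. \<Sum>i\<in>I. a i * \<bar>indicator (A i) x - h i x\<bar>)"
          by (rule Bochner_Integration.integrable_sum) (rule ii)
        fix x
        have "s x - g x = (\<Sum>i\<in>I. a i * (indicator (A i) x - h i x))"
          by (simp add: s_def g_def right_diff_distrib sum_subtractf)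
        then show "\<bar>s x - g x\<bar> \<le> (\<Sum>i\<in>I. a i * \<bar>indicator (A i) x - h i x\<bar>)"
          using sum_abs[of "\<lambda>i. a i * (indicator (A i) x - h i x)" I] I(2) by (simp add: abs_mult)
      qed
      also have "\<dots> = (\<Sum>i\<in>I. a i * (LINT x|L. \<bar>indicator (A i) x - h i x\<bar>))"
        by (subst Bochner_Integration.integral_sum[OF ii]) simp_all
      also have "\<dots> \<le> (\<Sum>i\<in>I. a i * e)"
        by (intro sum_mono mult_left_mono L(4) I(2))
      also have "\<dots> = e * B" by (simp add: B_def sum_distrib_left mult.commute)
      finally show "(LINT x|L. \<bar>s x - g x\<bar>) \<le> e * B" .
    qed
    note dm = diff[OF m(2) sm bm(1) h(4)] and d\<mu> = diff[OF \<mu>(2) s\<mu> bm(2) h(5)]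
    have ig: "integrable \<mu> g" by (rule integrable_continuous[OF compact \<mu>(2) s\<mu> cg])
    have ig2: "integrable m (\<lambda>x. (g x)\<^sup>2)"
      by (rule integrable_continuous[OF compact m(2) sm]) (intro continuous_intros cg)
    have "(LINT x|\<mu>. s x) \<le> (LINT x|\<mu>. g x + \<bar>s x - g x\<bar>)"
    proof (rule integral_mono[OF int_s Bochner_Integration.integrable_add[OF ig d\<mu>(2)]])
      fix x show "s x \<le> g x + \<bar>s x - g x\<bar>" using abs_ge_self[of "s x - g x"] by linarith
    qed
    also have "\<dots> \<le> C * sqrt (LINT x|m. (g x)\<^sup>2) + e * B"
      using d\<mu> ig bound[OF cg] by (simp add: Bochner_Integration.integral_add)
    \<comment> \<open>Both \<open>s\<close> and \<open>g\<close> take values between 0 and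
      \<open>B\<close>, so their squares differ by at most \<open>2 * B\<close> times their
      distance, and closeness in L1 is enough.\<close>
    also have "(LINT x|m. (g x)\<^sup>2) \<le> (LINT x|m. (s x)\<^sup>2) + 2 * B * (e * B)"
    proof -
      have "(LINT x|m. (g x)\<^sup>2) \<le> (LINT x|m. (s x)\<^sup>2 + 2 * B * \<bar>s x - g x\<bar>)"
      proof (rule integral_mono[OF ig2])
        show "integrable m (\<lambda>x. (s x)\<^sup>2 + 2 * B * \<bar>s x - g x\<bar>)" using int_s2 dm(2) by simp
        fix x
        have "(g x)\<^sup>2 - (s x)\<^sup>2 = (g x + s x) * (g x - s x)" by (simp add: power2_eq_square algebra_simps)
        also have "\<dots> \<le> (g x + s x) * \<bar>s x - g x\<bar>" using sB[of x] gB[of x] by (intro mult_left_mono) auto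
        also have "\<dots> \<le> (2 * B) * \<bar>s x - g x\<bar>" using sB[of x] gB[of x] by (intro mult_right_mono) auto
        finally show "(g x)\<^sup>2 \<le> (s x)\<^sup>2 + 2 * B * \<bar>s x - g x\<bar>" by simp
      qed
      also have "\<dots> = (LINT x|m. (s x)\<^sup>2) + 2 * B * (LINT x|m. \<bar>s x - g x\<bar>)"
        using int_s2 dm(2) by simp
      finally show ?thesis using mult_left_mono[OF dm(1), of "2 * B"] B by linarith
    qed
    finally show ?thesis using C by (simp add: mult_left_mono)
  qed
  have "((\<lambda>e. C * sqrt ((LINT x|m. (s x)\<^sup>2) + 2 * B * (e * B)) + e * B) \<longlongrightarrow>
      C * sqrt ((LINT x|m. (s x)\<^sup>2) + 2 * B * (0 * B)) + 0 * B) (at_right 0)"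
    by (intro tendsto_intros)
  then have "(LINT x|\<mu>. s x) \<le> C * sqrt ((LINT x|m. (s x)\<^sup>2) + 2 * B * (0 * B)) + 0 * B"
    by (rule tendsto_lowerbound) (use ineq in \<open>auto simp: eventually_at_right_less intro: eventually_at_rightI[of 0 1]\<close>)
  then show ?thesis by simp
qed

text \<open>The density is the Radon-Nikodym derivative \<open>f\<close>, approximated from below by
  simple functions \<open>u i\<close>. With \<open>K\<close> the integral of the square of
  \<open>u i\<close>, the inequality \<open>u i \<le> f\<close> bounds \<open>K\<close> by the
  \<mu>-integral of \<open>u i\<close>, hence by \<open>C * sqrt K\<close>. Monotone convergence
  carries the resulting bound to \<open>f\<close>.\<close>

lemma has_L2_densityI:
  fixes m \<mu> :: "'a::t2_space measure"
  assumes compact: "compact (UNIV :: 'a set)" and m: "regular_borel_measure m" "finite_measure m"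
    and \<mu>: "regular_borel_measure \<mu>" "finite_measure \<mu>" and C: "C \<ge> 0"
    and bound: "\<And>h :: 'a \<Rightarrow> real. continuous_on UNIV h \<Longrightarrow> (LINT x|\<mu>. h x) \<le> C * sqrt (LINT x|m. (h x)\<^sup>2)"
  shows "has_L2_density m \<mu>"
proof -
  interpret m: finite_measure m by fact
  interpret \<mu>: finite_measure \<mu> by fact
  have sm: "sets m = sets borel" and s\<mu>: "sets \<mu> = sets borel"
    using m \<mu> by (auto simp: regular_borel_measure_def)
  note simple = continuous_bound_simple[OF compact m \<mu> C bound]
  \<comment> \<open>The bound for the indicator of a null set reads
    \<open>measure \<mu> A \<le> 0\<close>.\<close>
  have ac: "absolutely_continuous m \<mu>"
    unfolding absolutely_continuous_def
  proof
    fix A assume A: "A \<in> null_sets m"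
    then have Ab: "A \<in> sets borel" using sm by auto
    have ind: "(indicator A x :: real)\<^sup>2 = indicator A x" for x by (simp add: indicator_def)
    have "measure m A = 0" using A by (simp add: measure_def null_setsD1)
    moreover have "A \<inter> space m = A" "A \<inter> space \<mu> = A"
      using sets.sets_into_space[of A m] sets.sets_into_space[of A \<mu>] Ab sm s\<mu> by auto
    ultimately have "measure \<mu> A \<le> 0"
      using simple[of "{()}" "\<lambda>_. 1" "\<lambda>_. A"] Ab ind by simp
    then have "measure \<mu> A = 0" using measure_nonneg[of \<mu> A] by linarith
    then show "A \<in> null_sets \<mu>"
      using Ab by (auto simp: null_sets_def s\<mu> \<mu>.emeasure_eq_measure)
  qed
  define f where "f = RN_deriv m \<mu>"
  have fm: "f \<in> borel_measurable m" unfolding f_def by simp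
  have dens: "density m f = \<mu>"
    unfolding f_def by (rule m.density_RN_deriv[OF ac]) (simp add: sm s\<mu>)
  obtain u where u: "\<And>i. simple_function m (u i)" "incseq u" "\<And>i x. u i x < \<infinity>" "\<And>x. (SUP i. u i x) = f x"
    using borel_measurable_implies_simple_function_sequence'[OF fm] unfolding infinity_ennreal_def by metis
  \<comment> \<open>A simple function with finite values is bounded, so \<open>K\<close> is a real
    number and \<open>sqrt K\<close> may be cancelled from
    \<open>K \<le> C * sqrt K\<close>.\<close>
  have step: "(\<integral>\<^sup>+ x. u i x * u i x \<partial>m) \<le> ennreal (C\<^sup>2)" for i
  proof -
    define s where "s x = enn2real (u i x)" for x
    have us: "u i x = ennreal (s x)" for x using u(3)[of i x] by (simp add: s_def)
    have spm: "space m = UNIV" using sets_eq_imp_space_eq[OF sm] by simp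
    have fin: "finite (range s)"
    proof -
      have "finite (u i ` UNIV)" using u(1)[of i] by (simp add: simple_function_def spm)
      then have "finite (enn2real ` u i ` UNIV)" by (rule finite_imageI)
      then show ?thesis by (simp add: s_def image_image)
    qed
    have sbm: "s \<in> borel_measurable m" unfolding s_def using borel_measurable_simple_function[OF u(1)[of i]] by simp
    have sb\<mu>: "s \<in> borel_measurable \<mu>" using sbm sm s\<mu> by (simp add: measurable_def sets_eq_imp_space_eq[OF sm] sets_eq_imp_space_eq[OF s\<mu>])
    have repr: "s x = (\<Sum>y\<in>range s. y * indicator (s -` {y}) x)" for x
    proof -
      have "(\<Sum>y\<in>range s. y * indicator (s -` {y}) x) = (\<Sum>y\<in>range s. if y = s x then y else 0)"
        by (intro sum.cong) (auto simp: indicator_def)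
      then show ?thesis using fin by simp
    qed
    have vim: "s -` {y} \<in> sets borel" for y
      using measurable_sets[OF sbm, of "{y}"] by (simp add: spm sm)
    have s0: "s x \<ge> 0" for x by (simp add: s_def)
    define B where "B = Max (range s)"
    have sB: "s x \<le> B" for x unfolding B_def using fin by (intro Max_ge) auto
    have int1: "integrable \<mu> s" by (rule \<mu>.integrable_const_bound[of _ B]) (use s0 sB sb\<mu> in auto)
    have int2: "integrable m (\<lambda>x. (s x)\<^sup>2)"
      by (rule m.integrable_const_bound[of _ "B\<^sup>2"]) (use s0 sB sbm in \<open>auto intro!: power_mono\<close>)
    define K where "K = (LINT x|m. (s x)\<^sup>2)"
    have K0: "K \<ge> 0" unfolding K_def by (intro Bochner_Integration.integral_nonneg) simp
    have "(LINT x|\<mu>. s x) \<le> C * sqrt K"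
      using simple[of "range s" "\<lambda>y. y" "\<lambda>y. s -` {y}"] fin s0 vim
      unfolding K_def repr[symmetric] by auto
    have "ennreal K = (\<integral>\<^sup>+ x. u i x * u i x \<partial>m)"
      unfolding K_def by (subst nn_integral_eq_integral[OF int2, symmetric])
        (auto simp: us power2_eq_square ennreal_mult s0)
    also have "\<dots> \<le> (\<integral>\<^sup>+ x. f x * u i x \<partial>m)"
    proof (rule nn_integral_mono)
      fix x show "u i x * u i x \<le> f x * u i x"
        unfolding u(4)[symmetric] by (intro mult_right_mono SUP_upper) auto
    qed
    also have "\<dots> = (\<integral>\<^sup>+ x. u i x \<partial>\<mu>)"
      unfolding dens[symmetric] by (rule nn_integral_density[symmetric, OF fm]) (rule borel_measurable_simple_function[OF u(1)])
    also have "\<dots> = ennreal (LINT x|\<mu>. s x)"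
      unfolding us by (rule nn_integral_eq_integral[OF int1]) (simp add: s0)
    also have "\<dots> \<le> ennreal (C * sqrt K)" by (rule ennreal_leI) fact
    finally have "ennreal K \<le> ennreal (C * sqrt K)" .
    then have KC: "K \<le> C * sqrt K" using C K0 by simp
    have "K \<le> C\<^sup>2"
    proof (cases "K = 0")
      case False
      then have pos: "sqrt K > 0" using K0 by simp
      have "sqrt K * sqrt K \<le> C * sqrt K" using KC K0 by simp
      then have "sqrt K \<le> C" using pos by (rule mult_right_le_imp_le)
      then have "(sqrt K)\<^sup>2 \<le> C\<^sup>2" using K0 by (intro power_mono) auto
      then show ?thesis using K0 by simp
    qed simp
    then show ?thesis using \<open>ennreal K = _\<close> by (metis ennreal_leI)
  qed
  have sup: "(SUP i. u i x * u i x) = (f x)\<^sup>2" for x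
  proof (rule LIMSEQ_unique)
    have inc: "incseq (\<lambda>i. u i x)" using u(2) by (auto simp: incseq_def le_fun_def)
    have "(\<lambda>i. u i x) \<longlonglongrightarrow> f x" using LIMSEQ_SUP[OF inc] by (simp add: u(4))
    then show "(\<lambda>i. u i x * u i x) \<longlonglongrightarrow> (f x)\<^sup>2"
      unfolding power2_eq_square by (intro tendsto_mult_ennreal) auto
    have "incseq (\<lambda>i. u i x * u i x)" using inc by (auto simp: incseq_def intro!: mult_mono)
    then show "(\<lambda>i. u i x * u i x) \<longlonglongrightarrow> (SUP i. u i x * u i x)" by (rule LIMSEQ_SUP)
  qed
  have "(\<integral>\<^sup>+ x. (f x)\<^sup>2 \<partial>m) = (SUP i. \<integral>\<^sup>+ x. u i x * u i x \<partial>m)"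
    unfolding sup[symmetric]
    by (rule nn_integral_monotone_convergence_SUP)
       (use u(2) borel_measurable_simple_function[OF u(1)] in \<open>auto simp: incseq_def le_fun_def intro!: mult_mono\<close>)
  also have "\<dots> \<le> ennreal (C\<^sup>2)" by (rule SUP_least) (rule step)
  also have "\<dots> < \<infinity>" by simp
  finally show ?thesis unfolding has_L2_density_def f_def using ac by simp
qed

section \<open>The criterion over the whole dual\<close>

context compact_group_dual
begin

lemma L2_density_Fourier_bound:
  assumes \<mu>: "finite_measure \<mu>" "sets \<mu> = sets borel" and L2: "has_L2_density m \<mu>"
  obtains S where "\<And>F. finite F \<Longrightarrow> F \<subseteq> D \<Longrightarrow> (\<Sum>\<pi>\<in>F. real (rep_dim \<pi>) *
      (\<Sum>i<rep_dim \<pi>. \<Sum>j<rep_dim \<pi>. (cmod (LINT x|\<mu>. \<pi> x $$ (i, j)))\<^sup>2)) \<le> S"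
proof -
  define f where "f = RN_deriv m \<mu>"
  have fm: "f \<in> borel_measurable m" unfolding f_def by simp
  have ac: "absolutely_continuous m \<mu>" and fin: "(\<integral>\<^sup>+ x. (f x)\<^sup>2 \<partial>m) < \<infinity>"
    using L2 by (auto simp: has_L2_density_def f_def)
  have dens: "density m f = \<mu>"
    unfolding f_def by (rule density_RN_deriv[OF ac]) (simp add: sets_m \<mu>)
  define r where "r x = enn2real (f x)" for x
  have rm: "r \<in> borel_measurable m" unfolding r_def using fm by simp
  have r0: "r x \<ge> 0" for x by (simp add: r_def)
  have "AE x in m. (f x)\<^sup>2 \<noteq> \<infinity>"
    using fm fin by (intro nn_integral_PInf_AE) auto
  \<comment> \<open>Finiteness of the square integral forces \<open>f\<close> to be finite almost
    everywhere, so the extended-valued density can be replaced by the real function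
    \<open>r\<close>.\<close>
  then have fr: "AE x in m. f x = ennreal (r x)"
    by eventually_elim (auto simp: r_def power2_eq_square ennreal_mult_eq_top_iff less_top)
  have "\<mu> = density m (\<lambda>x. ennreal (r x))"
    unfolding dens[symmetric] by (rule density_cong) (use fr fm rm in auto)
  then have int: "(LINT x|\<mu>. g x) = (LINT x|m. of_real (r x) * g x)" if "continuous_on UNIV g" for g :: "'g \<Rightarrow> complex"
    using integral_density[OF continuous_measurable[OF sets_m that] rm] r0 by (simp add: scaleR_conv_of_real)
  define R where "R x = complex_of_real (r x)" for x
  have sR: "sqint R"
    unfolding sqint_def
  proof
    show "R \<in> borel_measurable m" unfolding R_def using rm by simp
    show "integrable m (\<lambda>x. (cmod (R x))\<^sup>2)"
    proof (rule integrableI_nonneg)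
      have "(\<integral>\<^sup>+ x. ennreal ((cmod (R x))\<^sup>2) \<partial>m) = (\<integral>\<^sup>+ x. (f x)\<^sup>2 \<partial>m)"
        by (rule nn_integral_cong_AE) (use fr in eventually_elim, simp add: R_def ennreal_power r0)
      then show "(\<integral>\<^sup>+ x. ennreal ((cmod (R x))\<^sup>2) \<partial>m) < \<infinity>" using fin by simp
    qed (use rm in \<open>auto simp: R_def\<close>)
  qed
  have "cmod (LINT x|\<mu>. \<pi> x $$ (i, j)) = cmod (ip R (\<lambda>x. \<pi> x $$ (i, j)))"
    if "\<pi> \<in> D" "i < rep_dim \<pi>" "j < rep_dim \<pi>" for \<pi> i j
  proof -
    have "ip R (\<lambda>x. \<pi> x $$ (i, j)) = (LINT x|m. cnj (of_real (r x) * \<pi> x $$ (i, j)))"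
      by (simp add: ip_def R_def)
    also have "\<dots> = cnj (LINT x|\<mu>. \<pi> x $$ (i, j))"
      unfolding int[OF dual_cont[OF that]] by (rule Bochner_Integration.integral_cnj)
    finally show ?thesis by simp
  qed
  then have eq: "(\<Sum>\<pi>\<in>F. real (rep_dim \<pi>) * (\<Sum>i<rep_dim \<pi>. \<Sum>j<rep_dim \<pi>. (cmod (LINT x|\<mu>. \<pi> x $$ (i, j)))\<^sup>2)) =
      (\<Sum>\<pi>\<in>F. real (rep_dim \<pi>) * (\<Sum>i<rep_dim \<pi>. \<Sum>j<rep_dim \<pi>. (cmod (ip R (\<lambda>x. \<pi> x $$ (i, j))))\<^sup>2))"
    if "F \<subseteq> D" for F
    using that by (intro sum.cong refl arg_cong2[where f = "(*)"]) auto
  show ?thesis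
    by (rule that[of "nsq R"]) (use eq Bessel_dual[OF _ _ sR] in simp)
qed

text \<open>In \<open>ennreal\<close> the sum is the supremum of the finite partial sums, so being
  below \<infinity> is a uniform bound on them. A real-valued \<open>infsum\<close> would be 0 for a
  divergent series.\<close>

lemma has_L2_density_iff:
  assumes \<mu>: "finite_measure \<mu>" "regular_borel_measure \<mu>"
  shows "has_L2_density m \<mu> \<longleftrightarrow> (\<Sum>\<^sub>\<infinity>\<pi>\<in>D. ennreal (real (rep_dim \<pi>) *
      (\<Sum>i<rep_dim \<pi>. \<Sum>j<rep_dim \<pi>. (cmod (LINT x|\<mu>. \<pi> x $$ (i, j)))\<^sup>2))) < \<infinity>"
    (is "_ \<longleftrightarrow> (\<Sum>\<^sub>\<infinity>\<pi>\<in>D. ennreal (?t \<pi>)) < \<infinity>")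
proof
  have s: "sets \<mu> = sets borel" using \<mu> by (simp add: regular_borel_measure_def)
  have t0: "?t \<pi> \<ge> 0" for \<pi> by (intro mult_nonneg_nonneg sum_nonneg) auto
  have inf: "(\<Sum>\<^sub>\<infinity>\<pi>\<in>D. ennreal (?t \<pi>)) = (SUP F\<in>{F. finite F \<and> F \<subseteq> D}. ennreal (sum ?t F))"
    by (subst nonneg_infsum_complete) (simp_all add: sum_ennreal t0)
  {
    assume L2: "has_L2_density m \<mu>"
    obtain S where S: "\<And>F. finite F \<Longrightarrow> F \<subseteq> D \<Longrightarrow> sum ?t F \<le> S"
      using L2_density_Fourier_bound[OF \<mu>(1) s L2] by blast
    have "(\<Sum>\<^sub>\<infinity>\<pi>\<in>D. ennreal (?t \<pi>)) \<le> ennreal S"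
      unfolding inf by (rule SUP_least) (auto intro!: ennreal_leI S)
    then show "(\<Sum>\<^sub>\<infinity>\<pi>\<in>D. ennreal (?t \<pi>)) < \<infinity>" by (simp add: le_less_trans)
  }
  assume fin: "(\<Sum>\<^sub>\<infinity>\<pi>\<in>D. ennreal (?t \<pi>)) < \<infinity>"
  define S where "S = enn2real (\<Sum>\<^sub>\<infinity>\<pi>\<in>D. ennreal (?t \<pi>))"
  have eS: "(\<Sum>\<^sub>\<infinity>\<pi>\<in>D. ennreal (?t \<pi>)) = ennreal S" using fin by (simp add: S_def)
  have S0: "S \<ge> 0" by (simp add: S_def)
  have S: "sum ?t F \<le> S" if "finite F" "F \<subseteq> D" for F
  proof -
    have "ennreal (sum ?t F) \<le> ennreal S"
      unfolding eS[symmetric] inf using that by (intro SUP_upper) auto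
    then show ?thesis using S0 by simp
  qed
  show "has_L2_density m \<mu>"
  proof (rule has_L2_densityI[OF compact_UNIV _ finite_m \<mu>(2,1), of "sqrt S"])
    show "regular_borel_measure m" using haar by (simp add: normalised_haar_measure_def)
    show "sqrt S \<ge> 0" using S0 by simp
    fix h :: "'g \<Rightarrow> real" assume h: "continuous_on UNIV h"
    have ch: "continuous_on UNIV (\<lambda>x. complex_of_real (h x))" by (intro continuous_intros h)
    have "\<bar>LINT x|\<mu>. h x\<bar> = cmod (LINT x|\<mu>. complex_of_real (h x))"
      by (simp add: integral_complex_of_real)
    also have "\<dots> \<le> sqrt S * sqrt (nsq (\<lambda>x. complex_of_real (h x)))"
      by (rule Fourier_Stieltjes_bound[OF \<mu>(1) s S ch])
    also have "nsq (\<lambda>x. complex_of_real (h x)) = (LINT x|m. (h x)\<^sup>2)" by (simp add: nsq_def)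
    finally show "(LINT x|\<mu>. h x) \<le> sqrt S * sqrt (LINT x|m. (h x)\<^sup>2)" by linarith
  qed
qed

end

section \<open>Spherical representations\<close>

lemma cscalar_prod_sum:
  fixes v w :: "complex vec"
  assumes "v \<in> carrier_vec n" "w \<in> carrier_vec n"
  shows "v \<bullet>c w = (\<Sum>i<n. vec_index v i * cnj (vec_index w i))"
  using assms by (auto simp: scalar_prod_def lessThan_atLeast0)

lemma index_mult_mat_vec_sum:
  assumes "A \<in> carrier_mat n k" "v \<in> carrier_vec k" "i < n"
  shows "vec_index (A *\<^sub>v v) i = (\<Sum>j<k. A $$ (i, j) * vec_index v j)"
  using assms by (auto simp: scalar_prod_def lessThan_atLeast0)

lemma cscalar_prod_commute:
  fixes v w :: "complex vec"
  assumes "v \<in> carrier_vec n" "w \<in> carrier_vec n"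
  shows "v \<bullet>c w = cnj (w \<bullet>c v)"
  using assms by (simp add: cscalar_prod_sum[of _ n] mult.commute)

lemma cscalar_prod_adjoint:
  fixes A :: "complex mat"
  assumes A: "A \<in> carrier_mat n n" and v: "v \<in> carrier_vec n" and w: "w \<in> carrier_vec n"
  shows "(A *\<^sub>v v) \<bullet>c w = v \<bullet>c (mat_adjoint A *\<^sub>v w)"
proof -
  note A' = mat_adjoint_carrier[OF A]
  have "(A *\<^sub>v v) \<bullet>c w = (\<Sum>i<n. \<Sum>j<n. A $$ (i, j) * vec_index v j * cnj (vec_index w i))"
    unfolding cscalar_prod_sum[OF mult_mat_vec_carrier[OF A v] w]
    by (intro sum.cong refl) (simp add: index_mult_mat_vec_sum[OF A v] sum_distrib_right del: index_mult_mat_vec)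
  also have "\<dots> = (\<Sum>j<n. \<Sum>i<n. A $$ (i, j) * vec_index v j * cnj (vec_index w i))" by (rule sum.swap)
  also have "\<dots> = v \<bullet>c (mat_adjoint A *\<^sub>v w)"
    unfolding cscalar_prod_sum[OF v mult_mat_vec_carrier[OF A' w]]
    by (intro sum.cong refl) (simp add: index_mult_mat_vec_sum[OF A' w] index_mat_adjoint[OF A]
      sum_distrib_left mult_ac del: index_mult_mat_vec)
  finally show ?thesis .
qed

text \<open>Orthonormal columns of a square matrix force orthonormal rows, and it is the row
  relations that the isometry lemma requires.\<close>

lemma Parseval_orthonormal_basis:
  assumes b: "orthonormal_basis d b" and v: "v \<in> carrier_vec d"
  shows "(\<Sum>j=1..d. (cmod (v \<bullet>c b j))\<^sup>2) = (\<Sum>i<d. (cmod (vec_index v i))\<^sup>2)"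
proof -
  have bc: "b (Suc j) \<in> carrier_vec d" if "j < d" for j
    using b that by (simp add: orthonormal_basis_def)
  have bo: "b (Suc i) \<bullet>c b (Suc j) = (if i = j then 1 else 0)" if "i < d" "j < d" for i j
    using b that by (simp add: orthonormal_basis_def)
  \<comment> \<open>The basis is numbered from 1 and matrix columns from 0, hence the
    \<open>Suc\<close>.\<close>
  define E where "E = mat d d (\<lambda>(i, j). vec_index (b (Suc j)) i)"
  have E: "E \<in> carrier_mat d d" by (simp add: E_def)
  have E_entry: "E $$ (i, j) = vec_index (b (Suc j)) i" if "i < d" "j < d" for i j
    using that by (simp add: E_def)
  note E' = mat_adjoint_carrier[OF E]
  have "mat_adjoint E * E = 1\<^sub>m d"
  proof (rule eq_matI)
    fix i j assume "i < dim_row (1\<^sub>m d)" "j < dim_col (1\<^sub>m d)"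
    then have ij: "i < d" "j < d" by auto
    have "(mat_adjoint E * E) $$ (i, j) = b (Suc j) \<bullet>c b (Suc i)"
      unfolding index_mult_mat_sum[OF E' E ij] cscalar_prod_sum[OF bc[OF ij(2)] bc[OF ij(1)]]
      using ij by (intro sum.cong) (auto simp: index_mat_adjoint[OF E] E_entry)
    then show "(mat_adjoint E * E) $$ (i, j) = 1\<^sub>m d $$ (i, j)" using ij by (simp add: bo)
  qed (use E E' in auto)
  then have EE: "E * mat_adjoint E = 1\<^sub>m d" by (rule mat_mult_left_right_inverse[OF E' E])
  have "(\<Sum>l<d. cnj (E $$ (k, l)) * cnj (cnj (E $$ (k', l)))) = (if k = k' then 1 else 0)" if "k < d" "k' < d" for k k'
  proof -
    have "(\<Sum>l<d. cnj (E $$ (k, l)) * cnj (cnj (E $$ (k', l)))) = (E * mat_adjoint E) $$ (k', k)"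
      unfolding index_mult_mat_sum[OF E E' that(2,1)]
      using that by (intro sum.cong) (auto simp: index_mat_adjoint[OF E])
    then show ?thesis using that by (auto simp: EE)
  qed
  from sum_cmod_square_isometry[of d "\<lambda>k l. cnj (E $$ (k, l))", OF this]
  have "(\<Sum>l<d. (cmod (\<Sum>k<d. vec_index v k * cnj (E $$ (k, l))))\<^sup>2) = (\<Sum>k<d. (cmod (vec_index v k))\<^sup>2)" .
  moreover have "(\<Sum>k<d. vec_index v k * cnj (E $$ (k, l))) = v \<bullet>c b (Suc l)" if "l < d" for l
    unfolding cscalar_prod_sum[OF v bc[OF that]] using that by (intro sum.cong) (auto simp: E_entry)
  ultimately show ?thesis by (simp add: sum.atLeast1_atMost_eq)
qed

lemma hs_norm_square:
  assumes A: "A \<in> carrier_mat d d"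
  shows "(hs_norm A)\<^sup>2 = (\<Sum>i<d. \<Sum>j<d. (cmod (A $$ (i, j)))\<^sup>2)"
proof -
  note A' = mat_adjoint_carrier[OF A]
  have "mat_trace (mat_adjoint A * A) = (\<Sum>j<d. (mat_adjoint A * A) $$ (j, j))"
    using A A' by (simp add: mat_trace_def)
  also have "\<dots> = (\<Sum>j<d. \<Sum>i<d. of_real ((cmod (A $$ (i, j)))\<^sup>2))"
  proof (rule sum.cong)
    fix j assume "j \<in> {..<d}"
    then have j: "j < d" by simp
    show "(mat_adjoint A * A) $$ (j, j) = (\<Sum>i<d. of_real ((cmod (A $$ (i, j)))\<^sup>2))"
      unfolding index_mult_mat_sum[OF A' A j j] complex_norm_square
      using j by (intro sum.cong) (auto simp: index_mat_adjoint[OF A] mult.commute)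
  qed simp
  also have "\<dots> = of_real (\<Sum>i<d. \<Sum>j<d. (cmod (A $$ (i, j)))\<^sup>2)"
    unfolding of_real_sum by (rule sum.swap)
  finally have "Re (mat_trace (mat_adjoint A * A)) = (\<Sum>i<d. \<Sum>j<d. (cmod (A $$ (i, j)))\<^sup>2)" by simp
  then show ?thesis by (simp add: hs_norm_def sum_nonneg)
qed

text \<open>Parseval is used twice, for the images of the basis vectors and then for the rows of
  \<open>A\<close>.\<close>

lemma hs_norm_square_matrix_entry:
  assumes A: "A \<in> carrier_mat d d" and b: "orthonormal_basis d b"
  shows "(hs_norm A)\<^sup>2 = (\<Sum>i=1..d. \<Sum>j=1..d. (cmod (matrix_entry b A i j))\<^sup>2)"
proof -
  have bc: "b i \<in> carrier_vec d" if "i \<in> {1..d}" for i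
    using b that by (simp add: orthonormal_basis_def)
  have "(\<Sum>i=1..d. \<Sum>j=1..d. (cmod (matrix_entry b A i j))\<^sup>2) = (\<Sum>i=1..d. \<Sum>k<d. (cmod (vec_index (A *\<^sub>v b i) k))\<^sup>2)"
    unfolding matrix_entry_def using A bc
    by (intro sum.cong refl Parseval_orthonormal_basis[OF b]) (auto intro: mult_mat_vec_carrier)
  also have "\<dots> = (\<Sum>k<d. \<Sum>i=1..d. (cmod (vec_index (A *\<^sub>v b i) k))\<^sup>2)" by (rule sum.swap)
  also have "\<dots> = (\<Sum>k<d. \<Sum>l<d. (cmod (A $$ (k, l)))\<^sup>2)"
  proof (rule sum.cong)
    fix k assume "k \<in> {..<d}"
    then have k: "k < d" by simp
    \<comment> \<open>Conjugating the row turns the bilinear product of row and vector into an inner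
      product with the basis vector, up to conjugation.\<close>
    let ?w = "vec d (\<lambda>l. cnj (A $$ (k, l)))"
    have "cmod (vec_index (A *\<^sub>v b i) k) = cmod (?w \<bullet>c b i)" if "i \<in> {1..d}" for i
    proof -
      have "vec_index (A *\<^sub>v b i) k = cnj (?w \<bullet>c b i)"
        unfolding index_mult_mat_vec_sum[OF A bc[OF that] k] cscalar_prod_sum[OF vec_carrier bc[OF that]] by simp
      then show ?thesis by simp
    qed
    then have "(\<Sum>i=1..d. (cmod (vec_index (A *\<^sub>v b i) k))\<^sup>2) = (\<Sum>i=1..d. (cmod (?w \<bullet>c b i))\<^sup>2)" by simp
    also have "\<dots> = (\<Sum>l<d. (cmod (vec_index ?w l))\<^sup>2)" by (rule Parseval_orthonormal_basis[OF b]) simp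
    finally show "(\<Sum>i=1..d. (cmod (vec_index (A *\<^sub>v b i) k))\<^sup>2) = (\<Sum>l<d. (cmod (A $$ (k, l)))\<^sup>2)" by simp
  qed simp
  finally show ?thesis using hs_norm_square[OF A] by simp
qed

section \<open>Matrix coefficients and uniqueness of the spherical vector\<close>

context compact_group
begin

lemma cont_coefficient:
  assumes rep: "unitary_rep \<pi>" and a: "a \<in> carrier_vec (rep_dim \<pi>)" and b: "b \<in> carrier_vec (rep_dim \<pi>)"
  shows "continuous_on UNIV (\<lambda>x. (\<pi> x *\<^sub>v a) \<bullet>c b)"
proof -
  have "(\<pi> x *\<^sub>v a) \<bullet>c b = (\<Sum>i<rep_dim \<pi>. (\<Sum>j<rep_dim \<pi>. \<pi> x $$ (i, j) * vec_index a j) * cnj (vec_index b i))" for x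
    unfolding cscalar_prod_sum[OF mult_mat_vec_carrier[OF rep_carrier[OF rep] a] b]
    by (intro sum.cong) (auto simp: index_mult_mat_vec_sum[OF rep_carrier[OF rep] a])
  then show ?thesis by (auto intro!: continuous_intros rep_cont[OF rep])
qed

text \<open>Schur orthogonality freed from the standard basis, by expanding both coefficients. The
  factor of \<open>b\<close> and \<open>b'\<close> is conjugated because these vectors occupy the
  conjugate-linear slot.\<close>

lemma ip_coefficients:
  assumes irr: "irreducible_unitary_rep \<pi>"
    and a: "a \<in> carrier_vec (rep_dim \<pi>)" and b: "b \<in> carrier_vec (rep_dim \<pi>)"
    and a': "a' \<in> carrier_vec (rep_dim \<pi>)" and b': "b' \<in> carrier_vec (rep_dim \<pi>)"
  shows "ip (\<lambda>x. (\<pi> x *\<^sub>v a) \<bullet>c b) (\<lambda>x. (\<pi> x *\<^sub>v a') \<bullet>c b') = (a \<bullet>c a') * cnj (b \<bullet>c b') / of_nat (rep_dim \<pi>)"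
proof -
  note rep = irr_rep[OF irr]
  let ?d = "rep_dim \<pi>"
  let ?J = "{..<?d} \<times> {..<?d}"
  define E where "E p x = \<pi> x $$ p" for p :: "nat \<times> nat" and x
  have sE: "sqint (E p)" if "p \<in> ?J" for p
    using that unfolding E_def by (auto intro!: cont_sqint rep_cont[OF rep])
  have expand: "(\<pi> x *\<^sub>v v) \<bullet>c w = (\<Sum>p\<in>?J. (vec_index v (snd p) * cnj (vec_index w (fst p))) * E p x)"
    if v: "v \<in> carrier_vec ?d" and w: "w \<in> carrier_vec ?d" for v w x
    unfolding cscalar_prod_sum[OF mult_mat_vec_carrier[OF rep_carrier[OF rep] v] w] sum.cartesian_product' E_def
    by (intro sum.cong) (auto simp: index_mult_mat_vec_sum[OF rep_carrier[OF rep] v] sum_distrib_left sum_distrib_right mult_ac)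
  have orth: "ip (E p) (E q) = (if p = q then 1 / of_nat ?d else 0)" if "p \<in> ?J" "q \<in> ?J" for p q
    using that Schur_orthogonality[OF irr] unfolding E_def by (auto simp: prod_eq_iff)
  let ?c = "\<lambda>p. vec_index a (snd p) * cnj (vec_index b (fst p))"
  let ?c' = "\<lambda>p. vec_index a' (snd p) * cnj (vec_index b' (fst p))"
  have "ip (\<lambda>x. (\<pi> x *\<^sub>v a) \<bullet>c b) (\<lambda>x. (\<pi> x *\<^sub>v a') \<bullet>c b') = (\<Sum>p\<in>?J. ?c p * ip (E p) (\<lambda>x. \<Sum>q\<in>?J. ?c' q * E q x))"
    unfolding expand[OF a b] expand[OF a' b']
    by (subst ip_sum_left) (simp_all add: sqint_scale sqint_sum sE ip_scale_left del: SigmaI)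
  also have "\<dots> = (\<Sum>p\<in>?J. ?c p * (\<Sum>q\<in>?J. cnj (?c' q) * ip (E p) (E q)))"
  proof (rule sum.cong)
    fix p assume p: "p \<in> ?J"
    have "ip (E p) (\<lambda>x. \<Sum>q\<in>?J. ?c' q * E q x) = (\<Sum>q\<in>?J. cnj (?c' q) * ip (E p) (E q))"
      by (subst ip_sum_right) (simp_all only: sqint_scale sE[OF p] sE ip_scale_right)
    then show "?c p * ip (E p) (\<lambda>x. \<Sum>q\<in>?J. ?c' q * E q x) = ?c p * (\<Sum>q\<in>?J. cnj (?c' q) * ip (E p) (E q))" by simp
  qed simp
  also have "\<dots> = (\<Sum>p\<in>?J. ?c p * cnj (?c' p) / of_nat ?d)"
  proof (rule sum.cong)
    fix p assume p: "p \<in> ?J"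
    have "(\<Sum>q\<in>?J. cnj (?c' q) * ip (E p) (E q)) = (\<Sum>q\<in>?J. if q = p then cnj (?c' p) / of_nat ?d else 0)"
      using p by (intro sum.cong) (auto simp: orth simp del: complex_cnj_mult)
    also have "\<dots> = cnj (?c' p) / of_nat ?d" using p by simp
    finally show "?c p * (\<Sum>q\<in>?J. cnj (?c' q) * ip (E p) (E q)) = ?c p * cnj (?c' p) / of_nat ?d" by simp
  qed simp
  also have "\<dots> = (\<Sum>i<?d. \<Sum>j<?d. (vec_index a j * cnj (vec_index a' j)) * cnj (vec_index b i * cnj (vec_index b' i))) / of_nat ?d"
    unfolding sum.cartesian_product' by (simp add: sum_divide_distrib mult_ac)
  also have "\<dots> = (a \<bullet>c a') * cnj (b \<bullet>c b') / of_nat ?d"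
    unfolding cscalar_prod_sum[OF a a'] cscalar_prod_sum[OF b b'] cnj_sum
    by (subst sum.swap) (simp only: sum_product)
  finally show ?thesis .
qed

text \<open>For orthogonal \<open>K\<close>-fixed vectors \<open>u\<close>, \<open>v\<close> the coefficients \<open>f = \<langle>\<pi> u, u\<rangle>\<close> and \<open>g = \<langle>\<pi> u, v\<rangle>\<close> are
  bi-invariant with \<open>f * g = 0\<close>, whereas \<open>g * f\<close> is a multiple of \<open>g\<close>.\<close>

lemma spherical_vector_unique:
  assumes gelfand: "compact_gelfand_pair m K" and irr: "irreducible_unitary_rep \<pi>"
    and u: "u \<in> carrier_vec (rep_dim \<pi>)" "u \<noteq> 0\<^sub>v (rep_dim \<pi>)" "\<And>k. k \<in> K \<Longrightarrow> \<pi> k *\<^sub>v u = u"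
    and v: "v \<in> carrier_vec (rep_dim \<pi>)" "\<And>k. k \<in> K \<Longrightarrow> \<pi> k *\<^sub>v v = v"
    and orth: "u \<bullet>c v = 0"
  shows "v = 0\<^sub>v (rep_dim \<pi>)"
proof -
  note rep = irr_rep[OF irr]
  note car = rep_carrier[OF rep]
  let ?d = "rep_dim \<pi>"
  have K: "- k \<in> K" if "k \<in> K" for k
    using gelfand that by (auto simp: compact_gelfand_pair_def closed_subgroup_def)
  define c where "c a b x = (\<pi> x *\<^sub>v a) \<bullet>c b" for a b x
  have cc: "continuous_on UNIV (c a b)" if "a \<in> carrier_vec ?d" "b \<in> carrier_vec ?d" for a b
    unfolding c_def by (rule cont_coefficient[OF rep that])
  have bi: "c u b \<in> bi_invariant_L1 m K" if b: "b \<in> carrier_vec ?d" "\<And>k. k \<in> K \<Longrightarrow> \<pi> k *\<^sub>v b = b" for b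
  proof -
    have "c u b (k + x + k') = c u b x" if k: "k \<in> K" "k' \<in> K" for k k' x
    proof -
      have "\<pi> (k + x + k') *\<^sub>v u = (\<pi> k * \<pi> x) *\<^sub>v (\<pi> k' *\<^sub>v u)"
        unfolding rep_add[OF rep] by (rule assoc_mult_mat_vec[OF mult_carrier_mat[OF car car] car u(1)])
      also have "\<dots> = \<pi> k *\<^sub>v (\<pi> x *\<^sub>v u)"
        unfolding u(3)[OF k(2)] by (rule assoc_mult_mat_vec[OF car car u(1)])
      finally have "c u b (k + x + k') = (\<pi> x *\<^sub>v u) \<bullet>c (\<pi> (- k) *\<^sub>v b)"
        unfolding c_def rep_minus[OF rep]
        by (simp add: cscalar_prod_adjoint[OF car mult_mat_vec_carrier[OF car u(1)] b(1)])
      then show ?thesis unfolding b(2)[OF K[OF k(1)]] c_def .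
    qed
    then show ?thesis using integrable_cont[OF cc[OF u(1) b(1)]] by (auto simp: bi_invariant_L1_def)
  qed
  \<comment> \<open>The reflected and translated factor is again a coefficient, namely
    \<open>c b' (\<pi> x *\<^sub>v u)\<close>, so the convolution is an inner product of two
    coefficients.\<close>
  have conv_c: "conv (c u b) (c u b') x = (u \<bullet>c b') * cnj (b \<bullet>c (\<pi> x *\<^sub>v u)) / of_nat ?d"
    if b: "b \<in> carrier_vec ?d" and b': "b' \<in> carrier_vec ?d" for b b' x
  proof -
    have pxu: "\<pi> x *\<^sub>v u \<in> carrier_vec ?d" by (rule mult_mat_vec_carrier[OF car u(1)])
    have "star (c u b') (- x + y) = c b' (\<pi> x *\<^sub>v u) y" for y
    proof -
      have "c u b' (- y + x) = (\<pi> (- y) *\<^sub>v (\<pi> x *\<^sub>v u)) \<bullet>c b'"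
        unfolding c_def rep_add[OF rep] by (simp add: assoc_mult_mat_vec[OF car car u(1)])
      also have "\<dots> = (\<pi> x *\<^sub>v u) \<bullet>c (\<pi> (- (- y)) *\<^sub>v b')"
        unfolding rep_minus[OF rep, of "- y"] by (rule cscalar_prod_adjoint[OF car pxu b'])
      also have "\<dots> = cnj (c b' (\<pi> x *\<^sub>v u) y)"
        unfolding c_def using cscalar_prod_commute[OF pxu mult_mat_vec_carrier[OF car b']] by simp
      finally show ?thesis by (simp add: star_def minus_add)
    qed
    then have "conv (c u b) (c u b') x = ip (c u b) (c b' (\<pi> x *\<^sub>v u))" by (simp add: conv_ip)
    then show ?thesis unfolding c_def by (simp add: ip_coefficients[OF irr u(1) b b' pxu])
  qed
  have "AE x in m. conv (c u u) (c u v) x = conv (c u v) (c u u) x"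
    using gelfand bi[OF u(1,3)] bi[OF v] unfolding compact_gelfand_pair_def by blast
  then have "AE x in m. c u v x * cnj (c u v x) = 0"
  proof eventually_elim
    case (elim x)
    have "u \<bullet>c u \<noteq> 0" using conjugate_square_eq_0_vec[OF u(1)] u(2) by simp
    then have "cnj (v \<bullet>c (\<pi> x *\<^sub>v u)) = 0"
      using elim irr_dim[OF irr] by (simp add: conv_c u(1) v(1) orth)
    moreover have "c u v x = cnj (v \<bullet>c (\<pi> x *\<^sub>v u))"
      unfolding c_def by (rule cscalar_prod_commute[OF mult_mat_vec_carrier[OF car u(1)] v(1)])
    ultimately show ?case by simp
  qed
  \<comment> \<open>Commutativity almost everywhere suffices: it makes the norm of
    \<open>c u v\<close> zero, and Schur orthogonality evaluates that norm as a nonzero multiple of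
    the squared norms of \<open>u\<close> and \<open>v\<close>.\<close>
  then have "ip (c u v) (c u v) = 0" unfolding ip_def by (rule integral_eq_zero_AE)
  then have "(u \<bullet>c u) * cnj (v \<bullet>c v) = 0"
    using ip_coefficients[OF irr u(1) v(1) u(1) v(1)] irr_dim[OF irr] by (simp add: c_def[abs_def])
  then show ?thesis
    using conjugate_square_eq_0_vec[OF u(1)] conjugate_square_eq_0_vec[OF v(1)] u(2) by auto
qed

end

lemma fourier_transform_carrier: "fourier_transform \<mu> \<pi> \<in> carrier_mat (rep_dim \<pi>) (rep_dim \<pi>)"
  by (simp add: fourier_transform_def)

section \<open>Fourier transforms of invariant measures\<close>

locale gelfand_dual = compact_group_dual m D for m :: "'g::{topological_group_add, t2_space} measure" and D +
  fixes K :: "'g set" and e :: "('g \<Rightarrow> complex mat) \<Rightarrow> nat \<Rightarrow> complex vec" and \<mu> :: "'g measure"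
  assumes gelfand: "compact_gelfand_pair m K"
    and bases: "adapted_bases K D e"
    and finite_\<mu>: "finite_measure \<mu>" and regular_\<mu>: "regular_borel_measure \<mu>"
begin

lemma sets_\<mu>: "sets \<mu> = sets borel"
  using regular_\<mu> by (simp add: regular_borel_measure_def)

lemma integrable_\<mu>: "continuous_on UNIV f \<Longrightarrow> integrable \<mu> (f :: 'g \<Rightarrow> complex)"
  by (rule integrable_continuous[OF compact_UNIV finite_\<mu> sets_\<mu>])

lemma K_uminus: "k \<in> K \<Longrightarrow> - k \<in> K"
  using gelfand by (auto simp: compact_gelfand_pair_def closed_subgroup_def)

lemma basis: "\<pi> \<in> D \<Longrightarrow> orthonormal_basis (rep_dim \<pi>) (e \<pi>)"
  using bases by (simp add: adapted_bases_def)

lemma basis_carrier: "\<pi> \<in> D \<Longrightarrow> i \<in> {1..rep_dim \<pi>} \<Longrightarrow> e \<pi> i \<in> carrier_vec (rep_dim \<pi>)"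
  using basis by (simp add: orthonormal_basis_def)

lemma basis_orthonormal:
  "\<pi> \<in> D \<Longrightarrow> i \<in> {1..rep_dim \<pi>} \<Longrightarrow> j \<in> {1..rep_dim \<pi>} \<Longrightarrow> e \<pi> i \<bullet>c e \<pi> j = (if i = j then 1 else 0)"
  using basis by (simp add: orthonormal_basis_def)

lemma one_in_range: "\<pi> \<in> D \<Longrightarrow> 1 \<in> {1..rep_dim \<pi>}"
  using irr_dim[OF dual_irr] by (simp add: Suc_le_eq)

declare One_nat_def [simp del]

text \<open>Removing from \<open>w\<close> its component along the first basis vector leaves a fixed
  vector orthogonal to it, which \<open>spherical_vector_unique\<close> forces to be zero; so
  \<open>w\<close> is a multiple of that basis vector.\<close>

lemma fixed_vector_orthogonal:
  assumes \<pi>: "\<pi> \<in> spherical_part K D" and w: "w \<in> carrier_vec (rep_dim \<pi>)" "\<And>k. k \<in> K \<Longrightarrow> \<pi> k *\<^sub>v w = w"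
    and i: "i \<in> {1..rep_dim \<pi>}" "i \<noteq> 1"
  shows "w \<bullet>c e \<pi> i = 0"
proof -
  let ?d = "rep_dim \<pi>" and ?u = "e \<pi> 1"
  have D: "\<pi> \<in> D" using \<pi> by (simp add: spherical_part_def)
  note car = rep_carrier[OF dual_rep[OF D]]
  have u: "?u \<in> carrier_vec ?d" by (rule basis_carrier[OF D one_in_range[OF D]])
  have uu: "?u \<bullet>c ?u = 1" using basis_orthonormal[OF D one_in_range[OF D] one_in_range[OF D]] by simp
  have ufix: "\<pi> k *\<^sub>v ?u = ?u" if "k \<in> K" for k
    using bases \<pi> that by (simp add: adapted_bases_def)
  have u0: "?u \<noteq> 0\<^sub>v ?d" using uu conjugate_square_eq_0_vec[OF u] by auto
  define c where "c = w \<bullet>c ?u"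
  define v where "v = w - c \<cdot>\<^sub>v ?u"
  have v: "v \<in> carrier_vec ?d" unfolding v_def using u w by simp
  have "\<pi> k *\<^sub>v v = v" if k: "k \<in> K" for k
    unfolding v_def using mult_minus_distrib_mat_vec[OF car[of k] w(1), of "c \<cdot>\<^sub>v ?u"] u
    by (simp add: mult_mat_vec[OF car u] ufix[OF k] w(2)[OF k])
  moreover have "?u \<bullet>c v = 0"
  proof -
    have "v \<bullet>c ?u = w \<bullet>c ?u - c * (?u \<bullet>c ?u)"
      using u w(1) by (simp add: cscalar_prod_sum[of _ ?d] v_def left_diff_distrib sum_subtractf sum_distrib_left mult.assoc)
    then have "v \<bullet>c ?u = 0" by (simp add: uu c_def)
    then show ?thesis using cscalar_prod_commute[OF u v] by simp
  qed
  ultimately have "v = 0\<^sub>v ?d"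
    using spherical_vector_unique[OF gelfand dual_irr[OF D] u u0 ufix v] by blast
  then have "vec_index w j = c * vec_index ?u j" if "j < ?d" for j
  proof -
    have "vec_index v j = 0" using \<open>v = 0\<^sub>v ?d\<close> that by simp
    then show ?thesis using that u w(1) by (simp add: v_def)
  qed
  then have "w \<bullet>c e \<pi> i = c * (?u \<bullet>c e \<pi> i)"
    using u w(1) basis_carrier[OF D i(1)] by (simp add: cscalar_prod_sum[of _ ?d] sum_distrib_left mult.assoc)
  then show ?thesis using basis_orthonormal[OF D one_in_range[OF D] i(1)] i(2) by simp
qed

lemma fixed_vector_zero:
  assumes "\<pi> \<in> D" "\<pi> \<notin> spherical_part K D" "w \<in> carrier_vec (rep_dim \<pi>)" "\<And>k. k \<in> K \<Longrightarrow> \<pi> k *\<^sub>v w = w"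
  shows "w = 0\<^sub>v (rep_dim \<pi>)"
  using assms by (auto simp: spherical_part_def is_spherical_def)

abbreviation "ft \<equiv> fourier_transform \<mu>"

lemma ft_entry:
  assumes \<pi>: "\<pi> \<in> D" and ij: "i < rep_dim \<pi>" "j < rep_dim \<pi>"
  shows "ft \<pi> $$ (i, j) = (LINT g|\<mu>. \<pi> (- g) $$ (i, j))"
  using ij by (simp add: fourier_transform_def)

lemma cont_rep_uminus:
  "\<pi> \<in> D \<Longrightarrow> i < rep_dim \<pi> \<Longrightarrow> j < rep_dim \<pi> \<Longrightarrow> continuous_on UNIV (\<lambda>g. \<pi> (- g) $$ (i, j))"
  by (rule cont_compose[OF dual_cont]) (auto intro!: continuous_intros)

text \<open>Since \<open>\<pi> (- g)\<close> is the adjoint of \<open>\<pi> g\<close>, the transform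
  is the adjoint of the matrix of integrated entries. This links it to the criterion over the whole
  dual.\<close>

lemma hs_norm_ft:
  assumes \<pi>: "\<pi> \<in> D"
  shows "(hs_norm (ft \<pi>))\<^sup>2 = (\<Sum>i<rep_dim \<pi>. \<Sum>j<rep_dim \<pi>. (cmod (LINT x|\<mu>. \<pi> x $$ (i, j)))\<^sup>2)"
proof -
  let ?d = "rep_dim \<pi>"
  have "cmod (ft \<pi> $$ (i, j)) = cmod (LINT x|\<mu>. \<pi> x $$ (j, i))" if "i < ?d" "j < ?d" for i j
  proof -
    have "ft \<pi> $$ (i, j) = (LINT x|\<mu>. cnj (\<pi> x $$ (j, i)))"
      unfolding ft_entry[OF \<pi> that] using rep_minus_entry[OF dual_rep[OF \<pi>] that] by simp
    also have "\<dots> = cnj (LINT x|\<mu>. \<pi> x $$ (j, i))" by (rule Bochner_Integration.integral_cnj)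
    finally show ?thesis by simp
  qed
  then have "(hs_norm (ft \<pi>))\<^sup>2 = (\<Sum>i<?d. \<Sum>j<?d. (cmod (LINT x|\<mu>. \<pi> x $$ (j, i)))\<^sup>2)"
    unfolding hs_norm_square[OF fourier_transform_carrier] by simp
  also have "\<dots> = (\<Sum>i<?d. \<Sum>j<?d. (cmod (LINT x|\<mu>. \<pi> x $$ (i, j)))\<^sup>2)" by (rule sum.swap)
  finally show ?thesis .
qed

text \<open>The transform integrates \<open>\<pi> (- g)\<close>, so moving \<open>g\<close> by
  \<open>- k\<close> on the left produces a factor \<open>\<pi> k\<close> on the right.\<close>

lemma ft_left_invariant:
  assumes inv: "left_invariant K \<mu>" and \<pi>: "\<pi> \<in> D" and k: "k \<in> K"
  shows "ft \<pi> * \<pi> k = ft \<pi>"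
proof (rule eq_matI)
  let ?d = "rep_dim \<pi>"
  note rep = dual_rep[OF \<pi>]
  note car = rep_carrier[OF rep] and fc = fourier_transform_carrier[of \<mu> \<pi>]
  show "dim_row (ft \<pi> * \<pi> k) = dim_row (ft \<pi>)" "dim_col (ft \<pi> * \<pi> k) = dim_col (ft \<pi>)"
    using fc car[of k] by auto
  fix i j assume "i < dim_row (ft \<pi>)" "j < dim_col (ft \<pi>)"
  then have ij: "i < ?d" "j < ?d" using fc by auto
  have "ft \<pi> $$ (i, j) = (LINT g|\<mu>. \<pi> (- (- k + g)) $$ (i, j))"
    unfolding ft_entry[OF \<pi> ij]
    by (rule integral_left_translate[symmetric, OF sets_\<mu> inv _ cont_rep_uminus[OF \<pi> ij]]) (simp add: k)
  also have "\<dots> = (LINT g|\<mu>. (\<Sum>l<?d. \<pi> (- g) $$ (i, l) * \<pi> k $$ (l, j)))"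
    by (simp add: minus_add rep_add_entry[OF rep ij] flip: rep_add[OF rep] del: add_uminus_conv_diff)
  also have "\<dots> = (\<Sum>l<?d. (LINT g|\<mu>. \<pi> (- g) $$ (i, l)) * \<pi> k $$ (l, j))"
    using ij by (subst Bochner_Integration.integral_sum)
      (auto intro!: integrable_\<mu> continuous_intros cont_rep_uminus[OF \<pi>])
  also have "\<dots> = (ft \<pi> * \<pi> k) $$ (i, j)"
    unfolding index_mult_mat_sum[OF fc car ij] using ij by (intro sum.cong) (auto simp: ft_entry[OF \<pi>])
  finally show "(ft \<pi> * \<pi> k) $$ (i, j) = ft \<pi> $$ (i, j)" by simp
qed

lemma ft_right_invariant:
  assumes inv: "right_invariant K \<mu>" and \<pi>: "\<pi> \<in> D" and k: "k \<in> K"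
  shows "\<pi> k * ft \<pi> = ft \<pi>"
proof (rule eq_matI)
  let ?d = "rep_dim \<pi>"
  note rep = dual_rep[OF \<pi>]
  note car = rep_carrier[OF rep] and fc = fourier_transform_carrier[of \<mu> \<pi>]
  show "dim_row (\<pi> k * ft \<pi>) = dim_row (ft \<pi>)" "dim_col (\<pi> k * ft \<pi>) = dim_col (ft \<pi>)"
    using fc car[of k] by auto
  fix i j assume "i < dim_row (ft \<pi>)" "j < dim_col (ft \<pi>)"
  then have ij: "i < ?d" "j < ?d" using fc by auto
  have "ft \<pi> $$ (i, j) = (LINT g|\<mu>. \<pi> (- (g + - k)) $$ (i, j))"
    unfolding ft_entry[OF \<pi> ij]
    by (rule integral_right_translate[symmetric, OF sets_\<mu> inv _ cont_rep_uminus[OF \<pi> ij]]) (simp add: k)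
  also have "\<dots> = (LINT g|\<mu>. (\<Sum>l<?d. \<pi> k $$ (i, l) * \<pi> (- g) $$ (l, j)))"
    by (simp add: minus_add rep_add_entry[OF rep ij] del: add_uminus_conv_diff)
  also have "\<dots> = (\<Sum>l<?d. \<pi> k $$ (i, l) * (LINT g|\<mu>. \<pi> (- g) $$ (l, j)))"
    using ij by (subst Bochner_Integration.integral_sum)
      (auto intro!: integrable_\<mu> continuous_intros cont_rep_uminus[OF \<pi>])
  also have "\<dots> = (\<pi> k * ft \<pi>) $$ (i, j)"
    unfolding index_mult_mat_sum[OF car fc ij] using ij by (intro sum.cong) (auto simp: ft_entry[OF \<pi>])
  finally show "(\<pi> k * ft \<pi>) $$ (i, j) = ft \<pi> $$ (i, j)" by simp
qed

text \<open>A factor \<open>\<pi> k\<close> on the right constrains the kernel of the transform;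
  passing to adjoints brings it to the left, where it describes fixed vectors.\<close>

lemma adjoint_ft_fixed:
  assumes inv: "left_invariant K \<mu>" and \<pi>: "\<pi> \<in> D" and k: "k \<in> K" and w: "w \<in> carrier_vec (rep_dim \<pi>)"
  shows "\<pi> k *\<^sub>v (mat_adjoint (ft \<pi>) *\<^sub>v w) = mat_adjoint (ft \<pi>) *\<^sub>v w"
proof -
  note car = rep_carrier[OF dual_rep[OF \<pi>]] and fc = fourier_transform_carrier[of \<mu> \<pi>]
  have "\<pi> k * mat_adjoint (ft \<pi>) = mat_adjoint (ft \<pi> * \<pi> (- k))"
    using rep_minus[OF dual_rep[OF \<pi>], of "- k"] by (simp add: mat_adjoint_mult[OF fc car])
  also have "\<dots> = mat_adjoint (ft \<pi>)" by (simp add: ft_left_invariant[OF inv \<pi> K_uminus[OF k]])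
  finally show ?thesis
    using assoc_mult_mat_vec[OF car mat_adjoint_carrier[OF fc] w, of k] by simp
qed

lemma ft_fixed:
  assumes inv: "right_invariant K \<mu>" and \<pi>: "\<pi> \<in> D" and k: "k \<in> K" and w: "w \<in> carrier_vec (rep_dim \<pi>)"
  shows "\<pi> k *\<^sub>v (ft \<pi> *\<^sub>v w) = ft \<pi> *\<^sub>v w"
  using assoc_mult_mat_vec[OF rep_carrier[OF dual_rep[OF \<pi>]] fourier_transform_carrier w, of k \<mu>]
  by (simp add: ft_right_invariant[OF inv \<pi> k])

lemma matrix_entry_adjoint:
  assumes \<pi>: "\<pi> \<in> D" and ij: "i \<in> {1..rep_dim \<pi>}" "j \<in> {1..rep_dim \<pi>}"
  shows "matrix_entry (e \<pi>) (ft \<pi>) i j = cnj ((mat_adjoint (ft \<pi>) *\<^sub>v e \<pi> j) \<bullet>c e \<pi> i)"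
  unfolding matrix_entry_def
    cscalar_prod_adjoint[OF fourier_transform_carrier basis_carrier[OF \<pi> ij(1)] basis_carrier[OF \<pi> ij(2)]]
  by (rule cscalar_prod_commute[OF basis_carrier[OF \<pi> ij(1)]
        mult_mat_vec_carrier[OF mat_adjoint_carrier[OF fourier_transform_carrier] basis_carrier[OF \<pi> ij(2)]]])

text \<open>By \<open>matrix_entry_adjoint\<close> the entry is, up to conjugation, component
  \<open>i\<close> of a \<open>K\<close>-fixed vector in the range of the adjoint. Hence it is the
  first index that is confined to 1.\<close>

lemma matrix_entry_left:
  assumes inv: "left_invariant K \<mu>" and \<pi>: "\<pi> \<in> D" and ij: "i \<in> {1..rep_dim \<pi>}" "j \<in> {1..rep_dim \<pi>}"
    and "\<pi> \<notin> spherical_part K D \<or> i \<noteq> 1"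
  shows "matrix_entry (e \<pi>) (ft \<pi>) i j = 0"
proof -
  let ?w = "mat_adjoint (ft \<pi>) *\<^sub>v e \<pi> j"
  have w: "?w \<in> carrier_vec (rep_dim \<pi>)"
    by (rule mult_mat_vec_carrier[OF mat_adjoint_carrier[OF fourier_transform_carrier] basis_carrier[OF \<pi> ij(2)]])
  have fixed: "\<pi> k *\<^sub>v ?w = ?w" if "k \<in> K" for k
    by (rule adjoint_ft_fixed[OF inv \<pi> that basis_carrier[OF \<pi> ij(2)]])
  have "?w \<bullet>c e \<pi> i = 0"
  proof (cases "\<pi> \<in> spherical_part K D")
    case True
    then show ?thesis using fixed_vector_orthogonal[OF True w fixed ij(1)] assms by auto
  next
    case False
    then show ?thesis using fixed_vector_zero[OF \<pi> False w fixed] basis_carrier[OF \<pi> ij(1)] by simp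
  qed
  then show ?thesis by (simp add: matrix_entry_adjoint[OF \<pi> ij])
qed

text \<open>Here the range of the transform itself is \<open>K\<close>-fixed, and \<open>j\<close>
  selects the component, so the second index is confined to 1.\<close>

lemma matrix_entry_right:
  assumes inv: "right_invariant K \<mu>" and \<pi>: "\<pi> \<in> D" and ij: "i \<in> {1..rep_dim \<pi>}" "j \<in> {1..rep_dim \<pi>}"
    and "\<pi> \<notin> spherical_part K D \<or> j \<noteq> 1"
  shows "matrix_entry (e \<pi>) (ft \<pi>) i j = 0"
proof -
  let ?w = "ft \<pi> *\<^sub>v e \<pi> i"
  have w: "?w \<in> carrier_vec (rep_dim \<pi>)"
    by (rule mult_mat_vec_carrier[OF fourier_transform_carrier basis_carrier[OF \<pi> ij(1)]])
  have fixed: "\<pi> k *\<^sub>v ?w = ?w" if "k \<in> K" for k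
    by (rule ft_fixed[OF inv \<pi> that basis_carrier[OF \<pi> ij(1)]])
  show ?thesis
  proof (cases "\<pi> \<in> spherical_part K D")
    case True
    then show ?thesis using fixed_vector_orthogonal[OF True w fixed ij(2)] assms by (auto simp: matrix_entry_def)
  next
    case False
    then show ?thesis using fixed_vector_zero[OF \<pi> False w fixed] basis_carrier[OF \<pi> ij(2)]
      by (simp add: matrix_entry_def)
  qed
qed

lemma hs_norm_entries:
  "\<pi> \<in> D \<Longrightarrow> (hs_norm (ft \<pi>))\<^sup>2 =
    (\<Sum>i=1..rep_dim \<pi>. \<Sum>j=1..rep_dim \<pi>. (cmod (matrix_entry (e \<pi>) (ft \<pi>) i j))\<^sup>2)"
  by (rule hs_norm_square_matrix_entry[OF fourier_transform_carrier basis])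

lemma hs_norm_left:
  assumes inv: "left_invariant K \<mu>" and \<pi>: "\<pi> \<in> spherical_part K D"
  shows "(hs_norm (ft \<pi>))\<^sup>2 = (\<Sum>j=1..rep_dim \<pi>. (cmod (matrix_entry (e \<pi>) (ft \<pi>) 1 j))\<^sup>2)"
proof -
  have D: "\<pi> \<in> D" using \<pi> by (simp add: spherical_part_def)
  have "(hs_norm (ft \<pi>))\<^sup>2 = (\<Sum>i=1..rep_dim \<pi>. if i = 1 then
      (\<Sum>j=1..rep_dim \<pi>. (cmod (matrix_entry (e \<pi>) (ft \<pi>) 1 j))\<^sup>2) else 0)"
    unfolding hs_norm_entries[OF D]
    by (intro sum.cong refl) (auto intro!: sum.neutral simp: matrix_entry_left[OF inv D])
  then show ?thesis using one_in_range[OF D] by simp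
qed

lemma hs_norm_right:
  assumes inv: "right_invariant K \<mu>" and \<pi>: "\<pi> \<in> spherical_part K D"
  shows "(hs_norm (ft \<pi>))\<^sup>2 = (\<Sum>i=1..rep_dim \<pi>. (cmod (matrix_entry (e \<pi>) (ft \<pi>) i 1))\<^sup>2)"
proof -
  have D: "\<pi> \<in> D" using \<pi> by (simp add: spherical_part_def)
  have "(\<Sum>j=1..rep_dim \<pi>. (cmod (matrix_entry (e \<pi>) (ft \<pi>) i j))\<^sup>2) =
      (cmod (matrix_entry (e \<pi>) (ft \<pi>) i 1))\<^sup>2" if i: "i \<in> {1..rep_dim \<pi>}" for i
  proof -
    have "(\<Sum>j=1..rep_dim \<pi>. (cmod (matrix_entry (e \<pi>) (ft \<pi>) i j))\<^sup>2) =
        (\<Sum>j=1..rep_dim \<pi>. if j = 1 then (cmod (matrix_entry (e \<pi>) (ft \<pi>) i 1))\<^sup>2 else 0)"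
      by (intro sum.cong refl) (auto simp: matrix_entry_right[OF inv D i])
    then show ?thesis using one_in_range[OF D] by simp
  qed
  then show ?thesis unfolding hs_norm_entries[OF D] by simp
qed

text \<open>The spherical function has \<open>\<pi> g\<close> in the second slot of the inner
  product; moving it to the first gives \<open>\<pi> (- g)\<close>, the integrand of the Fourier
  transform.\<close>

lemma spherical_transform_entry:
  assumes \<pi>: "\<pi> \<in> D"
  shows "spherical_transform \<mu> (spherical_function e \<pi>) = matrix_entry (e \<pi>) (ft \<pi>) 1 1"
proof -
  let ?d = "rep_dim \<pi>" and ?u = "e \<pi> 1"
  note rep = dual_rep[OF \<pi>]
  note car = rep_carrier[OF rep] and fc = fourier_transform_carrier[of \<mu> \<pi>]
  have u: "?u \<in> carrier_vec ?d" by (rule basis_carrier[OF \<pi> one_in_range[OF \<pi>]])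
  have expand: "(A *\<^sub>v ?u) \<bullet>c ?u = (\<Sum>i<?d. \<Sum>j<?d. A $$ (i, j) * (vec_index ?u j * cnj (vec_index ?u i)))"
    if A: "A \<in> carrier_mat ?d ?d" for A
    unfolding cscalar_prod_sum[OF mult_mat_vec_carrier[OF A u] u]
    by (intro sum.cong) (auto simp: index_mult_mat_vec_sum[OF A u] sum_distrib_right mult.assoc simp del: index_mult_mat_vec)
  have "spherical_function e \<pi> g = (\<pi> (- g) *\<^sub>v ?u) \<bullet>c ?u" for g
    unfolding spherical_function_def cscalar_prod_adjoint[OF car u u] rep_minus[OF rep, symmetric] by simp
  then have "spherical_transform \<mu> (spherical_function e \<pi>) =
      (LINT g|\<mu>. (\<Sum>i<?d. \<Sum>j<?d. \<pi> (- g) $$ (i, j) * (vec_index ?u j * cnj (vec_index ?u i))))"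
    by (simp add: spherical_transform_def expand[OF car])
  also have "\<dots> = (\<Sum>i<?d. LINT g|\<mu>. (\<Sum>j<?d. \<pi> (- g) $$ (i, j) * (vec_index ?u j * cnj (vec_index ?u i))))"
    by (rule Bochner_Integration.integral_sum)
       (auto intro!: integrable_\<mu> continuous_intros cont_rep_uminus[OF \<pi>])
  also have "\<dots> = (\<Sum>i<?d. \<Sum>j<?d. LINT g|\<mu>. \<pi> (- g) $$ (i, j) * (vec_index ?u j * cnj (vec_index ?u i)))"
    by (intro sum.cong refl Bochner_Integration.integral_sum)
       (auto intro!: integrable_\<mu> continuous_intros cont_rep_uminus[OF \<pi>])
  also have "\<dots> = (ft \<pi> *\<^sub>v ?u) \<bullet>c ?u"
    unfolding expand[OF fc] by (intro sum.cong refl) (simp add: ft_entry[OF \<pi>])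
  finally show ?thesis by (simp add: matrix_entry_def)
qed

lemma hs_norm_bi:
  assumes inv: "bi_invariant K \<mu>" and \<pi>: "\<pi> \<in> spherical_part K D"
  shows "(hs_norm (ft \<pi>))\<^sup>2 = (cmod (spherical_transform \<mu> (spherical_function e \<pi>)))\<^sup>2"
proof -
  have D: "\<pi> \<in> D" using \<pi> by (simp add: spherical_part_def)
  have l: "left_invariant K \<mu>" and r: "right_invariant K \<mu>" using inv by (auto simp: bi_invariant_def)
  have "(hs_norm (ft \<pi>))\<^sup>2 =
      (\<Sum>j=1..rep_dim \<pi>. if j = 1 then (cmod (matrix_entry (e \<pi>) (ft \<pi>) 1 1))\<^sup>2 else 0)"
    unfolding hs_norm_left[OF l \<pi>]
    by (intro sum.cong refl) (auto simp: matrix_entry_right[OF r D one_in_range[OF D]])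
  then show ?thesis using one_in_range[OF D] by (simp add: spherical_transform_entry[OF D])
qed

text \<open>A non-spherical representation has no nonzero \<open>K\<close>-fixed vector, so either
  invariance makes the transform vanish there and the sum over the dual can be restricted.\<close>

lemma has_L2_density_spherical:
  assumes inv: "left_invariant K \<mu> \<or> right_invariant K \<mu>"
  shows "has_L2_density m \<mu> \<longleftrightarrow>
    (\<Sum>\<^sub>\<infinity>\<pi>\<in>spherical_part K D. ennreal (real (rep_dim \<pi>) * (hs_norm (ft \<pi>))\<^sup>2)) < \<infinity>"
proof -
  have zero: "hs_norm (ft \<pi>) = 0" if "\<pi> \<in> D - spherical_part K D" for \<pi>
  proof -
    have \<pi>: "\<pi> \<in> D" "\<pi> \<notin> spherical_part K D" using that by auto
    have "(hs_norm (ft \<pi>))\<^sup>2 = 0"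
      unfolding hs_norm_entries[OF \<pi>(1)] using inv \<pi>
      by (intro sum.neutral ballI) (auto simp: matrix_entry_left matrix_entry_right)
    then show ?thesis by simp
  qed
  have "(\<Sum>\<^sub>\<infinity>\<pi>\<in>D. ennreal (real (rep_dim \<pi>) * (\<Sum>i<rep_dim \<pi>. \<Sum>j<rep_dim \<pi>. (cmod (LINT x|\<mu>. \<pi> x $$ (i, j)))\<^sup>2))) =
      (\<Sum>\<^sub>\<infinity>\<pi>\<in>spherical_part K D. ennreal (real (rep_dim \<pi>) * (hs_norm (ft \<pi>))\<^sup>2))"
    by (rule infsum_cong_neutral) (auto simp: spherical_part_def zero hs_norm_ft[symmetric])
  then show ?thesis unfolding has_L2_density_iff[OF finite_\<mu> regular_\<mu>] by simp
qed

end

theorem theorem3p3: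
  fixes m \<mu> :: "'g::{topological_group_add, t2_space} measure"
    and K :: "'g set"
    and Ghat :: "('g \<Rightarrow> complex mat) set"
    and e :: "('g \<Rightarrow> complex mat) \<Rightarrow> nat \<Rightarrow> complex vec"
  assumes "compact_gelfand_pair m K"
    and "dual_representatives Ghat"
    and "adapted_bases K Ghat e"
    and "finite_measure \<mu>"
    and "regular_borel_measure \<mu>"
  shows
    "(left_invariant K \<mu> \<longrightarrow>
        (has_L2_density m \<mu> \<longleftrightarrow>
          (\<Sum>\<^sub>\<infinity>\<pi>\<in>spherical_part K Ghat.
              ennreal (real (rep_dim \<pi>) * (hs_norm (fourier_transform \<mu> \<pi>))\<^sup>2)) =
          (\<Sum>\<^sub>\<infinity>\<pi>\<in>spherical_part K Ghat.
              ennreal (real (rep_dim \<pi>) *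
                (\<Sum>j=1..rep_dim \<pi>. (cmod (matrix_entry (e \<pi>) (fourier_transform \<mu> \<pi>) 1 j))\<^sup>2))) \<and>
          (\<Sum>\<^sub>\<infinity>\<pi>\<in>spherical_part K Ghat.
              ennreal (real (rep_dim \<pi>) *
                (\<Sum>j=1..rep_dim \<pi>. (cmod (matrix_entry (e \<pi>) (fourier_transform \<mu> \<pi>) 1 j))\<^sup>2))) < \<infinity>)) \<and>
     (right_invariant K \<mu> \<longrightarrow>
        (has_L2_density m \<mu> \<longleftrightarrow>
          (\<Sum>\<^sub>\<infinity>\<pi>\<in>spherical_part K Ghat.
              ennreal (real (rep_dim \<pi>) * (hs_norm (fourier_transform \<mu> \<pi>))\<^sup>2)) =
          (\<Sum>\<^sub>\<infinity>\<pi>\<in>spherical_part K Ghat.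
              ennreal (real (rep_dim \<pi>) *
                (\<Sum>i=1..rep_dim \<pi>. (cmod (matrix_entry (e \<pi>) (fourier_transform \<mu> \<pi>) i 1))\<^sup>2))) \<and>
          (\<Sum>\<^sub>\<infinity>\<pi>\<in>spherical_part K Ghat.
              ennreal (real (rep_dim \<pi>) *
                (\<Sum>i=1..rep_dim \<pi>. (cmod (matrix_entry (e \<pi>) (fourier_transform \<mu> \<pi>) i 1))\<^sup>2))) < \<infinity>)) \<and>
     (bi_invariant K \<mu> \<longrightarrow>
        (has_L2_density m \<mu> \<longleftrightarrow>
          (\<Sum>\<^sub>\<infinity>\<pi>\<in>spherical_part K Ghat.
              ennreal (real (rep_dim \<pi>) *
                (cmod (spherical_transform \<mu> (spherical_function e \<pi>)))\<^sup>2)) < \<infinity>))"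
proof -
  have "compact (UNIV :: 'g set)" "normalised_haar_measure m"
    using assms(1) by (simp_all add: compact_gelfand_pair_def)
  then interpret gelfand_dual m Ghat K e \<mu>
    by (intro gelfand_dual.intro gelfand_dual_axioms.intro compact_group_dual.intro
        compact_group_dual_axioms.intro compact_group.intro assms)
  let ?sum = "\<lambda>f. \<Sum>\<^sub>\<infinity>\<pi>\<in>spherical_part K Ghat. ennreal (real (rep_dim \<pi>) * f \<pi>)"
  \<comment> \<open>The terms agree one by one, so the sums agree even when infinite. Under
    invariance the equality inside the equivalence is automatic and finiteness is its
    content.\<close>
  have left: "?sum (\<lambda>\<pi>. (hs_norm (ft \<pi>))\<^sup>2) =
      ?sum (\<lambda>\<pi>. \<Sum>j=1..rep_dim \<pi>. (cmod (matrix_entry (e \<pi>) (ft \<pi>) 1 j))\<^sup>2)" if "left_invariant K \<mu>"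
    by (rule infsum_cong) (simp only: hs_norm_left[OF that])
  have right: "?sum (\<lambda>\<pi>. (hs_norm (ft \<pi>))\<^sup>2) =
      ?sum (\<lambda>\<pi>. \<Sum>i=1..rep_dim \<pi>. (cmod (matrix_entry (e \<pi>) (ft \<pi>) i 1))\<^sup>2)" if "right_invariant K \<mu>"
    by (rule infsum_cong) (simp only: hs_norm_right[OF that])
  have bi: "?sum (\<lambda>\<pi>. (hs_norm (ft \<pi>))\<^sup>2) =
      ?sum (\<lambda>\<pi>. (cmod (spherical_transform \<mu> (spherical_function e \<pi>)))\<^sup>2)" if "bi_invariant K \<mu>"
    by (rule infsum_cong) (simp only: hs_norm_bi[OF that])
  show ?thesis
  proof (intro conjI impI)
    assume inv: "left_invariant K \<mu>"
    then show "has_L2_density m \<mu> \<longleftrightarrow> ?sum (\<lambda>\<pi>. (hs_norm (ft \<pi>))\<^sup>2) =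
        ?sum (\<lambda>\<pi>. \<Sum>j=1..rep_dim \<pi>. (cmod (matrix_entry (e \<pi>) (ft \<pi>) 1 j))\<^sup>2) \<and>
        ?sum (\<lambda>\<pi>. \<Sum>j=1..rep_dim \<pi>. (cmod (matrix_entry (e \<pi>) (ft \<pi>) 1 j))\<^sup>2) < \<infinity>"
      unfolding left[OF inv, symmetric] by (simp add: has_L2_density_spherical)
  next
    assume inv: "right_invariant K \<mu>"
    then show "has_L2_density m \<mu> \<longleftrightarrow> ?sum (\<lambda>\<pi>. (hs_norm (ft \<pi>))\<^sup>2) =
        ?sum (\<lambda>\<pi>. \<Sum>i=1..rep_dim \<pi>. (cmod (matrix_entry (e \<pi>) (ft \<pi>) i 1))\<^sup>2) \<and>
        ?sum (\<lambda>\<pi>. \<Sum>i=1..rep_dim \<pi>. (cmod (matrix_entry (e \<pi>) (ft \<pi>) i 1))\<^sup>2) < \<infinity>"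
      unfolding right[OF inv, symmetric] by (simp add: has_L2_density_spherical)
  next
    assume inv: "bi_invariant K \<mu>"
    then show "has_L2_density m \<mu> \<longleftrightarrow>
        ?sum (\<lambda>\<pi>. (cmod (spherical_transform \<mu> (spherical_function e \<pi>)))\<^sup>2) < \<infinity>"
      unfolding bi[OF inv, symmetric] by (simp add: has_L2_density_spherical bi_invariant_def)
  qed
qed

end
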